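(* Let $\mathcal V=\bigoplus_r\mathcal V^r$ be a $\mathbf Z$-graded vector space, $|0\rangle\in\mathcal V^0$ a non-zero vector, and $\partial$ a degree $0$ endomorphism of $\mathcal V$. Let $\{a^i\}$ be a countable ordered set of vectors in $\mathcal V$, with $a^i\in\mathcal V^{r_i}$, and suppose given homogeneous raviolo fields $$A^i(z)=\sum_{m<0}z^{-m-1}A^i_m+\sum_{m\ge0}\Omega_z^mA^i_m$$ on $\mathcal V$, of degree $r_i$, such that: 1) $A^i_{-1}|0\rangle=a^i$ and $A^i_m|0\rangle=0$ for all $i$ and all $m\ge0$; 2) $\partial|0\rangle=0$ and $[\partial,A^i(z)]=\partial_zA^i(z)$ for all $i$; 3) all the fields $A^i(z)$ are mutually local; 4) $\mathcal V$ is spanned by the vectors $A^{i_1}_{j_1}\cdots A^{i_l}_{j_l}|0\rangle$ with $j_k<0$ (and $l\ge0$). Then the assignment $$Y(A^{i_1}_{j_1}\cdots A^{i_l}_{j_l}|0\rangle,z)=\frac{1}{(-j_1-1)!\cdots(-j_l-1)!}\,{:\!\partial_z^{-j_1-1}A^{i_1}\cdots\partial_z^{-j_l-1}A^{i_l}\!:}(z)$$ determines a well-defined raviolo vertex algebra structure on $\mathcal V$ (with vacuum $|0\rangle$ and translation operator $\partial$). Moreover, this is the unique raviolo vertex algebra structure on $\mathcal V$ (with this vacuum and translation operator) satisfying 1)–4) and such that $Y(a^i,z)=A^i(z)$ for all $i$.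
   Context: Conventions. Vector spaces are over $\mathbf C$ and $\mathbf Z$-graded (cohomological degree $|\cdot|$); $[x,y]=xy-(-1)^{|x||y|}yx$; Koszul signs are used throughout. Raviolo functions. $\mathcal K=\mathbf C\langle\!\langle z\rangle\!\rangle$ is the graded commutative algebra with degree 0 part $\mathbf C[\![z]\!]$ and degree 1 part the span (finite combinations) of symbols $\Omega_z^m$, $m\ge 0$, with $z^n\Omega_z^m=\Omega_z^{m-n}$ if $n\le m$, $z^n\Omega_z^m=0$ if $n>m$, $\Omega_z^n\Omega_z^m=0$. $\mathcal K_{dist}$ has degree 0 part $\mathbf C[\![z]\!]$ and degree 1 part all formal infinite sums $\sum_{m\ge0}a_m\Omega_z^m$. On both, $\partial_z z^n=nz^{n-1}$, $\partial_z\Omega_z^m=-(m+1)\Omega_z^{m+1}$. For $R$ a graded space, $R\langle\!\langle z\rangle\!\rangle$ is the space of series $\sum_{n<0}z^{-n-1}r_n+\sum_{n\ge0}\Omega_z^n r_n$, $r_n\in R$, $r_n=0$ for $n\gg0$; $R\langle\!\langle z\rangle\!\rangle\langle\!\langle w\rangle\!\rangle=(R\langle\!\langle z\rangle\!\rangle)\langle\!\langle w\rangle\!\rangle$. Tensor products $\mathrm{End}(\mathcal V)\otimes\mathcal K_{dist}$ denote $\mathrm{End}(\mathcal V)$-valued (infinite) series. $\mathcal K_{z,w,z-w}$ is the quotient of the free graded commutative algebra $\mathbf C[\![z,w]\!][\Omega_z^n,\Omega_w^m,\Omega_{z-w}^k]_{n,m,k\ge0}$ ($\Omega$'s of degree 1)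 by: for $x\in\{z,w,z-w\}$, $x^n\Omega_x^m=\Omega_x^{m-n}$ ($n\le m$), $x^n\Omega_x^m=0$ ($n>m$), $\Omega_x^n\Omega_x^m=0$; and $\Omega^0_{z-w}\Omega^0_z+\Omega^0_w\Omega^0_{z-w}+\Omega^0_z\Omega^0_w=0$ with all its $\partial_z,\partial_w$-derivatives ($\partial_x\Omega_x^m=-(m+1)\Omega_x^{m+1}$ for $x=z,w$, $\partial_z\Omega_{z-w}^m=-(m+1)\Omega_{z-w}^{m+1}=-\partial_w\Omega_{z-w}^m$). Expansion maps: (i) to $\mathbf C\langle\!\langle z\rangle\!\rangle\langle\!\langle w\rangle\!\rangle$, $\Omega_{z-w}^m\mapsto\sum_{n\ge0}\binom{m+n}{n}w^n\Omega_z^{m+n}$; (ii) to $\mathbf C\langle\!\langle w\rangle\!\rangle\langle\!\langle z\rangle\!\rangle$, $\Omega_{z-w}^m\mapsto(-1)^m\sum_{n\ge0}\binom{m+n}{n}z^n\Omega_w^{m+n}$; both fix the other generators. Fields. A raviolo field on $\mathcal V$ is $A(z)=\sum_{m<0}z^{-m-1}A_m+\sum_{m\ge0}\Omega_z^mA_m\in\mathrm{End}(\mathcal V)\otimes\mathcal K_{dist}$ such that for each $v$, $A_mv=0$ for $m\gg0$; homogeneous of degree $|A|$ if $A_m$ has degree $|A|$ for $m<0$ and $|A|-1$ for $m\ge0$. Put $A(z)_+=\sum_{m<0}z^{-m-1}A_m$, $A(z)_-=\sum_{m\ge0}\Omega_z^mA_m$. Fields $A(z),B(w)$ are mutually local if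 for all $v\in\mathcal V$, $\varphi\in\mathcal V^*$, $\langle\varphi,A(z)B(w)v\rangle$ and $(-1)^{|A||B|}\langle\varphi,B(w)A(z)v\rangle$ are the expansions (i) and (ii) of one and the same $f_{v,\varphi}\in\mathcal K_{z,w,z-w}$, with the pole order in $z-w$ (largest $m$ for which $\Omega_{z-w}^m$ occurs) uniformly bounded in $v,\varphi$. The normal-ordered product is ${:\!A(z)B(w)\!:}=A(z)_+B(w)+(-1)^{|A||B|}B(w)A(z)_-$, and ${:\!AB\!:}(z)$ is its specialization at $w=z$, again a field. Longer products are nested, ${:\!A_1A_2\cdots A_l\!:}={:\!A_1{:\!A_2\cdots A_l\!:}\!:}$; the product of one field is that field and the empty product is $\mathrm{id}$. A raviolo vertex algebra $(\mathcal V,|0\rangle,\partial,Y)$: a $\mathbf Z$-graded space $\mathcal V$, $|0\rangle\in\mathcal V^0$, a degree 0 endomorphism $\partial$, a degree 0 linear map $Y(-,z):\mathcal V\to\mathrm{End}(\mathcal V)\otimes\mathcal K_{dist}$ such that every $Y(a,z)=\sum_{m<0}z^{-m-1}a_{(m)}+\sum_{m\ge0}\Omega_z^ma_{(m)}$ is a raviolo field; $[\partial,Y(a,z)]=\partial_zY(a,z)$; $\partial|0\rangle=0$, $Y(|0\rangle,z)=\mathrm{id}$, $Y(a,z)|0\rangle\in\mathcal V[\![z]\!]$ with value $a$ at $z=0$; all $Y(a,z),Y(b,w)$ are mutually local. *)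

theory Defs
  imports
    Complex_Main
    "HOL-Library.Countable_Set"
    "HOL-Library.Poly_Mapping"
    "HOL-Computational_Algebra.Formal_Power_Series"
begin

section \<open>Superrings and raviolo series\<close>

text \<open>
  A superring is a ring with a parity involution, \<open>par x = (-1)\<^bsup>|x|\<^esup> x\<close> on homogeneous \<open>x\<close>.
  It only serves to produce the Koszul signs in products of raviolo series.
\<close>

class superring = ring_1 +
  fixes par :: "'a \<Rightarrow> 'a"
  assumes par_add: "par (x + y) = par x + par y"
    and par_mult: "par (x * y) = par x * par y"
    and par_par: "par (par x) = x"
begin

lemma par_zero [simp]: "par 0 = 0"
  using par_add [of 0 0] by simp

lemma par_one [simp]: "par 1 = 1"
  by (metis mult_1_left mult_1_right par_mult par_par)

lemma par_uminus: "par (- x) = - par x"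
  by (metis add_eq_0_iff par_add par_zero right_minus)

lemma par_sum: "par (sum f A) = (\<Sum>a\<in>A. par (f a))"
  by (induction A rule: infinite_finite_induct) (simp_all add: par_add)

lemma par_of_nat [simp]: "par (of_nat n) = of_nat n"
  by (induction n) (simp_all add: par_add)

lemma par_of_int [simp]: "par (of_int n) = of_int n"
  by (cases n rule: int_cases2) (simp_all add: par_uminus)

end

instantiation complex :: superring
begin
definition par_complex :: "complex \<Rightarrow> complex" where "par_complex x = x"
instance by standard (simp_all add: par_complex_def)
end

text \<open>
  \<open>R\<langle>\<langle>z\<rangle>\<rangle>\<close>: the coefficient with index \<open>n\<close> belongs to the basis element \<open>e\<^sub>n\<close>, where
  \<open>e\<^sub>n = z\<^bsup>-n-1\<^esup>\<close> for \<open>n < 0\<close> and \<open>e\<^sub>n = \<Omega>\<^sub>z\<^sup>n\<close> for \<open>n \<ge> 0\<close>.  Coefficients stand to the right of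
  the basis elements.
\<close>

typedef (overloaded) 'r raviolo = "{f :: int \<Rightarrow> 'r::zero. \<exists>N. \<forall>n\<ge>N. f n = 0}"
  morphisms rcoeff Abs_raviolo
  by auto

setup_lifting type_definition_raviolo

text \<open>
  In all cases \<open>e\<^sub>a e\<^sub>b\<close> is either \<open>e\<^bsub>a+b+1\<^esub>\<close> or \<open>0\<close>: this covers \<open>z\<^sup>n z\<^sup>m = z\<^bsup>n+m\<^esup>\<close>,
  \<open>z\<^sup>n \<Omega>\<^sup>m = \<Omega>\<^bsup>m-n\<^esup>\<close> for \<open>n \<le> m\<close>, \<open>z\<^sup>n \<Omega>\<^sup>m = 0\<close> for \<open>n > m\<close>, and \<open>\<Omega>\<^sup>n \<Omega>\<^sup>m = 0\<close>.
\<close>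

definition basis_mult_nonzero :: "int \<Rightarrow> int \<Rightarrow> bool" where
  "basis_mult_nonzero a b \<longleftrightarrow> (a < 0 \<and> b < 0) \<or> ((a < 0 \<or> b < 0) \<and> a + b + 1 \<ge> 0)"

text \<open>The Koszul sign for moving \<open>e\<^sub>n\<close> to the left past \<open>x\<close>.\<close>

definition par_past :: "int \<Rightarrow> 'a::superring \<Rightarrow> 'a" where
  "par_past n x = (if n \<ge> 0 then par x else x)"

lemma par_past_zero [simp]: "par_past n 0 = 0"
  by (simp add: par_past_def)

lemma par_past_one [simp]: "par_past n 1 = 1"
  by (simp add: par_past_def)

lemma par_past_add: "par_past n (x + y) = par_past n x + par_past n y"
  by (simp add: par_past_def par_add)

lemma par_past_mult: "par_past n (x * y) = par_past n x * par_past n y"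
  by (simp add: par_past_def par_mult)

lemma par_past_sum: "par_past n (sum f A) = (\<Sum>a\<in>A. par_past n (f a))"
  by (simp add: par_past_def par_sum)

lemma par_past_par_past:
  "basis_mult_nonzero a b \<Longrightarrow> par_past (a + b + 1) x = par_past b (par_past a x)"
  by (auto simp: par_past_def basis_mult_nonzero_def)

lemma basis_mult_nonzero_assoc:
  "basis_mult_nonzero b c \<and> basis_mult_nonzero a (b + c + 1) \<longleftrightarrow>
   basis_mult_nonzero a b \<and> basis_mult_nonzero (a + b + 1) c"
  unfolding basis_mult_nonzero_def by (cases "a < 0"; cases "b < 0"; cases "c < 0") auto

definition raviolo_mult_coeff ::
    "(int \<Rightarrow> 'r::superring) \<Rightarrow> (int \<Rightarrow> 'r) \<Rightarrow> int \<Rightarrow> 'r" where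
  "raviolo_mult_coeff f g N =
     Sum_any (\<lambda>a. if basis_mult_nonzero a (N - 1 - a)
                  then par_past (N - 1 - a) (f a) * g (N - 1 - a) else 0)"

lemma raviolo_mult_coeff_box1:
  assumes "\<And>n. n \<ge> B \<Longrightarrow> f n = 0" "\<And>n. n \<ge> B \<Longrightarrow> g n = 0" "finite J" "{N - B..<B} \<subseteq> J"
  shows "raviolo_mult_coeff f g N =
    (\<Sum>a\<in>J. if basis_mult_nonzero a (N - 1 - a)
            then par_past (N - 1 - a) (f a) * g (N - 1 - a) else 0)"
  unfolding raviolo_mult_coeff_def
proof (rule Sum_any.expand_superset)
  show "{a. (if basis_mult_nonzero a (N - 1 - a)
      then par_past (N - 1 - a) (f a) * g (N - 1 - a) else 0) \<noteq> 0} \<subseteq> J"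
  proof safe
    fix a
    assume a: "(if basis_mult_nonzero a (N - 1 - a)
      then par_past (N - 1 - a) (f a) * g (N - 1 - a) else 0) \<noteq> 0"
    have "a < B"
      using a assms(1)[of a] by (force split: if_splits)
    moreover have "N - 1 - a < B"
      using a assms(2)[of "N - 1 - a"] by (force split: if_splits)
    ultimately show "a \<in> J" using assms(4) by auto
  qed
qed fact

lemma raviolo_mult_coeff_box:
  assumes "\<And>n. n \<ge> B \<Longrightarrow> f n = 0" "\<And>n. n \<ge> B \<Longrightarrow> g n = 0" "finite J" "{N - B..<B} \<subseteq> J"
  shows "raviolo_mult_coeff f g N =
    (\<Sum>a\<in>J. \<Sum>b\<in>J. if a + b + 1 = N \<and> basis_mult_nonzero a b then par_past b (f a) * g b else 0)"
  unfolding raviolo_mult_coeff_box1[of B f g J N, OF assms(1) assms(2) assms(3) assms(4), simplified]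
proof (rule sum.cong)
  fix a assume "a \<in> J"
  let ?b = "N - 1 - a"
  have "(\<Sum>b\<in>J. if a + b + 1 = N \<and> basis_mult_nonzero a b then par_past b (f a) * g b else 0)
      = (\<Sum>b\<in>J. if b = ?b then (if basis_mult_nonzero a ?b then par_past ?b (f a) * g ?b else 0) else 0)"
    by (rule sum.cong) auto
  also have "\<dots> = (if ?b \<in> J then (if basis_mult_nonzero a ?b then par_past ?b (f a) * g ?b else 0) else 0)"
    using assms(3) by simp
  also have "\<dots> = (if basis_mult_nonzero a ?b then par_past ?b (f a) * g ?b else 0)"
  proof (cases "?b \<in> J \<or> f a = 0 \<or> g ?b = 0")
    case False
    then have "a < B" "?b < B" using assms(1)[of a] assms(2)[of ?b] by force+
    then have "?b \<in> J" using assms(4) by auto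
    then show ?thesis by simp
  qed auto
  finally show "(if basis_mult_nonzero a ?b then par_past ?b (f a) * g ?b else 0) =
    (\<Sum>b\<in>J. if a + b + 1 = N \<and> basis_mult_nonzero a b then par_past b (f a) * g b else 0)"
    by simp
qed simp

lemma raviolo_mult_coeff_eq_0:
  assumes "\<And>n. n \<ge> B \<Longrightarrow> f n = 0" "\<And>n. n \<ge> B \<Longrightarrow> g n = 0" "N \<ge> B" "B \<ge> 0"
  shows "raviolo_mult_coeff f g N = 0"
proof -
  have "raviolo_mult_coeff f g N =
    (\<Sum>a\<in>{N - B..<B}. \<Sum>b\<in>{N - B..<B}.
       if a + b + 1 = N \<and> basis_mult_nonzero a b then par_past b (f a) * g b else 0)"
    using assms by (intro raviolo_mult_coeff_box) auto
  also have "\<dots> = 0"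
    using assms(3,4) by (intro sum.neutral ballI) (auto simp: basis_mult_nonzero_def)
  finally show ?thesis .
qed

lemma common_bound:
  assumes "\<exists>N. \<forall>n\<ge>N. f n = (0::'a::zero)" "\<exists>N. \<forall>n\<ge>N. g n = (0::'b::zero)"
  obtains B :: int where "B \<ge> 0" "\<And>n. n \<ge> B \<Longrightarrow> f n = 0" "\<And>n. n \<ge> B \<Longrightarrow> g n = 0"
proof -
  from assms obtain M N where "\<forall>n\<ge>M. f n = 0" "\<forall>n\<ge>N. g n = 0" by blast
  then show ?thesis by (intro that[of "max 0 (max M N)"]) auto
qed

lemma bounded_pointwise:
  assumes "\<exists>N. \<forall>n\<ge>N. f n = (0::'a::zero)" "\<exists>N. \<forall>n\<ge>N. g n = (0::'b::zero)"
    and "\<And>n::int. f n = 0 \<Longrightarrow> g n = 0 \<Longrightarrow> h n = (0::'c::zero)"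
  shows "\<exists>N. \<forall>n\<ge>N. h n = 0"
proof -
  obtain B where "B \<ge> 0" "\<And>n. n \<ge> B \<Longrightarrow> f n = 0" "\<And>n. n \<ge> B \<Longrightarrow> g n = 0"
    by (rule common_bound[OF assms(1,2)]) (rule that)
  then have "\<forall>n\<ge>B. h n = 0" using assms(3) by simp
  then show ?thesis ..
qed

lemma bounded_mult:
  assumes "\<exists>N. \<forall>n\<ge>N. f n = 0" "\<exists>N. \<forall>n\<ge>N. g n = 0"
  shows "\<exists>N. \<forall>n\<ge>N. raviolo_mult_coeff f g n = 0"
proof -
  obtain B where B: "B \<ge> 0" "\<And>n. n \<ge> B \<Longrightarrow> f n = 0" "\<And>n. n \<ge> B \<Longrightarrow> g n = 0"
    by (rule common_bound[OF assms]) (rule that)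
  have "raviolo_mult_coeff f g n = 0" if "n \<ge> B" for n
    by (rule raviolo_mult_coeff_eq_0[of B]) (use B that in auto)
  then have "\<forall>n\<ge>B. raviolo_mult_coeff f g n = 0" by simp
  then show ?thesis ..
qed

instantiation raviolo :: (superring) ring_1
begin

lift_definition zero_raviolo :: "'a raviolo" is "\<lambda>_. 0" by auto

lift_definition one_raviolo :: "'a raviolo" is "\<lambda>n. if n = -1 then 1 else 0"
  by (auto intro: exI[of _ 0])

lift_definition plus_raviolo :: "'a raviolo \<Rightarrow> 'a raviolo \<Rightarrow> 'a raviolo" is "\<lambda>f g n. f n + g n"
  by (erule (1) bounded_pointwise) auto

lift_definition uminus_raviolo :: "'a raviolo \<Rightarrow> 'a raviolo" is "\<lambda>f n. - f n"
  by auto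

lift_definition minus_raviolo :: "'a raviolo \<Rightarrow> 'a raviolo \<Rightarrow> 'a raviolo" is "\<lambda>f g n. f n - g n"
  by (erule (1) bounded_pointwise) auto

lift_definition times_raviolo :: "'a raviolo \<Rightarrow> 'a raviolo \<Rightarrow> 'a raviolo" is raviolo_mult_coeff
  by (rule bounded_mult)

instance
proof
  fix x y z :: "'a raviolo"
  show "x + y + z = x + (y + z)" by transfer (auto simp: add.assoc)
  show "x + y = y + x" by transfer (auto simp: add.commute)
  show "0 + x = x" by transfer auto
  show "- x + x = 0" by transfer auto
  show "x - y = x + - y" by transfer auto
  show "(0 :: 'a raviolo) \<noteq> 1" by transfer (auto dest: fun_cong[of _ _ "-1"])
  show "1 * x = x"
  proof (transfer, rule ext)
    fix f :: "int \<Rightarrow> 'a" and N :: int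
    let ?t = "\<lambda>a. if basis_mult_nonzero a (N - 1 - a)
        then par_past (N - 1 - a) (if a = - 1 then 1 else 0) * f (N - 1 - a) else 0"
    have "Sum_any ?t = sum ?t {-1}"
      by (rule Sum_any.expand_superset) (auto split: if_splits)
    then show "raviolo_mult_coeff (\<lambda>n. if n = - 1 then 1 else 0) f N = f N"
      by (auto simp: raviolo_mult_coeff_def basis_mult_nonzero_def)
  qed
  show "x * 1 = x"
  proof (transfer, rule ext)
    fix f :: "int \<Rightarrow> 'a" and N :: int
    let ?t = "\<lambda>a. if basis_mult_nonzero a (N - 1 - a)
        then par_past (N - 1 - a) (f a) * (if N - 1 - a = - 1 then 1 else 0) else 0"
    have "Sum_any ?t = sum ?t {N}"
      by (rule Sum_any.expand_superset) (auto split: if_splits)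
    then show "raviolo_mult_coeff f (\<lambda>n. if n = - 1 then 1 else 0) N = f N"
      by (auto simp: raviolo_mult_coeff_def basis_mult_nonzero_def par_past_def)
  qed
  show "(x + y) * z = x * z + y * z"
  proof (transfer, rule ext)
    fix f g h :: "int \<Rightarrow> 'a" and N :: int
    assume a: "\<exists>N. \<forall>n\<ge>N. f n = 0" "\<exists>N. \<forall>n\<ge>N. g n = 0" "\<exists>N. \<forall>n\<ge>N. h n = 0"
    obtain B where B: "\<And>n. n \<ge> B \<Longrightarrow> f n = 0" "\<And>n. n \<ge> B \<Longrightarrow> g n = 0"
      using common_bound[OF a(1,2)] by metis
    then obtain C where C: "\<And>n. n \<ge> C \<Longrightarrow> f n = 0 \<and> g n = 0" "\<And>n. n \<ge> C \<Longrightarrow> h n = 0"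
      using a(3) by (metis dual_order.trans linorder_le_cases)
    show "raviolo_mult_coeff (\<lambda>n. f n + g n) h N =
        raviolo_mult_coeff f h N + raviolo_mult_coeff g h N"
    proof -
      note box = raviolo_mult_coeff_box1[where B = C and J = "{N - C..<C}" and N = N]
      have 1: "raviolo_mult_coeff f h N = (\<Sum>a\<in>{N - C..<C}. if basis_mult_nonzero a (N - 1 - a)
          then par_past (N - 1 - a) (f a) * h (N - 1 - a) else 0)"
        by (rule box) (use C in auto)
      have 2: "raviolo_mult_coeff g h N = (\<Sum>a\<in>{N - C..<C}. if basis_mult_nonzero a (N - 1 - a)
          then par_past (N - 1 - a) (g a) * h (N - 1 - a) else 0)"
        by (rule box) (use C in auto)
      have 3: "raviolo_mult_coeff (\<lambda>n. f n + g n) h N = (\<Sum>a\<in>{N - C..<C}. if basis_mult_nonzero a (N - 1 - a)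
          then par_past (N - 1 - a) (f a + g a) * (h (N - 1 - a)) else 0)"
        by (rule box) (use C in auto)
      show ?thesis
        unfolding 1 2 3 sum.distrib[symmetric]
        by (rule sum.cong) (auto simp: par_past_add distrib_right)
    qed
  qed
  show "x * (y + z) = x * y + x * z"
  proof (transfer, rule ext)
    fix f g h :: "int \<Rightarrow> 'a" and N :: int
    assume a: "\<exists>N. \<forall>n\<ge>N. f n = 0" "\<exists>N. \<forall>n\<ge>N. g n = 0" "\<exists>N. \<forall>n\<ge>N. h n = 0"
    obtain B where B: "\<And>n. n \<ge> B \<Longrightarrow> g n = 0" "\<And>n. n \<ge> B \<Longrightarrow> h n = 0"
      using common_bound[OF a(2,3)] by metis
    then obtain C where C: "\<And>n. n \<ge> C \<Longrightarrow> g n = 0 \<and> h n = 0" "\<And>n. n \<ge> C \<Longrightarrow> f n = 0"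
      using a(1) by (metis dual_order.trans linorder_le_cases)
    show "raviolo_mult_coeff f (\<lambda>n. g n + h n) N =
        raviolo_mult_coeff f g N + raviolo_mult_coeff f h N"
    proof -
      note box = raviolo_mult_coeff_box1[where B = C and J = "{N - C..<C}" and N = N]
      have 1: "raviolo_mult_coeff f g N = (\<Sum>a\<in>{N - C..<C}. if basis_mult_nonzero a (N - 1 - a)
          then par_past (N - 1 - a) (f a) * g (N - 1 - a) else 0)"
        by (rule box) (use C in auto)
      have 2: "raviolo_mult_coeff f h N = (\<Sum>a\<in>{N - C..<C}. if basis_mult_nonzero a (N - 1 - a)
          then par_past (N - 1 - a) (f a) * h (N - 1 - a) else 0)"
        by (rule box) (use C in auto)
      have 3: "raviolo_mult_coeff f (\<lambda>n. g n + h n) N = (\<Sum>a\<in>{N - C..<C}. if basis_mult_nonzero a (N - 1 - a)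
          then par_past (N - 1 - a) (f a) * (g (N - 1 - a) + h (N - 1 - a)) else 0)"
        by (rule box) (use C in auto)
      show ?thesis
        unfolding 1 2 3 sum.distrib[symmetric]
        by (rule sum.cong) (auto simp: par_past_add distrib_left)
    qed
  qed
  show "x * y * z = x * (y * z)"
  proof (transfer, rule ext)
    fix f g h :: "int \<Rightarrow> 'a" and N :: int
    assume a: "\<exists>N. \<forall>n\<ge>N. f n = 0" "\<exists>N. \<forall>n\<ge>N. g n = 0" "\<exists>N. \<forall>n\<ge>N. h n = 0"
    obtain B0 where B0: "B0 \<ge> 0" "\<And>n. n \<ge> B0 \<Longrightarrow> f n = 0" "\<And>n. n \<ge> B0 \<Longrightarrow> g n = 0"
      using common_bound[OF a(1,2)] by metis
    obtain M where M: "\<And>n. n \<ge> M \<Longrightarrow> h n = 0" using a(3) by blast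
    define B where "B = max B0 M"
    have B: "B \<ge> 0" "\<And>n. n \<ge> B \<Longrightarrow> f n = 0" "\<And>n. n \<ge> B \<Longrightarrow> g n = 0" "\<And>n. n \<ge> B \<Longrightarrow> h n = 0"
      using B0 M by (auto simp: B_def)
    have fg: "raviolo_mult_coeff f g n = 0" if "n \<ge> B" for n
      by (rule raviolo_mult_coeff_eq_0[of B]) (use B that in auto)
    have gh: "raviolo_mult_coeff g h n = 0" if "n \<ge> B" for n
      by (rule raviolo_mult_coeff_eq_0[of B]) (use B that in auto)
    define J where "J = {N - 2 * B..<B}"
    have fin: "finite J" by (simp add: J_def)
    define T where "T a b c = par_past c (par_past b (f a) * g b) * h c" for a b c
    define S where "S = (\<Sum>a\<in>J. \<Sum>b\<in>J. \<Sum>c\<in>J.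
      if a + b + c + 2 = N \<and> basis_mult_nonzero a b \<and> basis_mult_nonzero (a + b + 1) c then T a b c else 0)"
    have "raviolo_mult_coeff (raviolo_mult_coeff f g) h N =
      (\<Sum>d\<in>J. \<Sum>c\<in>J. if d + c + 1 = N \<and> basis_mult_nonzero d c
         then par_past c (raviolo_mult_coeff f g d) * h c else 0)"
      using B fg by (intro raviolo_mult_coeff_box) (auto simp: J_def)
    also have "\<dots> = (\<Sum>d\<in>J. \<Sum>c\<in>J. \<Sum>a\<in>J. \<Sum>b\<in>J. if d = a + b + 1 then
       (if a + b + c + 2 = N \<and> basis_mult_nonzero a b \<and> basis_mult_nonzero (a + b + 1) c then T a b c else 0) else 0)"
    proof (intro sum.cong refl)
      fix d c assume dc: "d \<in> J" "c \<in> J"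
      show "(if d + c + 1 = N \<and> basis_mult_nonzero d c
         then par_past c (raviolo_mult_coeff f g d) * h c else 0) =
         (\<Sum>a\<in>J. \<Sum>b\<in>J. if d = a + b + 1 then
       (if a + b + c + 2 = N \<and> basis_mult_nonzero a b \<and> basis_mult_nonzero (a + b + 1) c then T a b c else 0) else 0)"
      proof (cases "d + c + 1 = N \<and> basis_mult_nonzero d c")
        case True
        have "raviolo_mult_coeff f g d =
          (\<Sum>a\<in>J. \<Sum>b\<in>J. if a + b + 1 = d \<and> basis_mult_nonzero a b then par_past b (f a) * g b else 0)"
          using True dc B by (intro raviolo_mult_coeff_box) (auto simp: J_def)
        then show ?thesis
          using True by (simp add: par_past_sum sum_distrib_right)
            (intro sum.cong refl, auto simp: T_def)
      next
        case False
        show ?thesis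
          unfolding if_not_P[OF False]
          by (rule sum.neutral[symmetric], rule ballI, rule sum.neutral) (use False in auto)
      qed
    qed
    also have "\<dots> = (\<Sum>a\<in>J. \<Sum>b\<in>J. \<Sum>c\<in>J. \<Sum>d\<in>J. if d = a + b + 1 then
       (if a + b + c + 2 = N \<and> basis_mult_nonzero a b \<and> basis_mult_nonzero (a + b + 1) c then T a b c else 0) else 0)"
    proof -
      have "(\<Sum>d\<in>J. \<Sum>c\<in>J. \<Sum>a\<in>J. \<Sum>b\<in>J. F a b c d) = (\<Sum>a\<in>J. \<Sum>b\<in>J. \<Sum>c\<in>J. \<Sum>d\<in>J. F a b c d)"
        for F :: "int \<Rightarrow> int \<Rightarrow> int \<Rightarrow> int \<Rightarrow> 'a"
      proof -
        have "(\<Sum>d\<in>J. \<Sum>c\<in>J. \<Sum>a\<in>J. \<Sum>b\<in>J. F a b c d) = (\<Sum>c\<in>J. \<Sum>d\<in>J. \<Sum>a\<in>J. \<Sum>b\<in>J. F a b c d)"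
          by (rule sum.swap)
        also have "\<dots> = (\<Sum>c\<in>J. \<Sum>a\<in>J. \<Sum>d\<in>J. \<Sum>b\<in>J. F a b c d)"
          by (rule sum.cong[OF refl], rule sum.swap)
        also have "\<dots> = (\<Sum>c\<in>J. \<Sum>a\<in>J. \<Sum>b\<in>J. \<Sum>d\<in>J. F a b c d)"
          by (rule sum.cong[OF refl], rule sum.cong[OF refl], rule sum.swap)
        also have "\<dots> = (\<Sum>a\<in>J. \<Sum>c\<in>J. \<Sum>b\<in>J. \<Sum>d\<in>J. F a b c d)"
          by (rule sum.swap)
        also have "\<dots> = (\<Sum>a\<in>J. \<Sum>b\<in>J. \<Sum>c\<in>J. \<Sum>d\<in>J. F a b c d)"
          by (rule sum.cong[OF refl], rule sum.swap)
        finally show ?thesis .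
      qed
      then show ?thesis .
    qed
    also have "\<dots> = S"
      unfolding S_def
    proof (intro sum.cong refl)
      fix a b c assume abc: "a \<in> J" "b \<in> J" "c \<in> J"
      show "(\<Sum>d\<in>J. if d = a + b + 1 then
       (if a + b + c + 2 = N \<and> basis_mult_nonzero a b \<and> basis_mult_nonzero (a + b + 1) c then T a b c else 0) else 0)
       = (if a + b + c + 2 = N \<and> basis_mult_nonzero a b \<and> basis_mult_nonzero (a + b + 1) c then T a b c else 0)"
        using abc B(1) fin by (auto simp: J_def basis_mult_nonzero_def)
    qed
    finally have 1: "raviolo_mult_coeff (raviolo_mult_coeff f g) h N = S" .
    have "raviolo_mult_coeff f (raviolo_mult_coeff g h) N =
      (\<Sum>a\<in>J. \<Sum>e\<in>J. if a + e + 1 = N \<and> basis_mult_nonzero a e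
         then par_past e (f a) * raviolo_mult_coeff g h e else 0)"
      using B gh by (intro raviolo_mult_coeff_box) (auto simp: J_def)
    also have "\<dots> = (\<Sum>a\<in>J. \<Sum>e\<in>J. \<Sum>b\<in>J. \<Sum>c\<in>J. if e = b + c + 1 then
       (if a + b + c + 2 = N \<and> basis_mult_nonzero b c \<and> basis_mult_nonzero a (b + c + 1) then T a b c else 0) else 0)"
    proof (intro sum.cong refl)
      fix a e assume ae: "a \<in> J" "e \<in> J"
      show "(if a + e + 1 = N \<and> basis_mult_nonzero a e
         then par_past e (f a) * raviolo_mult_coeff g h e else 0) =
         (\<Sum>b\<in>J. \<Sum>c\<in>J. if e = b + c + 1 then
       (if a + b + c + 2 = N \<and> basis_mult_nonzero b c \<and> basis_mult_nonzero a (b + c + 1) then T a b c else 0) else 0)"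
      proof (cases "a + e + 1 = N \<and> basis_mult_nonzero a e")
        case True
        have "raviolo_mult_coeff g h e =
          (\<Sum>b\<in>J. \<Sum>c\<in>J. if b + c + 1 = e \<and> basis_mult_nonzero b c then par_past c (g b) * h c else 0)"
          using True ae B by (intro raviolo_mult_coeff_box) (auto simp: J_def)
        then show ?thesis
          using True by (simp add: sum_distrib_left)
            (intro sum.cong refl, auto simp: T_def par_past_mult par_past_par_past mult.assoc)
      next
        case False
        show ?thesis
          unfolding if_not_P[OF False]
          by (rule sum.neutral[symmetric], rule ballI, rule sum.neutral) (use False in auto)
      qed
    qed
    also have "\<dots> = (\<Sum>a\<in>J. \<Sum>b\<in>J. \<Sum>c\<in>J. \<Sum>e\<in>J. if e = b + c + 1 then
       (if a + b + c + 2 = N \<and> basis_mult_nonzero b c \<and> basis_mult_nonzero a (b + c + 1) then T a b c else 0) else 0)"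
    proof -
      have "(\<Sum>a\<in>J. \<Sum>e\<in>J. \<Sum>b\<in>J. \<Sum>c\<in>J. F a b c e) = (\<Sum>a\<in>J. \<Sum>b\<in>J. \<Sum>c\<in>J. \<Sum>e\<in>J. F a b c e)"
        for F :: "int \<Rightarrow> int \<Rightarrow> int \<Rightarrow> int \<Rightarrow> 'a"
      proof -
        have "(\<Sum>a\<in>J. \<Sum>e\<in>J. \<Sum>b\<in>J. \<Sum>c\<in>J. F a b c e) = (\<Sum>a\<in>J. \<Sum>b\<in>J. \<Sum>e\<in>J. \<Sum>c\<in>J. F a b c e)"
          by (rule sum.cong[OF refl], rule sum.swap)
        also have "\<dots> = (\<Sum>a\<in>J. \<Sum>b\<in>J. \<Sum>c\<in>J. \<Sum>e\<in>J. F a b c e)"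
          by (rule sum.cong[OF refl], rule sum.cong[OF refl], rule sum.swap)
        finally show ?thesis .
      qed
      then show ?thesis .
    qed
    also have "\<dots> = S"
      unfolding S_def
    proof (intro sum.cong refl)
      fix a b c assume abc: "a \<in> J" "b \<in> J" "c \<in> J"
      show "(\<Sum>e\<in>J. if e = b + c + 1 then
       (if a + b + c + 2 = N \<and> basis_mult_nonzero b c \<and> basis_mult_nonzero a (b + c + 1) then T a b c else 0) else 0)
       = (if a + b + c + 2 = N \<and> basis_mult_nonzero a b \<and> basis_mult_nonzero (a + b + 1) c then T a b c else 0)"
      proof (cases "a + b + c + 2 = N \<and> basis_mult_nonzero b c \<and> basis_mult_nonzero a (b + c + 1)")
        case True
        then have "b + c + 1 \<in> J"
          using abc B(1) by (auto simp: J_def basis_mult_nonzero_def)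
        then show ?thesis using True fin basis_mult_nonzero_assoc[of b c a] by simp
      next
        case False
        then show ?thesis using basis_mult_nonzero_assoc[of b c a] by (auto intro: sum.neutral)
      qed
    qed
    finally show "raviolo_mult_coeff (raviolo_mult_coeff f g) h N =
        raviolo_mult_coeff f (raviolo_mult_coeff g h) N"
      using 1 by simp
  qed
qed

end

instantiation raviolo :: (superring) superring
begin

lift_definition par_raviolo :: "'a raviolo \<Rightarrow> 'a raviolo" is
  "\<lambda>f n. if n \<ge> 0 then - par (f n) else par (f n)"
  by (metis neg_0_equal_iff_equal par_zero)

instance
proof
  fix x y :: "'a raviolo"
  show "par (x + y) = par x + par y" by transfer (auto simp: par_add)
  show "par (par x) = x" by transfer (auto simp: par_par par_uminus)
  show "par (x * y) = par x * par y"
  proof (transfer, rule ext)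
    fix f g :: "int \<Rightarrow> 'a" and N :: int
    assume a: "\<exists>N. \<forall>n\<ge>N. f n = 0" "\<exists>N. \<forall>n\<ge>N. g n = 0"
    obtain B where B: "\<And>n. n \<ge> B \<Longrightarrow> f n = 0" "\<And>n. n \<ge> B \<Longrightarrow> g n = 0"
      using common_bound[OF a] by metis
    show "(if N \<ge> 0 then - par (raviolo_mult_coeff f g N) else par (raviolo_mult_coeff f g N)) =
      raviolo_mult_coeff (\<lambda>n. if n \<ge> 0 then - par (f n) else par (f n))
        (\<lambda>n. if n \<ge> 0 then - par (g n) else par (g n)) N"
    proof -
      let ?p = "\<lambda>f n. if n \<ge> (0::int) then - par (f n) else par (f n :: 'a)"
      note box = raviolo_mult_coeff_box1[where B = B and J = "{N - B..<B}" and N = N]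
      have 1: "raviolo_mult_coeff f g N = (\<Sum>a\<in>{N - B..<B}. if basis_mult_nonzero a (N - 1 - a)
          then par_past (N - 1 - a) (f a) * g (N - 1 - a) else 0)"
        by (rule box) (use B in auto)
      have 2: "raviolo_mult_coeff (?p f) (?p g) N = (\<Sum>a\<in>{N - B..<B}. if basis_mult_nonzero a (N - 1 - a)
          then par_past (N - 1 - a) (?p f a) * ?p g (N - 1 - a) else 0)"
        by (rule box) (use B in auto)
      show ?thesis
      proof (cases "N \<ge> 0")
        case True
        have "- par (raviolo_mult_coeff f g N) = raviolo_mult_coeff (?p f) (?p g) N"
          unfolding 1 2 par_sum sum_negf[symmetric]
          by (rule sum.cong) (use True in \<open>auto simp: basis_mult_nonzero_def par_past_def par_mult par_uminus\<close>)
        then show ?thesis using True by simp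
      next
        case False
        have "par (raviolo_mult_coeff f g N) = raviolo_mult_coeff (?p f) (?p g) N"
          unfolding 1 2 par_sum
          by (rule sum.cong) (use False in \<open>auto simp: basis_mult_nonzero_def par_past_def par_mult par_uminus\<close>)
        then show ?thesis using False by simp
      qed
    qed
  qed
qed

end

lemma raviolo_eqI: "(\<And>n. rcoeff x n = rcoeff y n) \<Longrightarrow> x = y"
  by (simp add: rcoeff_inject[symmetric] ext)

lemma rcoeff_bounded: "\<exists>N. \<forall>n\<ge>N. rcoeff x n = 0"
  using rcoeff[of x] by simp

lemma rcoeff_zero [simp]: "rcoeff 0 n = 0"
  by transfer simp

lemma rcoeff_add [simp]: "rcoeff (x + y) n = rcoeff x n + rcoeff y n"
  by transfer simp

lemma rcoeff_minus [simp]: "rcoeff (- x) n = - rcoeff x n"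
  by transfer simp

lemma rcoeff_diff [simp]: "rcoeff (x - y) n = rcoeff x n - rcoeff y n"
  by transfer simp

lemma rcoeff_one: "rcoeff 1 n = (if n = -1 then 1 else 0)"
  by transfer simp

lemma rcoeff_mult: "rcoeff (x * y) n = raviolo_mult_coeff (rcoeff x) (rcoeff y) n"
  by transfer simp

lemma rcoeff_of_nat: "rcoeff (of_nat k) n = (if n = -1 then of_nat k else 0)"
  by (induction k) (auto simp: rcoeff_one)

lemma rcoeff_of_nat_mult: "rcoeff (of_nat k * x) n = of_nat k * rcoeff x n"
  by (induction k) (auto simp: distrib_right)

text \<open>The element \<open>e\<^sub>k r\<close>.\<close>

lift_definition basis_elt :: "int \<Rightarrow> 'r::superring \<Rightarrow> 'r raviolo" is
  "\<lambda>k r n. if n = k then r else 0"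
proof -
  fix k :: int and r :: 'r
  have "\<forall>n\<ge>k + 1. (if n = k then r else 0) = 0" by simp
  then show "\<exists>N. \<forall>n\<ge>N. (if n = k then r else 0) = 0" ..
qed

text \<open>Power series \<open>\<Sum>\<^sub>n z\<^sup>n f\<^sub>n\<close> without polar part.\<close>

lift_definition regular_series :: "(nat \<Rightarrow> 'r::zero) \<Rightarrow> 'r raviolo" is
  "\<lambda>f n. if n < 0 then f (nat (- n - 1)) else 0"
proof -
  fix f :: "nat \<Rightarrow> 'r"
  have "\<forall>n\<ge>(0::int). (if n < 0 then f (nat (- n - 1)) else 0) = 0" by simp
  then show "\<exists>N. \<forall>n\<ge>(N::int). (if n < 0 then f (nat (- n - 1)) else 0) = 0" ..
qed

lemma rcoeff_basis_elt: "rcoeff (basis_elt k r) n = (if n = k then r else 0)"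
  by transfer simp

lemma rcoeff_regular_series:
  "rcoeff (regular_series f) n = (if n < 0 then f (nat (- n - 1)) else 0)"
  by transfer simp

lemma one_eq_basis_elt: "1 = basis_elt (-1) 1"
  by (rule raviolo_eqI) (simp add: rcoeff_one rcoeff_basis_elt)

lemma rcoeff_basis_elt_mult:
  "rcoeff (basis_elt k r * y) n = (if basis_mult_nonzero k (n - 1 - k)
     then par_past (n - 1 - k) r * rcoeff y (n - 1 - k) else 0)"
proof -
  let ?t = "\<lambda>a. if basis_mult_nonzero a (n - 1 - a)
      then par_past (n - 1 - a) (if a = k then r else 0) * rcoeff y (n - 1 - a) else 0"
  have "Sum_any ?t = sum ?t {k}"
    by (rule Sum_any.expand_superset) (auto split: if_splits)
  then show ?thesis
    unfolding rcoeff_mult raviolo_mult_coeff_def rcoeff_basis_elt by simp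
qed

lemma rcoeff_mult_basis_elt:
  "rcoeff (y * basis_elt k r) n = (if basis_mult_nonzero (n - 1 - k) k
     then par_past k (rcoeff y (n - 1 - k)) * r else 0)"
proof -
  let ?t = "\<lambda>a. if basis_mult_nonzero a (n - 1 - a)
      then par_past (n - 1 - a) (rcoeff y a) * (if n - 1 - a = k then r else 0) else 0"
  have "Sum_any ?t = sum ?t {n - 1 - k}"
    by (rule Sum_any.expand_superset) (auto split: if_splits)
  also have "\<dots> = (if basis_mult_nonzero (n - 1 - k) k
     then par_past k (rcoeff y (n - 1 - k)) * r else 0)" by simp
  finally show ?thesis
    unfolding rcoeff_mult raviolo_mult_coeff_def rcoeff_basis_elt .
qed

lemma rcoeff_regular_mult:
  assumes "n < 0"
  shows "rcoeff (regular_series f * regular_series g) n =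
    (\<Sum>i=0..nat (- n - 1). f i * g (nat (- n - 1) - i))"
proof -
  define k where "k = nat (- n - 1)"
  have n: "n = - int k - 1" using assms by (simp add: k_def)
  have "rcoeff (regular_series f * regular_series g) n =
    (\<Sum>a\<in>{n - 0..<0}. if basis_mult_nonzero a (n - 1 - a)
            then par_past (n - 1 - a) (rcoeff (regular_series f) a) * rcoeff (regular_series g) (n - 1 - a) else 0)"
    unfolding rcoeff_mult by (rule raviolo_mult_coeff_box1) (auto simp: rcoeff_regular_series)
  also have "\<dots> = (\<Sum>i=0..k. f i * g (k - i))"
    by (rule sum.reindex_bij_witness[of _ "\<lambda>i. - int i - 1" "\<lambda>a. nat (- a - 1)"])
      (auto simp: n rcoeff_regular_series basis_mult_nonzero_def par_past_def nat_diff_distrib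
        intro!: arg_cong2[where f = "(*)"] arg_cong[where f = g])
  finally show ?thesis by (simp add: k_def)
qed

lemma rcoeff_regular_mult_nonneg:
  assumes "n \<ge> 0"
  shows "rcoeff (regular_series f * regular_series g) n = 0"
proof -
  have "rcoeff (regular_series f * regular_series g) n =
    (\<Sum>a\<in>{n - 0..<0}. if basis_mult_nonzero a (n - 1 - a)
            then par_past (n - 1 - a) (rcoeff (regular_series f) a) * rcoeff (regular_series g) (n - 1 - a) else 0)"
    unfolding rcoeff_mult by (rule raviolo_mult_coeff_box1) (auto simp: rcoeff_regular_series)
  then show ?thesis using assms by simp
qed

lemma regular_series_mult:
  "regular_series f * regular_series g = regular_series (\<lambda>k. \<Sum>i=0..k. f i * g (k - i))"
proof (rule raviolo_eqI)
  fix n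
  show "rcoeff (regular_series f * regular_series g) n =
    rcoeff (regular_series (\<lambda>k. \<Sum>i=0..k. f i * g (k - i))) n"
    by (cases "n < 0") (simp_all add: rcoeff_regular_mult rcoeff_regular_mult_nonneg rcoeff_regular_series)
qed

lemma regular_series_central:
  fixes x :: "'r::superring raviolo"
  assumes "\<And>n r. f n * r = r * f n" and "\<And>n. par (f n) = f n"
  shows "regular_series f * x = x * regular_series f"
proof (rule raviolo_eqI)
  fix n
  obtain B where B: "B \<ge> 0" "\<And>n. n \<ge> B \<Longrightarrow> rcoeff x n = 0" "\<And>n. n \<ge> B \<Longrightarrow> rcoeff x n = 0"
    by (rule common_bound[OF rcoeff_bounded rcoeff_bounded]) (rule that)
  have s0: "m \<ge> B \<Longrightarrow> rcoeff (regular_series f) m = 0" for m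
    using B(1) by (simp add: rcoeff_regular_series)
  let ?J = "{n - B..<B}"
  have 1: "rcoeff (regular_series f * x) n = (\<Sum>a\<in>?J. \<Sum>b\<in>?J.
      if a + b + 1 = n \<and> basis_mult_nonzero a b then par_past b (rcoeff (regular_series f) a) * rcoeff x b else 0)"
    unfolding rcoeff_mult by (rule raviolo_mult_coeff_box) (use B s0 in auto)
  have 2: "rcoeff (x * regular_series f) n = (\<Sum>a\<in>?J. \<Sum>b\<in>?J.
      if a + b + 1 = n \<and> basis_mult_nonzero a b then par_past b (rcoeff x a) * rcoeff (regular_series f) b else 0)"
    unfolding rcoeff_mult by (rule raviolo_mult_coeff_box) (use B s0 in auto)
  have t: "(if a + b + 1 = n \<and> basis_mult_nonzero a b then par_past b (rcoeff (regular_series f) a) * rcoeff x b else 0)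
      = (if b + a + 1 = n \<and> basis_mult_nonzero b a then par_past a (rcoeff x b) * rcoeff (regular_series f) a else 0)" for a b
    using assms by (auto simp: par_past_def rcoeff_regular_series basis_mult_nonzero_def)
  show "rcoeff (regular_series f * x) n = rcoeff (x * regular_series f) n"
    unfolding 1 2 t by (rule sum.swap)
qed

lemma par_regular_series: "par (regular_series f) = regular_series (\<lambda>n. par (f n))"
  by (rule raviolo_eqI, transfer) auto

section \<open>The algebra \<open>\<K>\<^bsub>z,w,z-w\<^esub>\<close> and its expansions\<close>

datatype omega = Omega_z nat | Omega_w nat | Omega_zw nat

datatype omega_word = Word (letters: "omega list")

instantiation omega_word :: monoid_add
begin
definition zero_omega_word where "0 = Word []"
definition plus_omega_word where "u + v = Word (letters u @ letters v)"
instance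
  by standard (auto simp: zero_omega_word_def plus_omega_word_def)
end

lemma letters_simps [simp]:
  "letters 0 = []" "letters (u + v) = letters u @ letters v"
  by (simp_all add: zero_omega_word_def plus_omega_word_def)

text \<open>
  \<open>\<complex>[[z,w]]\<close> is realised as \<open>\<complex>[[z]][[w]]\<close>: the coefficient of \<open>z\<^sup>i w\<^sup>j\<close> in \<open>c\<close> is \<open>fps_nth (fps_nth c j) i\<close>.
  The type below is the free associative \<open>\<complex>[[z,w]]\<close>-algebra on the symbols \<open>\<Omega>\<close>
  (finite combinations of words, scalars central); graded commutativity is among the relations.
\<close>

type_synonym zw_series = "complex fps fps"
type_synonym omega_free = "omega_word \<Rightarrow>\<^sub>0 zw_series"

definition scalar_z :: zw_series where "scalar_z = fps_const fps_X"
definition scalar_w :: zw_series where "scalar_w = fps_X"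

definition scalar :: "zw_series \<Rightarrow> omega_free" where
  "scalar c = Poly_Mapping.single 0 c"

definition omega_gen :: "omega \<Rightarrow> omega_free" where
  "omega_gen x = Poly_Mapping.single (Word [x]) 1"

text \<open>The derivations \<open>\<partial>\<^sub>z\<close>, \<open>\<partial>\<^sub>w\<close> of the free algebra, from their values on scalars and letters.\<close>

fun word_deriv :: "(omega \<Rightarrow> omega_free) \<Rightarrow> omega list \<Rightarrow> omega_free" where
  "word_deriv d [] = 0"
| "word_deriv d (x # xs) =
     d x * Poly_Mapping.single (Word xs) 1 + omega_gen x * word_deriv d xs"

definition free_deriv ::
    "(zw_series \<Rightarrow> zw_series) \<Rightarrow> (omega \<Rightarrow> omega_free) \<Rightarrow> omega_free \<Rightarrow> omega_free" where
  "free_deriv D d f = (\<Sum>u\<in>Poly_Mapping.keys f.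
     Poly_Mapping.single u (D (Poly_Mapping.lookup f u)) + scalar (Poly_Mapping.lookup f u) * word_deriv d (letters u))"

definition scalar_dz :: "zw_series \<Rightarrow> zw_series" where
  "scalar_dz c = Abs_fps (\<lambda>j. fps_deriv (fps_nth c j))"

definition scalar_dw :: "zw_series \<Rightarrow> zw_series" where
  "scalar_dw c = fps_deriv c"

fun omega_dz :: "omega \<Rightarrow> omega_free" where
  "omega_dz (Omega_z m) = - (of_nat (m + 1) * omega_gen (Omega_z (m + 1)))"
| "omega_dz (Omega_w m) = 0"
| "omega_dz (Omega_zw m) = - (of_nat (m + 1) * omega_gen (Omega_zw (m + 1)))"

fun omega_dw :: "omega \<Rightarrow> omega_free" where
  "omega_dw (Omega_z m) = 0"
| "omega_dw (Omega_w m) = - (of_nat (m + 1) * omega_gen (Omega_w (m + 1)))"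
| "omega_dw (Omega_zw m) = of_nat (m + 1) * omega_gen (Omega_zw (m + 1))"

definition free_dz :: "omega_free \<Rightarrow> omega_free" where
  "free_dz = free_deriv scalar_dz omega_dz"

definition free_dw :: "omega_free \<Rightarrow> omega_free" where
  "free_dw = free_deriv scalar_dw omega_dw"

inductive_set arnold_relations :: "omega_free set" where
  arnold: "omega_gen (Omega_zw 0) * omega_gen (Omega_z 0) + omega_gen (Omega_w 0) * omega_gen (Omega_zw 0)
    + omega_gen (Omega_z 0) * omega_gen (Omega_w 0) \<in> arnold_relations"
| arnold_dz: "r \<in> arnold_relations \<Longrightarrow> free_dz r \<in> arnold_relations"
| arnold_dw: "r \<in> arnold_relations \<Longrightarrow> free_dw r \<in> arnold_relations"

inductive_set variable_families :: "(zw_series \<times> (nat \<Rightarrow> omega)) set" where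
  "(scalar_z, Omega_z) \<in> variable_families"
| "(scalar_w, Omega_w) \<in> variable_families"
| "(scalar_z - scalar_w, Omega_zw) \<in> variable_families"

text \<open>The two-sided ideal of relations; \<open>kzw\<close> below is the quotient by it.\<close>

inductive_set omega_ideal :: "omega_free set" where
  graded_commutative: "omega_gen x * omega_gen y + omega_gen y * omega_gen x \<in> omega_ideal"
| power_le: "(x, Om) \<in> variable_families \<Longrightarrow> n \<le> m \<Longrightarrow>
    scalar (x ^ n) * omega_gen (Om m) - omega_gen (Om (m - n)) \<in> omega_ideal"
| power_gt: "(x, Om) \<in> variable_families \<Longrightarrow> n > m \<Longrightarrow>
    scalar (x ^ n) * omega_gen (Om m) \<in> omega_ideal"
| omega_omega: "(x, Om) \<in> variable_families \<Longrightarrow> omega_gen (Om n) * omega_gen (Om m) \<in> omega_ideal"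
| arnold_relation: "r \<in> arnold_relations \<Longrightarrow> r \<in> omega_ideal"
| zero: "0 \<in> omega_ideal"
| add: "f \<in> omega_ideal \<Longrightarrow> g \<in> omega_ideal \<Longrightarrow> f + g \<in> omega_ideal"
| mult_left: "f \<in> omega_ideal \<Longrightarrow> g * f \<in> omega_ideal"
| mult_right: "f \<in> omega_ideal \<Longrightarrow> f * g \<in> omega_ideal"

definition omega_eq :: "omega_free \<Rightarrow> omega_free \<Rightarrow> bool" where
  "omega_eq f g \<longleftrightarrow> f - g \<in> omega_ideal"

lemma omega_ideal_uminus: "f \<in> omega_ideal \<Longrightarrow> - f \<in> omega_ideal"
  using omega_ideal.mult_left[of f "- 1"] by simp

lemma equivp_omega_eq: "equivp omega_eq"
proof (rule equivpI)
  show "reflp omega_eq"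
    by (auto simp: reflp_def omega_eq_def intro: omega_ideal.zero)
  show "symp omega_eq"
    unfolding symp_def omega_eq_def using omega_ideal_uminus by (metis minus_diff_eq)
  show "transp omega_eq"
  proof (rule transpI)
    fix f g h assume "omega_eq f g" "omega_eq g h"
    then have "(f - g) + (g - h) \<in> omega_ideal"
      unfolding omega_eq_def by (rule omega_ideal.add)
    then show "omega_eq f h" by (simp add: omega_eq_def)
  qed
qed

quotient_type kzw = omega_free / omega_eq
  by (rule equivp_omega_eq)

text \<open>The homomorphism from the free algebra with given values on scalars and letters.\<close>

definition free_eval ::
    "(zw_series \<Rightarrow> 'a::ring_1) \<Rightarrow> (omega \<Rightarrow> 'a) \<Rightarrow> omega_free \<Rightarrow> 'a" where
  "free_eval c g f = (\<Sum>u\<in>Poly_Mapping.keys f. c (Poly_Mapping.lookup f u) * prod_list (map g (letters u)))"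

lemma sum_keys_superset:
  assumes "finite A" "Poly_Mapping.keys f \<subseteq> A" "\<And>u. F u 0 = 0"
  shows "(\<Sum>u\<in>Poly_Mapping.keys f. F u (Poly_Mapping.lookup f u)) = (\<Sum>u\<in>A. F u (Poly_Mapping.lookup f u))"
  using assms by (intro sum.mono_neutral_left) (auto simp: in_keys_iff)

lemma sum_keys_add:
  fixes f g :: "'k \<Rightarrow>\<^sub>0 'b::comm_monoid_add" and F :: "'k \<Rightarrow> 'b \<Rightarrow> 'c::comm_monoid_add"
  assumes "\<And>u. F u 0 = 0" "\<And>u a b. F u (a + b) = F u a + F u b"
  shows "(\<Sum>u\<in>Poly_Mapping.keys (f + g). F u (Poly_Mapping.lookup (f + g) u)) =
    (\<Sum>u\<in>Poly_Mapping.keys f. F u (Poly_Mapping.lookup f u)) + (\<Sum>u\<in>Poly_Mapping.keys g. F u (Poly_Mapping.lookup g u))"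
proof -
  let ?A = "Poly_Mapping.keys f \<union> Poly_Mapping.keys g"
  have "(\<Sum>u\<in>Poly_Mapping.keys (f + g). F u (Poly_Mapping.lookup (f + g) u)) = (\<Sum>u\<in>?A. F u (Poly_Mapping.lookup (f + g) u))"
    by (rule sum_keys_superset) (use keys_add[of f g] assms in auto)
  moreover have "(\<Sum>u\<in>Poly_Mapping.keys f. F u (Poly_Mapping.lookup f u)) = (\<Sum>u\<in>?A. F u (Poly_Mapping.lookup f u))"
    by (rule sum_keys_superset) (use assms in auto)
  moreover have "(\<Sum>u\<in>Poly_Mapping.keys g. F u (Poly_Mapping.lookup g u)) = (\<Sum>u\<in>?A. F u (Poly_Mapping.lookup g u))"
    by (rule sum_keys_superset) (use assms in auto)
  ultimately show ?thesis by (simp add: lookup_add assms(2) sum.distrib)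
qed

lemma single_add_induct [case_names zero add]:
  fixes f :: "'k \<Rightarrow>\<^sub>0 'b::comm_monoid_add"
  assumes "P 0" "\<And>u a f. P f \<Longrightarrow> P (Poly_Mapping.single u a + f)"
  shows "P f"
proof (induction f rule: update_induct)
  case const
  show ?case using assms(1) by simp
next
  case (update f u a)
  have "Poly_Mapping.update u a f = Poly_Mapping.single u a + f"
    using update(1) by (intro poly_mapping_eqI)
      (auto simp: lookup_update lookup_add lookup_single in_keys_iff when_def)
  then show ?case using assms(2)[OF update(3)] by simp
qed

locale omega_evaluation =
  fixes c :: "zw_series \<Rightarrow> 'a::ring_1" and g :: "omega \<Rightarrow> 'a" and dz dw :: "'a \<Rightarrow> 'a"
  assumes c_add: "c (a + b) = c a + c b"
    and c_mult: "c (a * b) = c a * c b"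
    and c_one: "c 1 = 1"
    and c_central: "c a * x = x * c a"
    and g_anticommute: "g k * g l + g l * g k = 0"
    and g_power: "(y, Om) \<in> variable_families \<Longrightarrow> c y * g (Om (Suc m)) = g (Om m)"
    and g_power_0: "(y, Om) \<in> variable_families \<Longrightarrow> c y * g (Om 0) = 0"
    and g_omega: "(y, Om) \<in> variable_families \<Longrightarrow> g (Om n) * g (Om m) = 0"
    and g_arnold: "g (Omega_zw 0) * g (Omega_z 0) + g (Omega_w 0) * g (Omega_zw 0)
      + g (Omega_z 0) * g (Omega_w 0) = 0"
    and dz_add: "dz (x + x') = dz x + dz x'"
    and dw_add: "dw (x + x') = dw x + dw x'"
    and dz_mult: "dz (x * x') = dz x * x' + x * dz x'"
    and dw_mult: "dw (x * x') = dw x * x' + x * dw x'"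
    and dz_c: "dz (c a) = c (scalar_dz a)"
    and dw_c: "dw (c a) = c (scalar_dw a)"
    and dz_g: "dz (g (Omega_z m)) = - (of_nat (m + 1) * g (Omega_z (m + 1)))"
      "dz (g (Omega_w m)) = 0"
      "dz (g (Omega_zw m)) = - (of_nat (m + 1) * g (Omega_zw (m + 1)))"
    and dw_g: "dw (g (Omega_z m)) = 0"
      "dw (g (Omega_w m)) = - (of_nat (m + 1) * g (Omega_w (m + 1)))"
      "dw (g (Omega_zw m)) = of_nat (m + 1) * g (Omega_zw (m + 1))"
begin

abbreviation ev where "ev \<equiv> free_eval c g"

lemma c_zero: "c 0 = 0"
  using c_add[of 0 0] by simp

lemma ev_zero [simp]: "ev 0 = 0"
  by (simp add: free_eval_def)

lemma ev_add [simp]: "ev (f + h) = ev f + ev h"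
  unfolding free_eval_def
  by (rule sum_keys_add) (simp_all add: c_zero c_add distrib_right)

lemma ev_uminus [simp]: "ev (- f) = - ev f"
  by (metis add_eq_0_iff ev_add ev_zero right_minus)

lemma ev_diff [simp]: "ev (f - h) = ev f - ev h"
  by (metis ev_add ev_uminus diff_conv_add_uminus)

lemma ev_single: "ev (Poly_Mapping.single u a) = c a * prod_list (map g (letters u))"
  by (cases "a = 0") (simp_all add: free_eval_def c_zero)

lemma ev_scalar [simp]: "ev (scalar a) = c a"
  by (simp add: scalar_def ev_single)

lemma ev_gen [simp]: "ev (omega_gen x) = g x"
  by (simp add: omega_gen_def ev_single c_one)

lemma ev_mult [simp]: "ev (f * h) = ev f * ev h"
proof (induction f rule: single_add_induct)
  case (add u a f)
  have "ev (Poly_Mapping.single u a * h) = ev (Poly_Mapping.single u a) * ev h"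
  proof (induction h rule: single_add_induct)
    case (add v b h)
    have "c a * (c b * (U * V)) = c a * (U * (c b * V))" for U V
      by (metis c_central mult.assoc)
    then show ?case
      using add by (simp add: distrib_left mult_single ev_single c_mult mult.assoc)
  qed simp
  then show ?case using add by (simp add: distrib_right)
qed simp

lemma ev_one [simp]: "ev 1 = 1"
  using ev_scalar[of 1] by (simp add: scalar_def c_one flip: single_one)

lemma ev_of_nat [simp]: "ev (of_nat n) = of_nat n"
  by (induction n) simp_all

lemma ev_word_deriv:
  assumes "\<And>x. d (g x) = ev (e x)" and d_mult: "\<And>x y. d (x * y) = d x * y + x * d y"
  shows "d (prod_list (map g xs)) = ev (word_deriv e xs)"
proof (induction xs)
  case Nil
  have "d 1 = d 1 + d 1" using d_mult[of 1 1] by simp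
  then show ?case by simp
next
  case (Cons x xs)
  then show ?case by (simp add: d_mult assms(1) ev_single c_one)
qed

lemma ev_free_deriv:
  assumes e: "\<And>x. d (g x) = ev (e x)" and d_mult: "\<And>x y. d (x * y) = d x * y + x * d y"
    and d_add: "\<And>x y. d (x + y) = d x + d y"
    and D: "\<And>a. d (c a) = c (D a)" and D_add: "\<And>a b. D (a + b) = D a + D b"
  shows "ev (free_deriv D e f) = d (ev f)"
proof -
  have D0: "D 0 = 0" using D_add[of 0 0] by simp
  have d0: "d 0 = 0" using d_add[of 0 0] by simp
  have add: "free_deriv D e (f + h) = free_deriv D e f + free_deriv D e h" for f h
    unfolding free_deriv_def
    by (rule sum_keys_add) (simp_all add: D0 D_add scalar_def single_add distrib_right)
  have single: "free_deriv D e (Poly_Mapping.single u a) =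
    Poly_Mapping.single u (D a) + scalar a * word_deriv e (letters u)" for u a
    by (cases "a = 0") (simp_all add: free_deriv_def D0 scalar_def)
  show ?thesis
  proof (induction f rule: single_add_induct)
    case zero
    show ?case by (simp add: free_deriv_def d0)
  next
    case (add u a f)
    then show ?case
      by (simp add: \<open>\<And>f h. free_deriv D e (f + h) = free_deriv D e f + free_deriv D e h\<close>
          single ev_single d_add d_mult D ev_word_deriv[OF e d_mult])
  qed
qed

lemma scalar_dz_add: "scalar_dz (a + b) = scalar_dz a + scalar_dz b"
  by (rule fps_ext) (simp add: scalar_dz_def)

lemma ev_free_dz: "ev (free_dz f) = dz (ev f)"
  unfolding free_dz_def
proof (rule ev_free_deriv)
  fix x show "dz (g x) = ev (omega_dz x)"
    by (cases x) (simp_all add: dz_g flip: of_nat_Suc)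
qed (simp_all add: dz_mult dz_add dz_c scalar_dz_add)

lemma ev_free_dw: "ev (free_dw f) = dw (ev f)"
  unfolding free_dw_def
proof (rule ev_free_deriv)
  fix x show "dw (g x) = ev (omega_dw x)"
    by (cases x) (simp_all add: dw_g flip: of_nat_Suc)
qed (simp_all add: dw_mult dw_add dw_c scalar_dw_def)

lemma ev_arnold: "r \<in> arnold_relations \<Longrightarrow> ev r = 0"
proof (induction rule: arnold_relations.induct)
  case arnold
  show ?case using g_arnold by simp
next
  case (arnold_dz r)
  then show ?case using dz_add[of 0 0] by (simp add: ev_free_dz)
next
  case (arnold_dw r)
  then show ?case using dw_add[of 0 0] by (simp add: ev_free_dw)
qed

lemma c_power: "c (a ^ n) = c a ^ n"
  by (induction n) (simp_all add: c_one c_mult)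

lemma g_power_le:
  assumes "(y, Om) \<in> variable_families"
  shows "n \<le> m \<Longrightarrow> c y ^ n * g (Om m) = g (Om (m - n))"
proof (induction n)
  case (Suc n)
  then have "m - n = Suc (m - Suc n)" by simp
  then show ?case using Suc g_power[OF assms, of "m - Suc n"] by (simp add: mult.assoc)
qed simp

lemma g_power_gt:
  assumes "(y, Om) \<in> variable_families" "n > m"
  shows "c y ^ n * g (Om m) = 0"
proof -
  have "c y ^ n = c y ^ (n - Suc m) * (c y * c y ^ m)"
    using assms(2) by (metis Suc_leI le_add_diff_inverse2 power_Suc power_add)
  then show ?thesis
    using g_power_le[OF assms(1), of m m] g_power_0[OF assms(1)] by (simp add: mult.assoc)
qed

lemma ev_ideal: "f \<in> omega_ideal \<Longrightarrow> ev f = 0"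
  by (induction rule: omega_ideal.induct)
    (simp_all add: g_anticommute g_omega c_power g_power_le g_power_gt ev_arnold)

lemma ev_respects: "omega_eq f h \<Longrightarrow> ev f = ev h"
  using ev_ideal[of "f - h"] by (simp add: omega_eq_def)

end

definition series_zw :: "zw_series \<Rightarrow> complex raviolo raviolo" where
  "series_zw c = regular_series (\<lambda>j. regular_series (\<lambda>i. fps_nth (fps_nth c j) i))"

definition series_wz :: "zw_series \<Rightarrow> complex raviolo raviolo" where
  "series_wz c = regular_series (\<lambda>i. regular_series (\<lambda>j. fps_nth (fps_nth c j) i))"

text \<open>\<open>\<Sum>\<^sub>n (m+n choose n) y\<^sup>n \<Omega>\<^sub>x\<^bsup>m+n\<^esup>\<close> in \<open>\<complex>\<langle>\<langle>x\<rangle>\<rangle>\<langle>\<langle>y\<rangle>\<rangle>\<close>.\<close>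

definition omega_diff :: "nat \<Rightarrow> complex raviolo raviolo" where
  "omega_diff m = regular_series (\<lambda>n. basis_elt (int (m + n)) (of_nat ((m + n) choose n)))"

fun omega_expand_zw :: "omega \<Rightarrow> complex raviolo raviolo" where
  "omega_expand_zw (Omega_z m) = basis_elt (-1) (basis_elt (int m) 1)"
| "omega_expand_zw (Omega_w m) = basis_elt (int m) 1"
| "omega_expand_zw (Omega_zw m) = omega_diff m"

fun omega_expand_wz :: "omega \<Rightarrow> complex raviolo raviolo" where
  "omega_expand_wz (Omega_z m) = basis_elt (int m) 1"
| "omega_expand_wz (Omega_w m) = basis_elt (-1) (basis_elt (int m) 1)"
| "omega_expand_wz (Omega_zw m) = (-1) ^ m * omega_diff m"

subsection \<open>The expansions respect the relations\<close>

lift_definition rderiv :: "'r::superring raviolo \<Rightarrow> 'r raviolo" is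
  "\<lambda>f n. - (of_int n * f (n - 1))"
proof -
  fix f :: "int \<Rightarrow> 'r" assume "\<exists>N. \<forall>n\<ge>N. f n = 0"
  then obtain N where "\<forall>n\<ge>N. f n = 0" ..
  then have "\<forall>n\<ge>N + 1. - (of_int n * f (n - 1)) = 0" by simp
  then show "\<exists>N. \<forall>n\<ge>N. - (of_int n * f (n - 1)) = 0" ..
qed

lemma rcoeff_rderiv: "rcoeff (rderiv x) n = - (of_int n * rcoeff x (n - 1))"
  by transfer simp

lemma rderiv_zero [simp]: "rderiv 0 = 0"
  by (rule raviolo_eqI) (simp add: rcoeff_rderiv)

lemma rderiv_add: "rderiv (x + y) = rderiv x + rderiv y"
  by (rule raviolo_eqI) (simp add: rcoeff_rderiv distrib_left)

lemma rderiv_sum: "rderiv (sum f A) = (\<Sum>a\<in>A. rderiv (f a))"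
  by (induction A rule: infinite_finite_induct) (simp_all add: rderiv_add)

lift_definition inner_deriv :: "'r::superring raviolo raviolo \<Rightarrow> 'r raviolo raviolo" is
  "\<lambda>f n. rderiv (f n)"
  by (metis rderiv_zero)

lemma rcoeff_inner_deriv: "rcoeff (inner_deriv x) n = rderiv (rcoeff x n)"
  by transfer simp

lemma inner_deriv_add: "inner_deriv (x + y) = inner_deriv x + inner_deriv y"
  by (rule raviolo_eqI) (simp add: rcoeff_inner_deriv rderiv_add)

lemma rcoeff_par: "rcoeff (par x) n = (if n \<ge> 0 then - par (rcoeff x n) else par (rcoeff x n))"
  by transfer simp

lemma par_rderiv: "par (rderiv x) = rderiv (par x)"
proof (rule raviolo_eqI)
  fix n show "rcoeff (par (rderiv x)) n = rcoeff (rderiv (par x)) n"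
    by (cases "n = 0") (auto simp: rcoeff_par rcoeff_rderiv par_uminus par_mult)
qed

lemma par_past_rderiv: "par_past n (rderiv x) = rderiv (par_past n x)"
  by (simp add: par_past_def par_rderiv)

lemma leibniz_term:
  fixes x y :: "'r::superring"
  shows "(if basis_mult_nonzero (a + 1) b then par_past b (- (of_int (a + 1) * x)) * y else 0)
    + (if basis_mult_nonzero a (b + 1) then par_past (b + 1) x * (- (of_int (b + 1) * y)) else 0)
    = - (of_int (a + b + 2) * (if basis_mult_nonzero a b then par_past b x * y else 0))"
proof -
  have m: "par_past c x * (of_int k * y) = of_int k * (par_past c x * y)" for c k
    by (simp only: mult_of_int_commute[of k "par_past c x"] mult.assoc[symmetric])
  have p: "par_past c (- (of_int k * x)) * y = - (of_int k * (par_past c x * y))" for c k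
    by (simp add: par_past_def par_uminus par_mult mult.assoc)
  have q: "of_int (b + 1) * (par_past (b + 1) x * y) = of_int (b + 1) * (par_past b x * y)"
    by (cases "b = -1") (auto simp: par_past_def)
  have "a + b + 2 = (a + 1) + (b + 1)" by simp
  then have s: "of_int (a + b + 2) * z = of_int (a + 1) * z + of_int (b + 1) * z" for z :: 'r
    by (simp only: of_int_add distrib_right)
  show ?thesis
  proof (cases "basis_mult_nonzero a b")
    case True
    have "a = -1 \<or> basis_mult_nonzero (a + 1) b" "b = -1 \<or> basis_mult_nonzero a (b + 1)"
      using True by (auto simp: basis_mult_nonzero_def)
    then have "(if basis_mult_nonzero (a + 1) b then - (of_int (a + 1) * (par_past b x * y)) else 0)
      + (if basis_mult_nonzero a (b + 1) then - (of_int (b + 1) * (par_past b x * y)) else 0)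
      = - (of_int (a + 1) * (par_past b x * y)) - of_int (b + 1) * (par_past b x * y)"
      by auto
    also have "\<dots> = - (of_int (a + b + 2) * (par_past b x * y))"
      unfolding s by simp
    finally show ?thesis
      using True by (simp only: m p q mult_minus_right if_True)
  next
    case False
    then consider "\<not> basis_mult_nonzero (a + 1) b" "\<not> basis_mult_nonzero a (b + 1)"
      | "a + b + 2 = 0" "basis_mult_nonzero (a + 1) b \<or> a = - 1" "basis_mult_nonzero a (b + 1) \<or> b = -1"
    proof (cases "a + b + 2 = 0")
      case True
      then show thesis
        using False by (intro that(2)) (auto simp: basis_mult_nonzero_def)
    next
      case a: False
      show thesis
        by (rule that(1)) (use a False in \<open>auto simp: basis_mult_nonzero_def\<close>)
    qed
    then show ?thesis
    proof cases
      case 1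
      then show ?thesis using False by simp
    next
      case 2
      then have "(if basis_mult_nonzero (a + 1) b then - (of_int (a + 1) * (par_past b x * y)) else 0)
        + (if basis_mult_nonzero a (b + 1) then - (of_int (b + 1) * (par_past b x * y)) else 0)
        = - (of_int (a + 1) * (par_past b x * y)) - of_int (b + 1) * (par_past b x * y)"
        by auto
      also have "\<dots> = - (of_int (a + b + 2) * (par_past b x * y))"
        unfolding s by simp
      finally show ?thesis
        using False 2(1) by (simp only: m p q mult_minus_right if_False) simp
    qed
  qed
qed

lemma rderiv_mult: "rderiv (x * y) = rderiv x * y + x * rderiv y"
proof (rule raviolo_eqI)
  fix n
  obtain B where B: "B \<ge> 0" "\<And>n. n \<ge> B \<Longrightarrow> rcoeff x n = 0" "\<And>n. n \<ge> B \<Longrightarrow> rcoeff y n = 0"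
    by (rule common_bound[OF rcoeff_bounded rcoeff_bounded]) (rule that)
  have d: "rcoeff (rderiv x) n = 0" "rcoeff (rderiv y) n = 0" if "n \<ge> B + 1" for n
    using B that by (simp_all add: rcoeff_rderiv)
  let ?I = "{n - B - 2..<B + 1}" and ?I' = "{n - B - 1..<B + 2}"
  have 0: "rcoeff (x * y) (n - 1) = (\<Sum>a\<in>?I. if basis_mult_nonzero a (n - 1 - 1 - a)
      then par_past (n - 1 - 1 - a) (rcoeff x a) * rcoeff y (n - 1 - 1 - a) else 0)"
    unfolding rcoeff_mult by (rule raviolo_mult_coeff_box1[where B = B]) (use B in auto)
  have "rcoeff (rderiv x * y) n = (\<Sum>a\<in>?I'. if basis_mult_nonzero a (n - 1 - a)
      then par_past (n - 1 - a) (rcoeff (rderiv x) a) * rcoeff y (n - 1 - a) else 0)"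
    unfolding rcoeff_mult by (rule raviolo_mult_coeff_box1[where B = "B + 1"]) (use B d in auto)
  also have "\<dots> = (\<Sum>a\<in>?I. if basis_mult_nonzero (a + 1) (n - 1 - (a + 1))
      then par_past (n - 1 - (a + 1)) (rcoeff (rderiv x) (a + 1)) * rcoeff y (n - 1 - (a + 1)) else 0)"
    by (rule sum.reindex_bij_witness[of _ "\<lambda>a. a + 1" "\<lambda>a. a - 1"]) auto
  finally have 1: "rcoeff (rderiv x * y) n = \<dots>" .
  have 2: "rcoeff (x * rderiv y) n = (\<Sum>a\<in>?I. if basis_mult_nonzero a (n - 1 - a)
      then par_past (n - 1 - a) (rcoeff x a) * rcoeff (rderiv y) (n - 1 - a) else 0)"
    unfolding rcoeff_mult by (rule raviolo_mult_coeff_box1[where B = "B + 1"]) (use B d in auto)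
  have "rcoeff (rderiv x * y) n + rcoeff (x * rderiv y) n = - (of_int n * rcoeff (x * y) (n - 1))"
    unfolding 0 1 2 sum.distrib[symmetric] sum_distrib_left sum_negf[symmetric]
  proof (rule sum.cong[OF refl])
    fix a
    define b where "b = n - 2 - a"
    have b: "n - 1 - (a + 1) = b" "n - 1 - a = b + 1" "n - 1 - 1 - a = b" "n = a + b + 2"
      by (simp_all add: b_def)
    show "(if basis_mult_nonzero (a + 1) (n - 1 - (a + 1))
          then par_past (n - 1 - (a + 1)) (rcoeff (rderiv x) (a + 1)) * rcoeff y (n - 1 - (a + 1)) else 0) +
         (if basis_mult_nonzero a (n - 1 - a)
          then par_past (n - 1 - a) (rcoeff x a) * rcoeff (rderiv y) (n - 1 - a) else 0) =
         - (of_int n * (if basis_mult_nonzero a (n - 1 - 1 - a)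
           then par_past (n - 1 - 1 - a) (rcoeff x a) * rcoeff y (n - 1 - 1 - a) else 0))"
      unfolding b(1-3) unfolding rcoeff_rderiv add_diff_cancel_right' unfolding b(4)
      by (rule leibniz_term)
  qed
  then show "rcoeff (rderiv (x * y)) n = rcoeff (rderiv x * y + x * rderiv y) n"
    by (simp add: rcoeff_rderiv[of "x * y"])
qed

lemma inner_deriv_mult: "inner_deriv (x * y) = inner_deriv x * y + x * inner_deriv y"
proof (rule raviolo_eqI)
  fix n
  obtain B where B: "B \<ge> 0" "\<And>n. n \<ge> B \<Longrightarrow> rcoeff x n = 0" "\<And>n. n \<ge> B \<Longrightarrow> rcoeff y n = 0"
    by (rule common_bound[OF rcoeff_bounded rcoeff_bounded]) (rule that)
  have d: "rcoeff (inner_deriv x) n = 0" "rcoeff (inner_deriv y) n = 0" if "n \<ge> B" for n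
    using B that by (simp_all add: rcoeff_inner_deriv)
  let ?I = "{n - B..<B}"
  have 0: "rcoeff (x * y) n = (\<Sum>a\<in>?I. if basis_mult_nonzero a (n - 1 - a)
      then par_past (n - 1 - a) (rcoeff x a) * rcoeff y (n - 1 - a) else 0)"
    unfolding rcoeff_mult by (rule raviolo_mult_coeff_box1[where B = B]) (use B in auto)
  have 1: "rcoeff (inner_deriv x * y) n = (\<Sum>a\<in>?I. if basis_mult_nonzero a (n - 1 - a)
      then par_past (n - 1 - a) (rcoeff (inner_deriv x) a) * rcoeff y (n - 1 - a) else 0)"
    unfolding rcoeff_mult by (rule raviolo_mult_coeff_box1[where B = B]) (use B d in auto)
  have 2: "rcoeff (x * inner_deriv y) n = (\<Sum>a\<in>?I. if basis_mult_nonzero a (n - 1 - a)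
      then par_past (n - 1 - a) (rcoeff x a) * rcoeff (inner_deriv y) (n - 1 - a) else 0)"
    unfolding rcoeff_mult by (rule raviolo_mult_coeff_box1[where B = B]) (use B d in auto)
  have "rderiv (rcoeff (x * y) n) = rcoeff (inner_deriv x * y) n + rcoeff (x * inner_deriv y) n"
    unfolding 0 1 2 rderiv_sum sum.distrib[symmetric]
    by (rule sum.cong[OF refl]) (simp add: rcoeff_inner_deriv rderiv_mult par_past_rderiv)
  then show "rcoeff (inner_deriv (x * y)) n = rcoeff (inner_deriv x * y + x * inner_deriv y) n"
    by (simp add: rcoeff_inner_deriv[of "x * y"])
qed

lemma basis_elt_zero [simp]: "basis_elt k 0 = 0"
  by (rule raviolo_eqI) (simp add: rcoeff_basis_elt)

lemma basis_elt_mult: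
  "basis_elt a r * basis_elt b s =
    (if basis_mult_nonzero a b then basis_elt (a + b + 1) (par_past b r * s) else 0)"
  by (rule raviolo_eqI) (auto simp: rcoeff_basis_elt_mult rcoeff_basis_elt)

lemma par_basis_elt: "par (basis_elt k r) = (if k \<ge> 0 then - basis_elt k (par r) else basis_elt k (par r))"
  by (rule raviolo_eqI) (auto simp: rcoeff_par rcoeff_basis_elt)

lemma basis_elt_eq_regular: "basis_elt (-1) r = regular_series (\<lambda>i. if i = 0 then r else 0)"
  by (rule raviolo_eqI) (auto simp: rcoeff_basis_elt rcoeff_regular_series)

lemma basis_elt_eq_regular': "basis_elt (-2) r = regular_series (\<lambda>i. if i = 1 then r else 0)"
  by (rule raviolo_eqI) (auto simp: rcoeff_basis_elt rcoeff_regular_series)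

lemma regular_series_sum:
  "(\<Sum>a\<in>A. regular_series (f a)) = regular_series (\<lambda>n. \<Sum>a\<in>A. f a n)"
proof (rule raviolo_eqI)
  fix n
  have "rcoeff (\<Sum>a\<in>A. regular_series (f a)) n = (\<Sum>a\<in>A. rcoeff (regular_series (f a)) n)"
    by (induction A rule: infinite_finite_induct) simp_all
  then show "rcoeff (\<Sum>a\<in>A. regular_series (f a)) n = rcoeff (regular_series (\<lambda>n. \<Sum>a\<in>A. f a n)) n"
    by (simp add: rcoeff_regular_series)
qed

lemma regular_series_add:
  "regular_series f + regular_series g = regular_series (\<lambda>n. f n + g n)"
  by (rule raviolo_eqI) (simp add: rcoeff_regular_series)

lemma regular_series_zero: "regular_series (\<lambda>n. 0) = 0"
  by (rule raviolo_eqI) (simp add: rcoeff_regular_series)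

lemma regular_series_one: "regular_series (\<lambda>n. if n = 0 then 1 else 0) = 1"
  by (simp add: one_eq_basis_elt[symmetric] flip: basis_elt_eq_regular)

lemma omega_anticommute_regular:
  assumes "k \<ge> 0" "\<And>i. par (f i) = - f i"
  shows "basis_elt k 1 * regular_series f + regular_series f * basis_elt k 1 = 0"
  by (rule raviolo_eqI)
    (use assms in \<open>auto simp: rcoeff_basis_elt_mult rcoeff_mult_basis_elt rcoeff_regular_series
      basis_mult_nonzero_def par_past_def\<close>)

lemma basis_elt_omega_mult:
  "a \<ge> 0 \<Longrightarrow> b \<ge> 0 \<Longrightarrow> basis_elt a r * basis_elt b s = 0"
  by (simp add: basis_elt_mult basis_mult_nonzero_def)

lemma omega_diff_mult: "omega_diff m * omega_diff n = 0"
  by (simp add: omega_diff_def regular_series_mult basis_elt_omega_mult regular_series_zero)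

lemma omega_diff_inner_mult:
  "omega_diff m * basis_elt (-1) (basis_elt (int n) 1) = 0"
  "basis_elt (-1) (basis_elt (int n) 1) * omega_diff m = 0"
  by (simp_all add: omega_diff_def basis_elt_eq_regular regular_series_mult basis_elt_omega_mult
      regular_series_zero if_distrib[of "\<lambda>x. _ * x"] if_distrib[of "\<lambda>x. x * _"] cong: if_cong)

lemma outer_inner_anticommute:
  "basis_elt (int m) 1 * basis_elt (-1) (basis_elt (int n) (1::complex))
    + basis_elt (-1) (basis_elt (int n) 1) * basis_elt (int m) 1 = 0"
  unfolding basis_elt_eq_regular
  by (rule omega_anticommute_regular) (auto simp: par_basis_elt)

lemma outer_diff_anticommute:
  "basis_elt (int m) 1 * omega_diff n + omega_diff n * basis_elt (int m) 1 = 0"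
  unfolding omega_diff_def by (rule omega_anticommute_regular) (auto simp: par_basis_elt)

lemma outer_mult_omega_diff:
  "basis_elt (-2) 1 * omega_diff m = regular_series (\<lambda>n. if n = 0 then 0
     else basis_elt (int (m + n) - 1) (of_nat ((m + n - 1) choose (n - 1))))"
proof (rule raviolo_eqI)
  fix n :: int
  show "rcoeff (basis_elt (-2) 1 * omega_diff m) n = rcoeff (regular_series (\<lambda>n. if n = 0 then 0
     else basis_elt (int (m + n) - 1) (of_nat ((m + n - 1) choose (n - 1))))) n"
  proof (cases "n < -1")
    case True
    define k where "k = nat (- n - 2)"
    have n: "n = - int k - 2" using True by (simp add: k_def)
    have "nat (- n - 1) = Suc k" "nat (- (n - 1 - - 2) - 1) = k" by (simp_all add: n)
    then show ?thesis
      by (simp add: n rcoeff_basis_elt_mult omega_diff_def rcoeff_regular_series basis_mult_nonzero_def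
          par_past_def algebra_simps)
  next
    case False
    then show ?thesis
      by (auto simp: rcoeff_basis_elt_mult omega_diff_def rcoeff_regular_series basis_mult_nonzero_def)
  qed
qed

lemma inner_mult_omega_diff:
  "basis_elt (-1) (basis_elt (-2) 1) * omega_diff m = regular_series (\<lambda>n.
     if m + n = 0 then 0 else basis_elt (int (m + n) - 1) (of_nat ((m + n) choose n)))"
proof (rule raviolo_eqI)
  fix n :: int
  show "rcoeff (basis_elt (-1) (basis_elt (-2) 1) * omega_diff m) n = rcoeff (regular_series (\<lambda>n.
     if m + n = 0 then 0 else basis_elt (int (m + n) - 1) (of_nat ((m + n) choose n)))) n"
    by (auto simp: rcoeff_basis_elt_mult omega_diff_def rcoeff_regular_series basis_elt_mult
        basis_mult_nonzero_def par_past_def par_basis_elt algebra_simps)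
qed

lemma basis_elt_diff: "basis_elt k r - basis_elt k s = basis_elt k (r - s)"
  by (rule raviolo_eqI) (simp add: rcoeff_basis_elt)

lemma omega_diff_power:
  "(basis_elt (-1) (basis_elt (-2) 1) - basis_elt (-2) 1) * omega_diff (Suc m) = omega_diff m"
proof (rule raviolo_eqI)
  fix n :: int
  show "rcoeff ((basis_elt (-1) (basis_elt (-2) 1) - basis_elt (-2) 1) * omega_diff (Suc m)) n
      = rcoeff (omega_diff m) n"
  proof (cases "n < 0")
    case True
    define k where "k = nat (- n - 1)"
    have e: "int (Suc m + k) - 1 = int (m + k)" "Suc m + k - 1 = m + k" "Suc m + k \<noteq> 0" by simp_all
    have c: "of_nat (Suc m + k choose k) - (if k = 0 then 0 else of_nat (m + k choose (k - 1)))
      = (of_nat (m + k choose k) :: complex)"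
      by (cases k) simp_all
    have "basis_elt (int (m + k)) (of_nat (Suc m + k choose k))
        - (if k = 0 then 0 else basis_elt (int (m + k)) (of_nat (m + k choose (k - 1))))
        = (basis_elt (int (m + k)) (of_nat (m + k choose k)) :: complex raviolo)"
      unfolding c[symmetric] basis_elt_diff[symmetric] by simp
    moreover have "rcoeff (basis_elt (-1) (basis_elt (-2) 1) * omega_diff (Suc m)) n =
        basis_elt (int (m + k)) (of_nat (Suc m + k choose k))"
      by (simp only: inner_mult_omega_diff rcoeff_regular_series k_def[symmetric] True if_True e if_False)
    moreover have "rcoeff (basis_elt (-2) 1 * omega_diff (Suc m)) n =
        (if k = 0 then 0 else basis_elt (int (m + k)) (of_nat (m + k choose (k - 1))))"
      by (simp only: outer_mult_omega_diff rcoeff_regular_series k_def[symmetric] True if_True e)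
    moreover have "rcoeff (omega_diff m) n = basis_elt (int (m + k)) (of_nat (m + k choose k))"
      by (simp only: omega_diff_def rcoeff_regular_series k_def[symmetric] True if_True)
    ultimately show ?thesis
      by (simp only: left_diff_distrib rcoeff_diff)
  next
    case False
    then show ?thesis
      by (simp only: left_diff_distrib rcoeff_diff inner_mult_omega_diff outer_mult_omega_diff
          rcoeff_regular_series) (simp add: omega_diff_def rcoeff_regular_series)
  qed
qed

lemma omega_diff_power_0:
  "(basis_elt (-1) (basis_elt (-2) 1) - basis_elt (-2) 1) * omega_diff 0 = 0"
  by (rule raviolo_eqI)
    (auto simp: left_diff_distrib inner_mult_omega_diff outer_mult_omega_diff rcoeff_regular_series)

lemma omega_diff_arnold:
  "basis_elt 0 1 * omega_diff 0 = basis_elt 0 (basis_elt 0 1)"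
  by (rule raviolo_eqI)
    (auto simp: rcoeff_basis_elt_mult rcoeff_basis_elt omega_diff_def rcoeff_regular_series
      basis_mult_nonzero_def)

lemma inner_outer_arnold:
  "basis_elt (-1) (basis_elt 0 1) * basis_elt 0 1 = - basis_elt 0 (basis_elt 0 (1::complex))"
  by (rule raviolo_eqI)
    (auto simp: basis_elt_mult basis_mult_nonzero_def par_past_def par_basis_elt rcoeff_basis_elt)

lemma of_nat_mult_basis_elt: "of_nat j * basis_elt k r = basis_elt k (of_nat j * r)"
  by (rule raviolo_eqI) (simp add: rcoeff_of_nat_mult rcoeff_basis_elt)

lemma rderiv_basis_elt: "rderiv (basis_elt (int m) r) = - (of_nat (m + 1) * basis_elt (int (m + 1)) r)"
  unfolding of_nat_mult_basis_elt
  by (rule raviolo_eqI) (auto simp: rcoeff_rderiv rcoeff_basis_elt)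

lemma rderiv_const: "rderiv (basis_elt (-1) r) = 0"
  by (rule raviolo_eqI) (auto simp: rcoeff_rderiv rcoeff_basis_elt)

lemma inner_deriv_basis_elt: "inner_deriv (basis_elt k r) = basis_elt k (rderiv r)"
  by (rule raviolo_eqI) (auto simp: rcoeff_inner_deriv rcoeff_basis_elt)

lemma rderiv_one [simp]: "rderiv 1 = 0"
  by (simp add: one_eq_basis_elt rderiv_const)

lemma inner_deriv_inner:
  "inner_deriv (basis_elt (-1) (basis_elt (int m) r)) =
    - (of_nat (m + 1) * basis_elt (-1) (basis_elt (int (m + 1)) r))"
  unfolding inner_deriv_basis_elt rderiv_basis_elt of_nat_mult_basis_elt
  by (rule raviolo_eqI) (simp add: rcoeff_basis_elt)

lemma binomial_shift:
  "Suc k * (Suc (m + k) choose Suc k) = Suc m * (Suc (m + k) choose k)"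
  using binomial_absorb_comp[of "Suc (m + k)" k] Suc_times_binomial[of k "m + k"]
  by (simp add: algebra_simps)

lemma rderiv_omega_diff: "rderiv (omega_diff m) = of_nat (m + 1) * omega_diff (m + 1)"
proof (rule raviolo_eqI)
  fix n :: int
  show "rcoeff (rderiv (omega_diff m)) n = rcoeff (of_nat (m + 1) * omega_diff (m + 1)) n"
  proof (cases "n < 0")
    case True
    define k where "k = nat (- n - 1)"
    have n: "n = - int k - 1" using True by (simp add: k_def)
    have k: "nat (- n - 1) = k" "nat (- (n - 1) - 1) = Suc k" by (simp_all add: n)
    have c: "- of_int n = (of_nat (Suc k) :: complex raviolo)"
      by (simp add: n)
    have "rcoeff (rderiv (omega_diff m)) n =
        of_nat (Suc k) * basis_elt (int (m + Suc k)) (of_nat ((m + Suc k) choose Suc k))"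
      unfolding rcoeff_rderiv mult_minus_left[symmetric] c using True k
      by (simp add: omega_diff_def rcoeff_regular_series del: of_nat_Suc of_nat_add binomial_Suc_Suc)
    also have "\<dots> = basis_elt (int (m + Suc k)) (of_nat (Suc k * (Suc (m + k) choose Suc k)))"
      unfolding of_nat_mult_basis_elt of_nat_mult add_Suc_right ..
    also have "\<dots> = of_nat (Suc m) * basis_elt (int (m + Suc k)) (of_nat (Suc (m + k) choose k))"
      unfolding binomial_shift of_nat_mult_basis_elt of_nat_mult add_Suc_right ..
    also have "\<dots> = rcoeff (of_nat (m + 1) * omega_diff (m + 1)) n"
      unfolding rcoeff_of_nat_mult using True k
      by (simp add: omega_diff_def rcoeff_regular_series del: of_nat_Suc)
    finally show ?thesis .
  next
    case False
    then show ?thesis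
      unfolding rcoeff_of_nat_mult
      by (cases "n = 0") (simp_all add: rcoeff_rderiv omega_diff_def rcoeff_regular_series)
  qed
qed

lemma inner_deriv_omega_diff:
  "inner_deriv (omega_diff m) = - (of_nat (m + 1) * omega_diff (m + 1))"
proof (rule raviolo_eqI)
  fix n :: int
  define k where "k = nat (- n - 1)"
  have "Suc (m + k) * (m + k choose k) = Suc m * (Suc (m + k) choose k)"
    using binomial_shift[of k m] Suc_times_binomial[of k "m + k"] by (simp del: binomial_Suc_Suc)
  then have c: "of_nat (Suc (m + k)) * of_nat (m + k choose k) =
      (of_nat (Suc m) * of_nat (Suc (m + k) choose k) :: complex)"
    by (metis of_nat_mult)
  show "rcoeff (inner_deriv (omega_diff m)) n = rcoeff (- (of_nat (m + 1) * omega_diff (m + 1))) n"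
    unfolding rcoeff_inner_deriv omega_diff_def rcoeff_regular_series rcoeff_minus
      rcoeff_of_nat_mult k_def[symmetric]
  proof (cases "n < 0")
    case True
    have e: "m + k + 1 = Suc (m + k)" "m + 1 = Suc m" "Suc m + k = Suc (m + k)" by simp_all
    show "rderiv (if n < 0 then basis_elt (int (m + k)) (complex_of_nat (m + k choose k)) else 0) =
      - (of_nat (m + 1) * (if n < 0 then basis_elt (int (m + 1 + k)) (of_nat (m + 1 + k choose k)) else 0))"
      using True by (simp only: if_True rderiv_basis_elt e of_nat_mult_basis_elt c)
  qed simp
qed

lemma rderiv_regular_series:
  "rderiv (regular_series f) = regular_series (\<lambda>i. of_nat (Suc i) * f (Suc i))"
proof (rule raviolo_eqI)
  fix n :: int
  show "rcoeff (rderiv (regular_series f)) n =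
      rcoeff (regular_series (\<lambda>i. of_nat (Suc i) * f (Suc i))) n"
  proof (cases "n < 0")
    case True
    define k where "k = nat (- n - 1)"
    have n: "n = - int k - 1" using True by (simp add: k_def)
    have k: "nat (- n - 1) = k" "nat (- (n - 1) - 1) = Suc k" by (simp_all add: n)
    have "- of_int n = (of_nat (Suc k) :: 'a)" by (simp add: n)
    then show ?thesis
      using True k by (simp add: rcoeff_rderiv rcoeff_regular_series flip: mult_minus_left)
  next
    case False
    then show ?thesis
      by (cases "n = 0") (simp_all add: rcoeff_rderiv rcoeff_regular_series)
  qed
qed

lemma inner_deriv_regular_series:
  "inner_deriv (regular_series f) = regular_series (\<lambda>i. rderiv (f i))"
  by (rule raviolo_eqI) (simp add: rcoeff_inner_deriv rcoeff_regular_series)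

lemma complex_series_central: "regular_series f * x = x * regular_series (f :: nat \<Rightarrow> complex)"
  by (rule regular_series_central) (simp_all add: par_complex_def)

lemma series_zw_central: "series_zw c * x = x * series_zw c"
  unfolding series_zw_def
  by (rule regular_series_central) (simp_all add: complex_series_central par_regular_series par_complex_def)

lemma series_wz_central: "series_wz c * x = x * series_wz c"
  unfolding series_wz_def
  by (rule regular_series_central) (simp_all add: complex_series_central par_regular_series par_complex_def)

lemma series_zw_mult: "series_zw (a * b) = series_zw a * series_zw b"
proof -
  have "(\<Sum>i=0..k. regular_series (fps_nth (fps_nth a i)) * regular_series (fps_nth (fps_nth b (k - i))))
      = regular_series (fps_nth (fps_nth (a * b) k))" for k
    unfolding regular_series_mult regular_series_sum
    by (rule arg_cong[where f = regular_series], rule ext) (simp add: fps_mult_nth fps_sum_nth)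
  then show ?thesis by (simp add: series_zw_def regular_series_mult)
qed

lemma series_wz_mult: "series_wz (a * b) = series_wz a * series_wz b"
proof -
  have "(\<Sum>i=0..k. regular_series (\<lambda>j. fps_nth (fps_nth a j) i) *
        regular_series (\<lambda>j. fps_nth (fps_nth b j) (k - i)))
      = regular_series (\<lambda>j. fps_nth (fps_nth (a * b) j) k)" for k
    by (simp add: regular_series_mult regular_series_sum fps_mult_nth fps_sum_nth)
      (rule arg_cong[where f = regular_series], rule ext, rule sum.swap)
  then show ?thesis by (simp add: series_wz_def regular_series_mult)
qed

lemma series_add:
  "series_zw (a + b) = series_zw a + series_zw b"
  "series_wz (a + b) = series_wz a + series_wz b"
  by (simp_all add: series_zw_def series_wz_def regular_series_add)

lemma series_uminus:
  "series_zw (- a) = - series_zw a" "series_wz (- a) = - series_wz a"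
  using series_add(1)[of a "- a"] series_add(2)[of a "- a"]
  by (simp_all add: series_zw_def series_wz_def regular_series_zero eq_neg_iff_add_eq_0 add.commute)

lemma series_diff:
  "series_zw (a - b) = series_zw a - series_zw b"
  "series_wz (a - b) = series_wz a - series_wz b"
  using series_add[of a "- b"] by (simp_all add: series_uminus)

lemma series_one: "series_zw 1 = 1" "series_wz 1 = 1"
proof -
  have f: "(\<lambda>n. if n = 0 then 1 else 0) = (\<lambda>j. regular_series (\<lambda>i. fps_nth (fps_nth 1 j) i))"
    "(\<lambda>n. if n = 0 then 1 else 0) = (\<lambda>i. regular_series (\<lambda>j. fps_nth (fps_nth (1 :: zw_series) j) i))"
    by (auto simp: fun_eq_iff regular_series_one[symmetric] regular_series_zero[symmetric]
        intro!: arg_cong[where f = regular_series])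
  show "series_zw 1 = 1" "series_wz 1 = 1"
    unfolding series_zw_def series_wz_def f[symmetric] by (rule regular_series_one)+
qed

lemma series_variables:
  "series_zw scalar_z = basis_elt (-1) (basis_elt (-2) 1)"
  "series_zw scalar_w = basis_elt (-2) 1"
  "series_wz scalar_w = basis_elt (-1) (basis_elt (-2) 1)"
  "series_wz scalar_z = basis_elt (-2) 1"
proof -
  note r = basis_elt_eq_regular basis_elt_eq_regular' series_zw_def series_wz_def
    scalar_z_def scalar_w_def regular_series_one[symmetric] regular_series_zero[symmetric]
  show "series_zw scalar_z = basis_elt (-1) (basis_elt (-2) 1)"
    "series_zw scalar_w = basis_elt (-2) 1"
    "series_wz scalar_w = basis_elt (-1) (basis_elt (-2) 1)"
    "series_wz scalar_z = basis_elt (-2) 1"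
    unfolding r by (auto intro!: arg_cong[where f = regular_series] simp: fun_eq_iff)
qed

lemma series_deriv:
  "inner_deriv (series_zw a) = series_zw (scalar_dz a)"
  "rderiv (series_zw a) = series_zw (scalar_dw a)"
  "rderiv (series_wz a) = series_wz (scalar_dz a)"
  "inner_deriv (series_wz a) = series_wz (scalar_dw a)"
proof -
  have n: "of_nat k * regular_series f = regular_series (\<lambda>i. of_nat k * f i)"
    for k and f :: "nat \<Rightarrow> complex"
    by (rule raviolo_eqI) (simp add: rcoeff_of_nat_mult rcoeff_regular_series)
  have nth: "fps_nth (of_nat k * f) i = of_nat k * fps_nth f i" for k i and f :: "complex fps"
    by (simp add: fps_mult_left_const_nth flip: fps_of_nat)
  show "inner_deriv (series_zw a) = series_zw (scalar_dz a)"
    "rderiv (series_zw a) = series_zw (scalar_dw a)"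
    "rderiv (series_wz a) = series_wz (scalar_dz a)"
    "inner_deriv (series_wz a) = series_wz (scalar_dw a)"
    by (simp_all add: series_zw_def series_wz_def inner_deriv_regular_series rderiv_regular_series
        scalar_dz_def scalar_dw_def n nth fps_deriv_nth del: of_nat_Suc)
qed

lemma inner_inner_mult:
  "basis_elt (-1) (basis_elt (int m) 1) * basis_elt (-1) (basis_elt (int n) (1::complex)) = 0"
  by (simp add: basis_elt_mult basis_mult_nonzero_def par_past_def)

lemmas omega_products = basis_elt_omega_mult inner_inner_mult omega_diff_mult omega_diff_inner_mult
  outer_inner_anticommute outer_diff_anticommute
  outer_inner_anticommute[unfolded add.commute[of "basis_elt (int _) 1 * _"]]
  outer_diff_anticommute[unfolded add.commute[of "basis_elt (int _) 1 * _"]]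

lemma variable_products:
  fixes one :: complex
  defines "one \<equiv> 1"
  shows "basis_elt (-2) 1 * basis_elt (int (Suc m)) r = basis_elt (int m) r"
    "basis_elt (-2) 1 * basis_elt (int 0) r = 0"
    "basis_elt (-1) (basis_elt (-2) 1) * basis_elt (-1) (basis_elt (int (Suc m)) one) =
      basis_elt (-1) (basis_elt (int m) one)"
    "basis_elt (-1) (basis_elt (-2) 1) * basis_elt (-1) (basis_elt (int 0) one) = 0"
  by (simp_all add: basis_elt_mult basis_mult_nonzero_def par_past_def)

lemma omega_diff_power':
  "(basis_elt (-2) 1 - basis_elt (-1) (basis_elt (-2) 1)) * omega_diff (Suc m) = - omega_diff m"
  "(basis_elt (-2) 1 - basis_elt (-1) (basis_elt (-2) 1)) * omega_diff 0 = 0"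
  using omega_diff_power[of m] omega_diff_power_0 by (simp_all add: left_diff_distrib algebra_simps)

lemma inner_deriv_outer: "inner_deriv (basis_elt k 1) = 0"
  by (simp add: inner_deriv_basis_elt)

lemma rderiv_uminus: "rderiv (- x) = - rderiv x"
  by (rule raviolo_eqI) (simp add: rcoeff_rderiv)

lemma inner_deriv_uminus: "inner_deriv (- x) = - inner_deriv x"
  by (rule raviolo_eqI) (simp add: rcoeff_inner_deriv rderiv_uminus)

lemma deriv_sign: "rderiv ((-1) ^ m * x) = (-1) ^ m * rderiv x"
  "inner_deriv ((-1) ^ m * y) = (-1) ^ m * inner_deriv y"
  by (simp_all add: uminus_power_if rderiv_uminus inner_deriv_uminus)

lemma outer_diff_swap: "omega_diff n * basis_elt (int m) 1 = - (basis_elt (int m) 1 * omega_diff n)"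
  using outer_diff_anticommute[of m n] by (simp add: eq_neg_iff_add_eq_0 add.commute)

interpretation expand_zw: omega_evaluation series_zw omega_expand_zw inner_deriv rderiv
proof
  fix a x
  show "series_zw a * x = x * series_zw a" by (rule series_zw_central)
next
  fix k l
  show "omega_expand_zw k * omega_expand_zw l + omega_expand_zw l * omega_expand_zw k = 0"
    by (cases k; cases l) (simp_all add: omega_products)
next
  fix y Om m
  assume "(y, Om) \<in> variable_families"
  then show "series_zw y * omega_expand_zw (Om (Suc m)) = omega_expand_zw (Om m)"
    by cases (simp_all only: omega_expand_zw.simps series_variables series_diff variable_products
        omega_diff_power)
next
  fix y Om
  assume "(y, Om) \<in> variable_families"
  then show "series_zw y * omega_expand_zw (Om 0) = 0"
    by cases (simp_all only: omega_expand_zw.simps series_variables series_diff variable_products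
        omega_diff_power_0)
next
  fix y Om m n
  assume "(y, Om) \<in> variable_families"
  then show "omega_expand_zw (Om n) * omega_expand_zw (Om m) = 0"
    by cases (simp_all add: omega_products)
next
  show "omega_expand_zw (Omega_zw 0) * omega_expand_zw (Omega_z 0) +
    omega_expand_zw (Omega_w 0) * omega_expand_zw (Omega_zw 0) +
    omega_expand_zw (Omega_z 0) * omega_expand_zw (Omega_w 0) = 0"
    using omega_diff_inner_mult(1)[of 0 0] omega_diff_arnold inner_outer_arnold by simp
qed (simp_all only: series_add series_zw_mult series_one rderiv_add inner_deriv_add
    rderiv_mult inner_deriv_mult series_deriv rderiv_basis_elt inner_deriv_inner rderiv_const
    inner_deriv_outer inner_deriv_omega_diff rderiv_omega_diff omega_expand_zw.simps)

interpretation expand_wz: omega_evaluation series_wz omega_expand_wz rderiv inner_deriv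
proof
  fix a x
  show "series_wz a * x = x * series_wz a" by (rule series_wz_central)
next
  fix k l
  show "omega_expand_wz k * omega_expand_wz l + omega_expand_wz l * omega_expand_wz k = 0"
    by (cases k; cases l) (auto simp add: omega_products uminus_power_if outer_diff_swap)
next
  fix y Om m
  assume "(y, Om) \<in> variable_families"
  then show "series_wz y * omega_expand_wz (Om (Suc m)) = omega_expand_wz (Om m)"
  proof cases
    case 3
    then show ?thesis
      using omega_diff_power'(1)[of m] by (simp add: series_variables series_diff uminus_power_if)
  qed (simp_all only: omega_expand_wz.simps series_variables variable_products)
next
  fix y Om
  assume "(y, Om) \<in> variable_families"
  then show "series_wz y * omega_expand_wz (Om 0) = 0"
  proof cases
    case 3
    then show ?thesis
      using omega_diff_power'(2) by (simp add: series_variables series_diff)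
  qed (simp_all only: omega_expand_wz.simps series_variables variable_products)
next
  fix y Om m n
  assume "(y, Om) \<in> variable_families"
  then show "omega_expand_wz (Om n) * omega_expand_wz (Om m) = 0"
    by cases (auto simp add: omega_products uminus_power_if)
next
  have "omega_diff 0 * basis_elt 0 1 = - basis_elt 0 (basis_elt 0 1)"
    using outer_diff_anticommute[of 0 0] omega_diff_arnold by (simp add: eq_neg_iff_add_eq_0 add.commute)
  moreover have "basis_elt 0 1 * basis_elt (-1) (basis_elt 0 1) = basis_elt 0 (basis_elt 0 (1::complex))"
    using outer_inner_anticommute[of 0 0] inner_outer_arnold by (simp add: eq_neg_iff_add_eq_0)
  ultimately show "omega_expand_wz (Omega_zw 0) * omega_expand_wz (Omega_z 0) +
    omega_expand_wz (Omega_w 0) * omega_expand_wz (Omega_zw 0) +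
    omega_expand_wz (Omega_z 0) * omega_expand_wz (Omega_w 0) = 0"
    using omega_diff_inner_mult(2)[of 0 0] by simp
next
  have sign: "(-1) ^ m * (of_nat k * x) = of_nat k * ((-1) ^ m * x)" for m k and x :: "complex raviolo raviolo"
    by (simp add: uminus_power_if)
  fix m
  show "rderiv (omega_expand_wz (Omega_zw m)) = - (of_nat (m + 1) * omega_expand_wz (Omega_zw (m + 1)))"
    "inner_deriv (omega_expand_wz (Omega_zw m)) = of_nat (m + 1) * omega_expand_wz (Omega_zw (m + 1))"
    unfolding omega_expand_wz.simps deriv_sign rderiv_omega_diff inner_deriv_omega_diff
    by (simp_all add: sign del: of_nat_add of_nat_Suc)
qed (simp_all only: series_add series_wz_mult series_one rderiv_add inner_deriv_add
    rderiv_mult inner_deriv_mult series_deriv rderiv_basis_elt inner_deriv_inner rderiv_const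
    inner_deriv_outer omega_expand_wz.simps)

text \<open>
  The expansions to \<open>\<complex>\<langle>\<langle>z\<rangle>\<rangle>\<langle>\<langle>w\<rangle>\<rangle>\<close> (\<open>expansion_zw\<close>) and \<open>\<complex>\<langle>\<langle>w\<rangle>\<rangle>\<langle>\<langle>z\<rangle>\<rangle>\<close> (\<open>expansion_wz\<close>).  The outer
  \<open>raviolo\<close> carries the variable written last: \<open>rcoeff (rcoeff (expansion_zw F) n) m\<close> belongs to
  \<open>e\<^sub>n(w) e\<^sub>m(z)\<close>, and \<open>rcoeff (rcoeff (expansion_wz F) m) n\<close> to \<open>e\<^sub>m(z) e\<^sub>n(w)\<close>.
\<close>

lift_definition expansion_zw :: "kzw \<Rightarrow> complex raviolo raviolo" is
  "free_eval series_zw omega_expand_zw"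
  by (rule expand_zw.ev_respects)

lift_definition expansion_wz :: "kzw \<Rightarrow> complex raviolo raviolo" is
  "free_eval series_wz omega_expand_wz"
  by (rule expand_wz.ev_respects)

text \<open>\<open>F\<close> has a representative in which only \<open>\<Omega>\<^sub>z\<^sub>-\<^sub>w\<^sup>k\<close> with \<open>k < N\<close> occur.\<close>

definition pole_order_zw_less :: "nat \<Rightarrow> kzw \<Rightarrow> bool" where
  "pole_order_zw_less N F \<longleftrightarrow>
     (\<exists>f. abs_kzw f = F \<and> (\<forall>u\<in>Poly_Mapping.keys f. \<forall>k. Omega_zw k \<in> set (letters u) \<longrightarrow> k < N))"

section \<open>Raviolo fields\<close>

locale graded_vector_space = vector_space scale
  for scale :: "complex \<Rightarrow> 'v::ab_group_add \<Rightarrow> 'v" +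
  fixes V :: "int \<Rightarrow> 'v set"
  assumes subspace_component: "subspace (V r)"
    and direct_sum: "\<exists>!f. (\<forall>r. f r \<in> V r) \<and> finite {r. f r \<noteq> 0} \<and> v = (\<Sum>r | f r \<noteq> 0. f r)"

definition homogeneous_endo ::
    "(complex \<Rightarrow> 'v::ab_group_add \<Rightarrow> 'v) \<Rightarrow> (int \<Rightarrow> 'v set) \<Rightarrow> int \<Rightarrow> ('v \<Rightarrow> 'v) \<Rightarrow> bool" where
  "homogeneous_endo scale V d T \<longleftrightarrow>
     Vector_Spaces.linear scale scale T \<and> (\<forall>r. \<forall>v\<in>V r. T v \<in> V (r + d))"

text \<open>
  An element of \<open>End(V) \<otimes> \<K>\<^bsub>dist\<^esub>\<close> is given by its modes: \<open>A m\<close> is the coefficient of the basis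
  element \<open>e\<^sub>m\<close>, that is, of \<open>z\<^bsup>-m-1\<^esup>\<close> for \<open>m < 0\<close> and of \<open>\<Omega>\<^sub>z\<^sup>m\<close> for \<open>m \<ge> 0\<close>.
\<close>

type_synonym 'v modes = "int \<Rightarrow> 'v \<Rightarrow> 'v"

definition basis_degree :: "int \<Rightarrow> int" where
  "basis_degree m = (if m < 0 then 0 else 1)"

definition raviolo_field ::
    "(complex \<Rightarrow> 'v::ab_group_add \<Rightarrow> 'v) \<Rightarrow> 'v modes \<Rightarrow> bool" where
  "raviolo_field scale A \<longleftrightarrow>
     (\<forall>m. Vector_Spaces.linear scale scale (A m)) \<and> (\<forall>v. \<exists>N. \<forall>m\<ge>N. A m v = 0)"

definition homogeneous_raviolo_field ::
    "(complex \<Rightarrow> 'v::ab_group_add \<Rightarrow> 'v) \<Rightarrow> (int \<Rightarrow> 'v set) \<Rightarrow> int \<Rightarrow> 'v modes \<Rightarrow> bool" where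
  "homogeneous_raviolo_field scale V p A \<longleftrightarrow>
     raviolo_field scale A \<and> (\<forall>m. homogeneous_endo scale V (p - basis_degree m) (A m))"

text \<open>\<open>(-1)\<^sup>k x\<close>\<close>

definition koszul :: "int \<Rightarrow> 'a::ab_group_add \<Rightarrow> 'a" where
  "koszul k x = (if even k then x else - x)"

text \<open>
  Mutual locality of \<open>A\<close>, \<open>B\<close>, homogeneous of degrees \<open>p\<close>, \<open>q\<close>.  Moving \<open>e\<^sub>n(w)\<close> to the left in
  \<open>e\<^sub>m(z) A\<^sub>m e\<^sub>n(w) B\<^sub>n v\<close> past \<open>e\<^sub>m(z) A\<^sub>m\<close>, which has total degree \<open>p\<close>, gives
  \<open>(-1)\<^bsup>p|e\<^sub>n|\<^esup> e\<^sub>n(w) e\<^sub>m(z) A\<^sub>m B\<^sub>n v\<close>, in the order of the basis elements used in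
  \<open>\<complex>\<langle>\<langle>z\<rangle>\<rangle>\<langle>\<langle>w\<rangle>\<rangle>\<close> above (outer variable first); likewise for \<open>B(w) A(z) v\<close>.  Functionals are applied
  to the coefficients.
\<close>

definition mutually_local ::
    "(complex \<Rightarrow> 'v::ab_group_add \<Rightarrow> 'v) \<Rightarrow> int \<Rightarrow> 'v modes \<Rightarrow> int \<Rightarrow> 'v modes \<Rightarrow> bool" where
  "mutually_local scale p A q B \<longleftrightarrow>
     (\<exists>N. \<forall>v \<phi>. Vector_Spaces.linear scale (*) \<phi> \<longrightarrow>
       (\<exists>F. pole_order_zw_less N F \<and>
         (\<forall>m n. rcoeff (rcoeff (expansion_zw F) n) m =
            koszul (p * basis_degree n) (\<phi> (A m (B n v)))) \<and>
         (\<forall>m n. rcoeff (rcoeff (expansion_wz F) m) n =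
            koszul (p * q) (koszul (q * basis_degree m) (\<phi> (B n (A m v)))))))"

definition id_field :: "'v::ab_group_add modes" where
  "id_field = (\<lambda>m v. if m = -1 then v else 0)"

text \<open>\<open>\<partial>\<^sub>z e\<^sub>m = -(m+1) e\<^bsub>m+1\<^esub>\<close> for all \<open>m\<close>, whence \<open>(\<partial>\<^sub>z A)\<^sub>m = -m A\<^bsub>m-1\<^esub>\<close>.\<close>

definition field_deriv ::
    "(complex \<Rightarrow> 'v::ab_group_add \<Rightarrow> 'v) \<Rightarrow> 'v modes \<Rightarrow> 'v modes" where
  "field_deriv scale A = (\<lambda>m v. scale (- of_int m) (A (m - 1) v))"

definition field_plus :: "'v::ab_group_add modes \<Rightarrow> 'v modes" where
  "field_plus A = (\<lambda>m v. if m < 0 then A m v else 0)"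

definition field_minus :: "'v::ab_group_add modes \<Rightarrow> 'v modes" where
  "field_minus A = (\<lambda>m v. if m < 0 then 0 else A m v)"

text \<open>
  The product \<open>A(z) B(z)\<close> for \<open>A\<close> homogeneous of degree \<open>p\<close>:
  \<open>e\<^sub>m A\<^sub>m e\<^sub>n B\<^sub>n = (-1)\<^bsup>|A\<^sub>m||e\<^sub>n|\<^esup> e\<^sub>m e\<^sub>n A\<^sub>m B\<^sub>n\<close>, with \<open>|A\<^sub>m| = p - |e\<^sub>m|\<close> and
  \<open>e\<^sub>m e\<^sub>n \<in> {0, e\<^bsub>m+n+1\<^esub>}\<close>.  It is only used where the sum has finitely many non-zero terms.
\<close>

definition field_mult :: "int \<Rightarrow> 'v::ab_group_add modes \<Rightarrow> 'v modes \<Rightarrow> 'v modes" where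
  "field_mult p A B = (\<lambda>N v. Sum_any (\<lambda>m. if basis_mult_nonzero m (N - 1 - m)
     then koszul ((p - basis_degree m) * basis_degree (N - 1 - m)) (A m (B (N - 1 - m) v)) else 0))"

definition normal_ordered ::
    "int \<Rightarrow> 'v::ab_group_add modes \<Rightarrow> int \<Rightarrow> 'v modes \<Rightarrow> 'v modes" where
  "normal_ordered p A q B = (\<lambda>N v.
     field_mult p (field_plus A) B N v + koszul (p * q) (field_mult q B (field_minus A) N v))"

text \<open>Nested products; each field comes with its degree.\<close>

fun normal_ordered_list :: "(int \<times> 'v::ab_group_add modes) list \<Rightarrow> 'v modes" where
  "normal_ordered_list [] = id_field"
| "normal_ordered_list [(p, A)] = A"
| "normal_ordered_list ((p, A) # B # Bs) =
     normal_ordered p A (sum_list (map fst (B # Bs))) (normal_ordered_list (B # Bs))"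

section \<open>Raviolo vertex algebras\<close>

text \<open>
  Locality is required for homogeneous vectors, where the sign \<open>(-1)\<^bsup>|a||b|\<^esup>\<close> is meaningful.
\<close>

locale raviolo_vertex_algebra = graded_vector_space scale V
  for scale :: "complex \<Rightarrow> 'v::ab_group_add \<Rightarrow> 'v" and V :: "int \<Rightarrow> 'v set" +
  fixes vac :: 'v and T :: "'v \<Rightarrow> 'v" and Y :: "'v \<Rightarrow> 'v modes"
  assumes vac_degree: "vac \<in> V 0"
    and T_endo: "homogeneous_endo scale V 0 T"
    and Y_linear: "Vector_Spaces.linear scale scale (\<lambda>a. Y a m v)"
    and Y_field: "raviolo_field scale (Y a)"
    and Y_homogeneous: "a \<in> V p \<Longrightarrow> homogeneous_raviolo_field scale V p (Y a)"
    and translation: "T (Y a m v) - Y a m (T v) = field_deriv scale (Y a) m v"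
    and T_vac: "T vac = 0"
    and Y_vac: "Y vac = id_field"
    and creation: "m \<ge> 0 \<Longrightarrow> Y a m vac = 0" "Y a (-1) vac = a"
    and locality: "a \<in> V p \<Longrightarrow> b \<in> V q \<Longrightarrow> mutually_local scale p (Y a) q (Y b)"

text \<open>For \<open>ws = [(i\<^sub>1, j\<^sub>1), \<dots>, (i\<^sub>l, j\<^sub>l)]\<close>: the vector \<open>A\<^bsup>i\<^sub>1\<^esup>\<^bsub>j\<^sub>1\<^esub> \<cdots> A\<^bsup>i\<^sub>l\<^esup>\<^bsub>j\<^sub>l\<^esub> |0\<rangle>\<close>.\<close>

definition word_vector :: "('i \<Rightarrow> 'v modes) \<Rightarrow> 'v \<Rightarrow> ('i \<times> int) list \<Rightarrow> 'v" where
  "word_vector A vac ws = foldr (\<lambda>(i, j) v. A i j v) ws vac"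

text \<open>
  The field assigned to that vector, for \<open>j\<^sub>k < 0\<close> and \<open>A\<^sup>i\<close> of degree \<open>r i\<close>.
\<close>

definition word_field ::
    "(complex \<Rightarrow> 'v::ab_group_add \<Rightarrow> 'v) \<Rightarrow> ('i \<Rightarrow> int) \<Rightarrow> ('i \<Rightarrow> 'v modes) \<Rightarrow>
      ('i \<times> int) list \<Rightarrow> 'v modes" where
  "word_field scale r A ws = (\<lambda>m v.
     scale (1 / (\<Prod>(i, j)\<leftarrow>ws. fact (nat (- j - 1))))
       (normal_ordered_list
         (map (\<lambda>(i, j). (r i, (field_deriv scale ^^ nat (- j - 1)) (A i))) ws) m v))"

end

theory Submission
  imports Defs
begin

text \<open>
  Mutual locality of \<open>A\<close> and \<open>B\<close> is a condition on their supercommutator alone: it has to be a combination of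
  derivatives of the delta distribution on \<open>z = w\<close>, the difference of the two expansions of \<open>\<Omega>\<^bsub>z-w\<^esub>\<close>.
  In modes this has three parts.  Regular modes (those with negative index) supercommute.  Along a line \<open>m + n = L\<close>
  the commutators of a regular and a polar mode are, up to sign, values of one polynomial in \<open>m\<close> that also vanishes
  at \<open>0, \<dots>, L\<close>; that the same polynomial describes the cases \<open>m \<ge> 0 > n\<close> and \<open>m < 0 \<le> n\<close> reflects that both
  expansions come from one \<open>\<Omega>\<^bsub>z-w\<^esub>\<close>.  The commutators of two polar modes are values of another polynomial.  The
  order of the pole in \<open>z - w\<close> bounds the degrees.  This is \<open>mutually_local_imp_local_upto\<close> and
  \<open>local_upto_imp_mutually_local\<close>.

  In this form the closure properties of locality are operations on polynomials: exchanging the fields reflects the lines,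
  and a derivative multiplies by \<open>m\<close>.  For Dong's lemma (\<open>local_upto_normal_ordered\<close>) the Leibniz rule expresses the
  commutator of \<open>:AB:\<close> with \<open>C\<close> by those of \<open>A\<close> and \<open>B\<close> with \<open>C\<close>, and the remaining modes only shift the
  polynomials.  One step is not formal: for \<open>i, j < 0 \<le> n\<close> the commutator \<open>[A\<^sub>i, C\<^sub>n]\<close> has to supercommute with \<open>B\<^sub>j\<close>
  (\<open>commutator_negative_mode_commute\<close>).  By the Jacobi identity the double commutator is symmetric in \<open>A\<close> and \<open>B\<close> up
  to sign.  It is therefore killed by powers of \<open>z - w\<close> and of \<open>x - w\<close>, hence by a power of \<open>z - x\<close>, and
  a power series in \<open>z\<close> and \<open>x\<close> with this property is zero.  The usual argument, which multiplies by powers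
  of \<open>z - w\<close> throughout, is not available because \<open>z - w\<close> is a zero divisor on raviolo series.

  A field that is local to the generators and annihilates the vacuum is zero (\<open>local_field_eq_zero\<close>), and if \<open>A(z) |0\<rangle>\<close>
  has no polar part, translation covariance determines it by \<open>A\<^bsub>-1\<^esub> |0\<rangle>\<close>.  So a homogeneous, translation covariant field that is local
  to the generators is determined by the vector that it creates.  The vectors that are created by such a field form a
  subspace in each degree, and this subspace contains the words, whose fields are the normal-ordered products.  As the words
  span, every homogeneous vector has exactly one such field.  This defines \<open>Y\<close>, which is linear because the field is
  unique.  Another linear map with the same values on words agrees with \<open>Y\<close> because the words span, and another vertex
  algebra structure with the given fields assigns the same fields to words because these are unique.
\<close>

section \<open>Polynomial functions on the integers\<close>

definition forward_diff :: "(int \<Rightarrow> complex) \<Rightarrow> int \<Rightarrow> complex" where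
  "forward_diff f m = f (m + 1) - f m"

text \<open>
  By Newton's formula below, the functions with vanishing \<open>N\<close>-th difference are the polynomials of
  degree less than \<open>N\<close>.  Defined through differences, they need no bookkeeping of coefficients.
\<close>

definition polyseq :: "nat \<Rightarrow> (int \<Rightarrow> complex) \<Rightarrow> bool" where
  "polyseq N f \<longleftrightarrow> (\<forall>m. (forward_diff ^^ N) f m = 0)"

lemma polyseq_0: "polyseq 0 f \<longleftrightarrow> (\<forall>m. f m = 0)"
  by (simp add: polyseq_def)

lemma polyseq_Suc: "polyseq (Suc N) f \<longleftrightarrow> polyseq N (forward_diff f)"
  by (simp add: polyseq_def funpow_Suc_right del: funpow.simps)

lemma polyseq_zero [simp]: "polyseq N (\<lambda>m. 0)"
proof (induction N)
  case (Suc N)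
  have "forward_diff (\<lambda>m. 0) = (\<lambda>m. 0)" by (simp add: forward_diff_def fun_eq_iff)
  then show ?case using Suc by (simp add: polyseq_Suc)
qed (simp add: polyseq_0)

lemma polyseq_add: "polyseq N f \<Longrightarrow> polyseq N g \<Longrightarrow> polyseq N (\<lambda>m. f m + g m)"
proof (induction N arbitrary: f g)
  case (Suc N)
  have "forward_diff (\<lambda>m. f m + g m) = (\<lambda>m. forward_diff f m + forward_diff g m)"
    by (simp add: forward_diff_def fun_eq_iff)
  then show ?case using Suc by (simp add: polyseq_Suc)
qed (simp add: polyseq_0)

lemma polyseq_cmult: "polyseq N f \<Longrightarrow> polyseq N (\<lambda>m. c * f m)"
proof (induction N arbitrary: f)
  case (Suc N)
  have "forward_diff (\<lambda>m. c * f m) = (\<lambda>m. c * forward_diff f m)"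
    by (simp add: forward_diff_def fun_eq_iff right_diff_distrib)
  then show ?case using Suc by (simp add: polyseq_Suc)
qed (simp add: polyseq_0)

lemma polyseq_uminus: "polyseq N f \<Longrightarrow> polyseq N (\<lambda>m. - f m)"
  using polyseq_cmult[of N f "-1"] by simp

lemma polyseq_diff: "polyseq N f \<Longrightarrow> polyseq N g \<Longrightarrow> polyseq N (\<lambda>m. f m - g m)"
  using polyseq_add[of N f "\<lambda>m. - g m"] polyseq_uminus[of N g] by simp

lemma polyseq_koszul: "polyseq N f \<Longrightarrow> polyseq N (\<lambda>m. koszul k (f m))"
  by (cases "even k") (simp_all add: koszul_def polyseq_uminus)

lemma polyseq_sum: "(\<And>i. i \<in> I \<Longrightarrow> polyseq N (f i)) \<Longrightarrow> polyseq N (\<lambda>m. \<Sum>i\<in>I. f i m)"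
  by (induction I rule: infinite_finite_induct) (simp_all add: polyseq_add)

lemma polyseq_shift: "polyseq N f \<Longrightarrow> polyseq N (\<lambda>m. f (m + a))"
proof (induction N arbitrary: f)
  case (Suc N)
  have "forward_diff (\<lambda>m. f (m + a)) = (\<lambda>m. forward_diff f (m + a))"
    by (simp add: forward_diff_def fun_eq_iff algebra_simps)
  then show ?case using Suc by (simp add: polyseq_Suc)
qed (simp add: polyseq_0)

lemma polyseq_reflect: "polyseq N f \<Longrightarrow> polyseq N (\<lambda>m. f (a - m))"
proof (induction N arbitrary: f a)
  case (Suc N)
  have "forward_diff (\<lambda>m. f (a - m)) = (\<lambda>m. - forward_diff f (a - 1 - m))"
    by (simp add: forward_diff_def fun_eq_iff algebra_simps)
  then show ?case using Suc by (simp add: polyseq_Suc polyseq_uminus)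
qed (simp add: polyseq_0)

lemma polyseq_mono:
  assumes "polyseq N f" "N \<le> M"
  shows "polyseq M f"
  using assms(2)
proof (induction M rule: dec_induct)
  case (step M)
  have "(forward_diff ^^ M) f = (\<lambda>m. 0)" using step by (simp add: polyseq_def fun_eq_iff)
  then show ?case by (simp add: polyseq_def forward_diff_def)
qed (rule assms(1))

lemma polyseq_id_mult: "polyseq N f \<Longrightarrow> polyseq (Suc N) (\<lambda>m. of_int m * f m)"
proof (induction N arbitrary: f)
  case 0
  then show ?case by (simp add: polyseq_0)
next
  case (Suc N)
  have "forward_diff (\<lambda>m. of_int m * f m) = (\<lambda>m. of_int m * forward_diff f m + f (m + 1))"
    by (simp add: forward_diff_def fun_eq_iff algebra_simps)
  moreover have "polyseq (Suc N) (\<lambda>m. of_int m * forward_diff f m)"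
    using Suc by (simp add: polyseq_Suc[of N f])
  ultimately show ?case
    using Suc.prems by (simp add: polyseq_Suc[of "Suc N"] polyseq_add polyseq_shift)
qed

lemma forward_diff_gbinomial:
  "forward_diff (\<lambda>m. of_int m gchoose Suc k) = (\<lambda>m. of_int m gchoose k)"
  by (rule ext) (simp add: forward_diff_def gbinomial_Suc_Suc)

lemma polyseq_gbinomial: "polyseq (Suc k) (\<lambda>m. of_int m gchoose k)"
proof (induction k)
  case 0
  show ?case by (simp add: polyseq_Suc polyseq_0 forward_diff_def)
next
  case (Suc k)
  then show ?case by (simp add: polyseq_Suc[of "Suc k"] forward_diff_gbinomial)
qed

lemma polyseq_1_constant:
  assumes "polyseq 1 f" shows "f m = f k"
proof -
  have step: "f (m + 1) = f m" for m
    using assms by (simp add: polyseq_Suc polyseq_0 forward_diff_def)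
  have "f m = f 0" for m
  proof (induction m rule: int_induct[where k = 0])
    case (step2 i)
    then show ?case using step[of "i - 1"] by simp
  qed (simp_all add: step)
  then show ?thesis by metis
qed

text \<open>
  A polynomial of degree less than \<open>N\<close> with \<open>N\<close> zeros is zero; consecutive zeros suffice here and
  make this an induction over differences.
\<close>

lemma polyseq_eq_zero:
  assumes "polyseq N f" "\<And>m. a \<le> m \<Longrightarrow> m < a + int N \<Longrightarrow> f m = 0"
  shows "f m = 0"
  using assms
proof (induction N arbitrary: f m)
  case (Suc N)
  have "forward_diff f m = 0" for m
    by (rule Suc.IH[OF Suc.prems(1)[unfolded polyseq_Suc]])
      (simp add: forward_diff_def Suc.prems(2))
  then have "polyseq 1 f" by (simp add: polyseq_Suc polyseq_0)
  then have "f m = f a" by (rule polyseq_1_constant)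
  then show ?case using Suc.prems(2)[of a] by simp
qed (simp add: polyseq_0)

lemma newton_expansion:
  assumes "polyseq N f"
  shows "f m = (\<Sum>k<N. (of_int m gchoose k) * (forward_diff ^^ k) f 0)"
  using assms
proof (induction N arbitrary: f m)
  case (Suc N)
  define g where "g m = (\<Sum>k<Suc N. (of_int m gchoose k) * (forward_diff ^^ k) f 0)" for m
  have g: "g m = f 0 + (\<Sum>k<N. (of_int m gchoose Suc k) * (forward_diff ^^ k) (forward_diff f) 0)" for m
    unfolding g_def sum.lessThan_Suc_shift
    by (simp add: funpow_Suc_right del: funpow.simps) 
  have "forward_diff g m = (\<Sum>k<N. (of_int m gchoose k) * (forward_diff ^^ k) (forward_diff f) 0)" for m
    unfolding forward_diff_def[of g] g
    by (simp add: gbinomial_Suc_Suc distrib_right flip: sum_subtractf)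
  then have "forward_diff g m = forward_diff f m" for m
    using Suc by (simp add: polyseq_Suc)
  then have "polyseq 1 (\<lambda>m. f m - g m)"
    by (simp add: polyseq_Suc polyseq_0 forward_diff_def algebra_simps)
  then have "f m - g m = f 0 - g 0" by (rule polyseq_1_constant)
  moreover have "g 0 = f 0" unfolding g by (simp add: gbinomial_0)
  ultimately show ?case by (simp add: g_def)
qed (simp add: polyseq_0)

lemma forward_diff_power_eq_zero:
  assumes "\<And>j. a \<le> j \<Longrightarrow> j \<le> a + int k \<Longrightarrow> f j = 0"
  shows "(forward_diff ^^ k) f a = 0"
  using assms
proof (induction k arbitrary: a)
  case (Suc k)
  have "(forward_diff ^^ k) f (a + 1) = 0" "(forward_diff ^^ k) f a = 0"
    by (rule Suc.IH, use Suc.prems in simp)+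
  then show ?case by (simp add: forward_diff_def[of "(forward_diff ^^ k) f"])
qed simp

section \<open>Combinations of derivatives of the delta distribution\<close>

text \<open>
  The two expansions of \<open>\<Omega>\<^bsub>z-w\<^esub>\<close> live in disjoint regions, \<open>m \<ge> 0 > n\<close> for the first and
  \<open>m < 0 \<le> n\<close> for the second.  In the difference of the expansions they appear with opposite signs.
\<close>

definition mixed_sign :: "int \<Rightarrow> int \<Rightarrow> complex" where
  "mixed_sign m n = (if m \<ge> 0 \<and> n \<ge> 0 then 0 else if m \<ge> 0 then 1 else - 1)"

text \<open>
  This is the shape on the line \<open>m + n = L\<close> of the difference \<open>d\<close> of the two expansions of one element of
  \<open>\<K>\<^bsub>z,w,z-w\<^esub>\<close> with poles \<open>\<Omega>\<^sup>k\<^bsub>z-w\<^esub>\<close>, \<open>k < N\<close>; \<open>d m n\<close> is the coefficient of \<open>e\<^sub>n(w) e\<^sub>m(z)\<close>.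
  Such a difference is a combination of derivatives of a delta distribution on the diagonal.

  Terms without \<open>\<Omega>\<^bsub>z-w\<^esub>\<close> cancel.  In degree one, \<open>w\<^sup>j \<Omega>\<^sup>k\<^bsub>z-w\<^esub>\<close> contributes the binomial polynomial
  \<open>m gchoose k\<close> in both mixed regions, so that a single \<open>f\<close> has to serve for both of them.  It lives on lines
  where that polynomial vanishes at all \<open>m \<ge> 0\<close> with \<open>n \<ge> 0\<close>, which is why \<open>f\<close> is also constrained there
  (\<open>mixed_sign\<close> is zero in that region).  In degree two, where \<open>m, n \<ge> 0\<close>, the products of
  \<open>\<Omega>\<^sub>w\<close> or \<open>\<Omega>\<^sub>z\<close> with \<open>\<Omega>\<^bsub>z-w\<^esub>\<close> give the polynomial \<open>g\<close>.
\<close>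

definition delta_witnesses ::
    "nat \<Rightarrow> int \<Rightarrow> (int \<Rightarrow> int \<Rightarrow> complex) \<Rightarrow> (int \<Rightarrow> complex) \<Rightarrow> (int \<Rightarrow> complex) \<Rightarrow> bool" where
  "delta_witnesses N L d f g \<longleftrightarrow> polyseq N f \<and> polyseq N g \<and>
     (\<forall>m n. m + n = L \<longrightarrow> m < 0 \<longrightarrow> n < 0 \<longrightarrow> d m n = 0) \<and>
     (\<forall>m n. m + n = L \<longrightarrow> m \<ge> 0 \<or> n \<ge> 0 \<longrightarrow> f m = mixed_sign m n * d m n) \<and>
     (\<forall>m n. m + n = L \<longrightarrow> m \<ge> 0 \<longrightarrow> n \<ge> 0 \<longrightarrow> g m = d m n)"

definition delta_like_at :: "nat \<Rightarrow> int \<Rightarrow> (int \<Rightarrow> int \<Rightarrow> complex) \<Rightarrow> bool" where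
  "delta_like_at N L d \<longleftrightarrow> (\<exists>f g. delta_witnesses N L d f g)"

definition delta_like :: "nat \<Rightarrow> (int \<Rightarrow> int \<Rightarrow> complex) \<Rightarrow> bool" where
  "delta_like N d \<longleftrightarrow> (\<forall>L. delta_like_at N L d)"

lemma delta_like_atI:
  assumes "\<And>m n. m + n = L \<Longrightarrow> m < 0 \<Longrightarrow> n < 0 \<Longrightarrow> d m n = 0"
    and "polyseq N f"
    and "\<And>m n. m + n = L \<Longrightarrow> m \<ge> 0 \<or> n \<ge> 0 \<Longrightarrow> f m = mixed_sign m n * d m n"
    and "polyseq N g"
    and "\<And>m n. m + n = L \<Longrightarrow> m \<ge> 0 \<Longrightarrow> n \<ge> 0 \<Longrightarrow> g m = d m n"
  shows "delta_like_at N L d"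
  unfolding delta_like_at_def delta_witnesses_def using assms by blast

lemma delta_witnessesD:
  assumes "delta_witnesses N L d f g"
  shows "m + n = L \<Longrightarrow> m < 0 \<Longrightarrow> n < 0 \<Longrightarrow> d m n = 0"
    and "polyseq N f"
    and "m + n = L \<Longrightarrow> m \<ge> 0 \<or> n \<ge> 0 \<Longrightarrow> f m = mixed_sign m n * d m n"
    and "polyseq N g"
    and "m + n = L \<Longrightarrow> m \<ge> 0 \<Longrightarrow> n \<ge> 0 \<Longrightarrow> g m = d m n"
  using assms unfolding delta_witnesses_def by blast+

lemma delta_like_at_zero:
  assumes "\<And>m n. m + n = L \<Longrightarrow> d m n = 0"
  shows "delta_like_at N L d"
  by (rule delta_like_atI[where f = "\<lambda>m. 0" and g = "\<lambda>m. 0"]) (simp_all add: assms)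

lemma delta_like_at_add:
  assumes "delta_like_at N L d" "delta_like_at N L e"
  shows "delta_like_at N L (\<lambda>m n. d m n + e m n)"
proof -
  obtain f g where "delta_witnesses N L d f g"
    using assms(1) unfolding delta_like_at_def by blast
  note d = delta_witnessesD[OF this]
  obtain f' g' where "delta_witnesses N L e f' g'"
    using assms(2) unfolding delta_like_at_def by blast
  note e = delta_witnessesD[OF this]
  show ?thesis
  proof (rule delta_like_atI)
    show "polyseq N (\<lambda>m. f m + f' m)" "polyseq N (\<lambda>m. g m + g' m)"
      by (intro polyseq_add d e)+
  next
    fix m n assume "m + n = L" "m \<ge> 0 \<or> n \<ge> 0"
    from d(3)[OF this] e(3)[OF this]
    show "f m + f' m = mixed_sign m n * (d m n + e m n)" by (simp only: distrib_left)
  next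
    fix m n assume "m + n = L" "m \<ge> 0" "n \<ge> 0"
    from d(5)[OF this] e(5)[OF this] show "g m + g' m = d m n + e m n" by (simp only:)
  next
    fix m n assume "m + n = L" "m < 0" "n < 0"
    from d(1)[OF this] e(1)[OF this] show "d m n + e m n = 0" by simp
  qed
qed

lemma delta_like_at_cmult:
  assumes "delta_like_at N L d"
  shows "delta_like_at N L (\<lambda>m n. c * d m n)"
proof -
  obtain f g where "delta_witnesses N L d f g"
    using assms(1) unfolding delta_like_at_def by blast
  note d = delta_witnessesD[OF this]
  show ?thesis
  proof (rule delta_like_atI)
    show "polyseq N (\<lambda>m. c * f m)" "polyseq N (\<lambda>m. c * g m)"
      by (intro polyseq_cmult d)+
  next
    fix m n assume "m + n = L" "m \<ge> 0 \<or> n \<ge> 0"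
    from d(3)[OF this]
    show "c * f m = mixed_sign m n * (c * d m n)" by (simp only: mult.left_commute)
  next
    fix m n assume "m + n = L" "m \<ge> 0" "n \<ge> 0"
    from d(5)[OF this] show "c * g m = c * d m n" by (simp only:)
  next
    fix m n assume "m + n = L" "m < 0" "n < 0"
    from d(1)[OF this] show "c * d m n = 0" by simp
  qed
qed

lemma delta_like_at_mono:
  assumes "delta_like_at N L d" "N \<le> M"
  shows "delta_like_at M L d"
  using assms polyseq_mono[OF _ assms(2)] unfolding delta_like_at_def delta_witnesses_def by blast

text \<open>
  The right hand side is \<open>z d\<close>: the coefficient of \<open>e\<^sub>m\<close> comes from \<open>e\<^bsub>m+1\<^esub>\<close>, except that \<open>z \<Omega>\<^sub>z\<^sup>0 = 0\<close> leaves
  nothing at \<open>m = -1\<close>.  This agrees with the shifted polynomial because \<open>f\<close> vanishes where both indices are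
  non-negative.
\<close>

lemma delta_like_at_z:
  assumes "delta_like_at N (L + 1) d"
  shows "delta_like_at N L (\<lambda>m n. if m = -1 then 0 else d (m + 1) n)"
proof -
  obtain f g where "delta_witnesses N (L + 1) d f g"
    using assms(1) unfolding delta_like_at_def by blast
  note d = delta_witnessesD[OF this]
  show ?thesis
  proof (rule delta_like_atI)
    show "polyseq N (\<lambda>m. f (m + 1))" "polyseq N (\<lambda>m. g (m + 1))"
      by (intro polyseq_shift d)+
  next
    fix m n :: int assume a: "m + n = L" "m \<ge> 0 \<or> n \<ge> 0"
    then have "f (m + 1) = mixed_sign (m + 1) n * d (m + 1) n" by (intro d(3)) auto
    then show "f (m + 1) = mixed_sign m n * (if m = -1 then 0 else d (m + 1) n)"
      using a(2) by (auto simp: mixed_sign_def)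
  next
    fix m n :: int assume "m + n = L" "m \<ge> 0" "n \<ge> 0"
    then show "g (m + 1) = (if m = -1 then 0 else d (m + 1) n)" using d(5)[of "m + 1" n] by simp
  next
    fix m n :: int assume "m + n = L" "m < 0" "n < 0"
    then show "(if m = -1 then 0 else d (m + 1) n) = 0" using d(1)[of "m + 1" n] by simp
  qed
qed

lemma delta_like_at_w:
  assumes "delta_like_at N (L + 1) d"
  shows "delta_like_at N L (\<lambda>m n. if n = -1 then 0 else d m (n + 1))"
proof -
  obtain f g where "delta_witnesses N (L + 1) d f g"
    using assms(1) unfolding delta_like_at_def by blast
  note d = delta_witnessesD[OF this]
  show ?thesis
  proof (rule delta_like_atI)
    show "polyseq N f" "polyseq N g" by fact+
  next
    fix m n :: int assume a: "m + n = L" "m \<ge> 0 \<or> n \<ge> 0"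
    then have "f m = mixed_sign m (n + 1) * d m (n + 1)" by (intro d(3)) auto
    then show "f m = mixed_sign m n * (if n = -1 then 0 else d m (n + 1))"
      using a(2) by (auto simp: mixed_sign_def)
  next
    fix m n :: int assume "m + n = L" "m \<ge> 0" "n \<ge> 0"
    then show "g m = (if n = -1 then 0 else d m (n + 1))" using d(5)[of m "n + 1"] by simp
  next
    fix m n :: int assume "m + n = L" "m < 0" "n < 0"
    then show "(if n = -1 then 0 else d m (n + 1)) = 0" using d(1)[of m "n + 1"] by simp
  qed
qed

section \<open>The difference of the two expansions\<close>

text \<open>
  The sign exchanges \<open>e\<^sub>m(z) e\<^sub>n(w)\<close>, the order in the second expansion, for \<open>e\<^sub>n(w) e\<^sub>m(z)\<close>.
\<close>

definition expansion_difference ::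
    "complex raviolo raviolo \<Rightarrow> complex raviolo raviolo \<Rightarrow> int \<Rightarrow> int \<Rightarrow> complex" where
  "expansion_difference x y m n = rcoeff (rcoeff x n) m -
     koszul (basis_degree m * basis_degree n) (rcoeff (rcoeff y m) n)"

lemma expansion_difference_add:
  "expansion_difference (x + x') (y + y') m n =
     expansion_difference x y m n + expansion_difference x' y' m n"
  by (simp add: expansion_difference_def koszul_def)

text \<open>
  The bound on \<open>m + n\<close> is a filtration that power series respect and that multiplication by \<open>z\<close> or \<open>w\<close>
  lowers.  On a given line only finitely many terms of a power series factor matter.
\<close>

definition weight_le :: "int \<Rightarrow> complex raviolo raviolo \<Rightarrow> bool" where
  "weight_le W x \<longleftrightarrow> (\<forall>m n. W < m + n \<longrightarrow> rcoeff (rcoeff x n) m = 0)"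

lemma rcoeff_Sum_any_eq_0:
  assumes "\<And>a. rcoeff (F a) m = 0"
  shows "rcoeff (Sum_any F) m = 0"
proof -
  have "rcoeff (sum F S) m = 0" for S
    by (induction S rule: infinite_finite_induct) (simp_all add: assms)
  then show ?thesis by (simp add: Sum_any.expand_set)
qed

lemma Sum_any_eq_0: "(\<And>a. F a = 0) \<Longrightarrow> Sum_any F = 0"
  by simp

text \<open>
  The summand \<open>2\<close> comes from \<open>e\<^sub>a e\<^sub>b = e\<^bsub>a+b+1\<^esub>\<close>, once for each variable.
\<close>

lemma weight_le_mult:
  assumes "weight_le W x" "weight_le W' y"
  shows "weight_le (W + W' + 2) (x * y)"
  unfolding weight_le_def
proof (intro allI impI)
  fix m n assume mn: "W + W' + 2 < m + n"
  show "rcoeff (rcoeff (x * y) n) m = 0"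
    unfolding rcoeff_mult[of x y] raviolo_mult_coeff_def
  proof (rule rcoeff_Sum_any_eq_0)
    fix a
    have "rcoeff (par_past (n - 1 - a) (rcoeff x a) * rcoeff y (n - 1 - a)) m = 0"
      unfolding rcoeff_mult raviolo_mult_coeff_def
    proof (rule Sum_any_eq_0)
      fix b
      have "rcoeff (rcoeff x a) b = 0 \<or> rcoeff (rcoeff y (n - 1 - a)) (m - 1 - b) = 0"
      proof (cases "W < b + a")
        case False
        then have "W' < (m - 1 - b) + (n - 1 - a)" using mn by simp
        then show ?thesis using assms(2) by (simp add: weight_le_def)
      qed (use assms(1) in \<open>simp add: weight_le_def\<close>)
      then show "(if basis_mult_nonzero b (m - 1 - b)
          then par_past (m - 1 - b) (rcoeff (par_past (n - 1 - a) (rcoeff x a)) b) *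
            rcoeff (rcoeff y (n - 1 - a)) (m - 1 - b) else 0) = 0"
        by (auto simp: par_past_def rcoeff_par par_complex_def)
    qed
    then show "rcoeff (if basis_mult_nonzero a (n - 1 - a)
        then par_past (n - 1 - a) (rcoeff x a) * rcoeff y (n - 1 - a) else 0) m = 0"
      by simp
  qed
qed

lemma weight_le_mono: "weight_le W x \<Longrightarrow> W \<le> W' \<Longrightarrow> weight_le W' x"
  by (auto simp: weight_le_def)

lemma weight_le_series: "weight_le (-2) (series_zw c)" "weight_le (-2) (series_wz c)"
  by (simp_all add: weight_le_def series_zw_def series_wz_def rcoeff_regular_series)

lemma weight_le_omega_diff: "weight_le (int k - 1) (omega_diff k)"
  by (auto simp: weight_le_def omega_diff_def rcoeff_regular_series rcoeff_basis_elt)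

lemma weight_le_minus: "weight_le W x \<Longrightarrow> weight_le W (- x)"
  by (simp add: weight_le_def)

lemma weight_le_letter:
  "\<exists>W. weight_le W (omega_expand_zw l) \<and> weight_le W (omega_expand_wz l)"
proof (cases l)
  case (Omega_z k)
  then show ?thesis by (intro exI[of _ "int k - 1"]) (auto simp: weight_le_def rcoeff_basis_elt rcoeff_one)
next
  case (Omega_w k)
  then show ?thesis by (intro exI[of _ "int k - 1"]) (auto simp: weight_le_def rcoeff_basis_elt rcoeff_one)
next
  case (Omega_zw k)
  then show ?thesis using weight_le_omega_diff[of k] weight_le_minus
    by (intro exI[of _ "int k - 1"]) (auto simp: uminus_power_if)
qed

lemma weight_le_word:
  "\<exists>W. weight_le W (prod_list (map omega_expand_zw u)) \<and> weight_le W (prod_list (map omega_expand_wz u))"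
proof (induction u)
  case Nil
  show ?case by (intro exI[of _ "-2"]) (auto simp: weight_le_def rcoeff_one)
next
  case (Cons l u)
  then show ?case using weight_le_letter[of l] weight_le_mult weight_le_mono
    by (auto) (metis (no_types) max.cobounded1 max.cobounded2)
qed

lemma basis_mult_nonzero_minus_1 [simp]: "basis_mult_nonzero (- 1) n"
  by (auto simp: basis_mult_nonzero_def)

lemma basis_mult_nonzero_minus_2: "basis_mult_nonzero (- 2) (n + 1) \<longleftrightarrow> n \<noteq> -1"
  "basis_mult_nonzero (- 2) (1 + n) \<longleftrightarrow> n \<noteq> -1" "\<not> basis_mult_nonzero (- 2) 0"
  by (auto simp: basis_mult_nonzero_def)

lemma par_past_basis_elt_negative:
  "k < 0 \<Longrightarrow> par_past n (basis_elt k (c::complex)) = basis_elt k c"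
  by (simp add: par_past_def par_basis_elt par_complex_def)

lemma par_past_complex [simp]: "par_past n (c::complex) = c"
  by (simp add: par_past_def par_complex_def)

lemma rcoeff_inner_z:
  "rcoeff (rcoeff (basis_elt (-1) (basis_elt (-2) 1) * (x::complex raviolo raviolo)) n) m =
     (if m = -1 then 0 else rcoeff (rcoeff x n) (m + 1))"
  by (simp add: rcoeff_basis_elt_mult par_past_basis_elt_negative basis_mult_nonzero_minus_2 add.commute[of _ 1])

lemma rcoeff_outer_z:
  "rcoeff (rcoeff (basis_elt (-2) 1 * (x::complex raviolo raviolo)) n) m =
     (if n = -1 then 0 else rcoeff (rcoeff x (n + 1)) m)"
  by (simp add: rcoeff_basis_elt_mult basis_mult_nonzero_minus_2 add.commute[of _ 1])

lemma expansion_difference_z: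
  "expansion_difference (series_zw scalar_z * x) (series_wz scalar_z * y) m n =
     (if m = -1 then 0 else expansion_difference x y (m + 1) n)"
  unfolding expansion_difference_def series_variables
  by (simp add: rcoeff_inner_z rcoeff_outer_z koszul_def basis_degree_def)

lemma expansion_difference_w:
  "expansion_difference (series_zw scalar_w * x) (series_wz scalar_w * y) m n =
     (if n = -1 then 0 else expansion_difference x y m (n + 1))"
  unfolding expansion_difference_def series_variables
  by (simp add: rcoeff_inner_z rcoeff_outer_z koszul_def basis_degree_def)

lemma series_constant:
  "series_zw (fps_const (fps_const k)) = basis_elt (-1) (basis_elt (-1) k)"
  "series_wz (fps_const (fps_const k)) = basis_elt (-1) (basis_elt (-1) k)"
  by (auto simp: series_zw_def series_wz_def basis_elt_eq_regular fun_eq_iff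
      intro!: arg_cong[where f = regular_series] raviolo_eqI simp: rcoeff_regular_series)

lemma expansion_difference_constant:
  "expansion_difference (series_zw (fps_const (fps_const k)) * x) (series_wz (fps_const (fps_const k)) * y) m n =
     k * expansion_difference x y m n"
  unfolding expansion_difference_def series_constant
  by (simp add: rcoeff_basis_elt_mult par_past_basis_elt_negative koszul_def right_diff_distrib)

lemma zw_series_decompose:
  obtains k c1 c2 where
    "c = fps_const (fps_const k) + scalar_z * c1 + scalar_w * c2"
proof
  have "c = fps_const (fps_nth c 0) + fps_X * fps_shift 1 c"
    by (rule fps_ext) (auto simp: fps_X_mult_nth)
  moreover have "fps_nth c 0 = fps_const (fps_nth (fps_nth c 0) 0) + fps_X * fps_shift 1 (fps_nth c 0)"
    by (rule fps_ext) (auto simp: fps_X_mult_nth)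
  ultimately show "c = fps_const (fps_const (fps_nth (fps_nth c 0) 0))
      + scalar_z * fps_const (fps_shift 1 (fps_nth c 0)) + scalar_w * fps_shift 1 c"
    unfolding scalar_z_def scalar_w_def fps_const_mult fps_const_add by (simp only: flip: fps_const_add)
qed

text \<open>
  A power series is \<open>c = a + z c\<^sub>1 + w c\<^sub>2\<close> with a constant \<open>a\<close>, and multiplication by \<open>z\<close> or \<open>w\<close>
  moves the line \<open>m + n = L + 1\<close> to \<open>m + n = L\<close>.  So the claim on a line follows from the claim for other
  power series on the next line, and above the weight bound there is nothing to show.
\<close>

lemma delta_like_series_mult:
  assumes xy: "delta_like N (expansion_difference x y)" and W: "weight_le W x" "weight_le W y"
  shows "delta_like N (expansion_difference (series_zw c * x) (series_wz c * y))"
proof -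
  have main: "delta_like_at N L (expansion_difference (series_zw c * x) (series_wz c * y))"
    if "W - L < int k" for L k
    using that
  proof (induction k arbitrary: L c)
    case 0
    have "weight_le W (series_zw c * x)" "weight_le W (series_wz c * y)"
      using weight_le_mult[OF weight_le_series(1) W(1)] weight_le_mult[OF weight_le_series(2) W(2)] by simp_all
    then show ?case
      using 0 by (intro delta_like_at_zero) (simp add: weight_le_def expansion_difference_def koszul_def)
  next
    case (Suc k)
    obtain a c1 c2 where c: "c = fps_const (fps_const a) + scalar_z * c1 + scalar_w * c2"
      by (rule zw_series_decompose)
    define s where "s c = expansion_difference (series_zw c * x) (series_wz c * y)" for c
    have "delta_like_at N (L + 1) (s c1)" "delta_like_at N (L + 1) (s c2)"
      using Suc unfolding s_def by simp_all
    moreover have "delta_like_at N L (expansion_difference x y)"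
      using xy by (simp add: delta_like_def)
    ultimately have "delta_like_at N L (\<lambda>m n. a * expansion_difference x y m n
        + (if m = -1 then 0 else s c1 (m + 1) n) + (if n = -1 then 0 else s c2 m (n + 1)))"
      by (intro delta_like_at_add delta_like_at_cmult delta_like_at_z delta_like_at_w)
    moreover have "s c = (\<lambda>m n. a * expansion_difference x y m n
        + (if m = -1 then 0 else s c1 (m + 1) n) + (if n = -1 then 0 else s c2 m (n + 1)))"
      unfolding s_def c series_add series_zw_mult series_wz_mult distrib_right mult.assoc
        expansion_difference_add expansion_difference_constant expansion_difference_z expansion_difference_w
      by (intro ext) (simp only: expansion_difference_add expansion_difference_constant expansion_difference_z expansion_difference_w)
    ultimately show ?case unfolding s_def by simp
  qed
  show ?thesis
    unfolding delta_like_def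
  proof
    fix L
    show "delta_like_at N L (expansion_difference (series_zw c * x) (series_wz c * y))"
      by (rule main[of L "nat (W - L + 1)"]) linarith
  qed
qed

lemma binomial_eq_gbinomial_int:
  "m = int (k + i) \<Longrightarrow> of_nat ((k + i) choose i) = (of_int m gchoose k :: complex)"
  using binomial_symmetric[of i "k + i"] by (simp add: binomial_gbinomial)

lemma gbinomial_int_eq_0: "0 \<le> m \<Longrightarrow> m < int k \<Longrightarrow> (of_int m gchoose k :: complex) = 0"
  using binomial_gbinomial[of "nat m" k, where 'a = complex] by (simp add: nat_less_iff binomial_eq_0)

lemma rcoeff_omega_diff:
  "rcoeff (rcoeff (omega_diff k) n) m =
     (if n < 0 \<and> m + n = int k - 1 then of_int m gchoose k else 0)"
proof (cases "n < 0 \<and> m + n = int k - 1")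
  case True
  then have "m = int (k + nat (- n - 1))" by simp
  then show ?thesis
    using True binomial_eq_gbinomial_int[of m k "nat (- n - 1)"]
    by (auto simp: omega_diff_def rcoeff_regular_series rcoeff_basis_elt)
qed (auto simp: omega_diff_def rcoeff_regular_series rcoeff_basis_elt)

lemma rcoeff_outer_omega_diff:
  "rcoeff (rcoeff (basis_elt (int b) 1 * omega_diff k) n) m =
     (if 0 \<le> n \<and> n \<le> int b \<and> m + n = int k + int b then of_int m gchoose k else 0)"
  by (auto simp: rcoeff_basis_elt_mult rcoeff_omega_diff basis_mult_nonzero_def)

lemma rcoeff_sign_mult: "rcoeff ((-1) ^ k * x) n = (-1) ^ k * rcoeff x n"
  by (simp add: uminus_power_if)

lemma delta_like_zero: "(\<And>m n. d m n = 0) \<Longrightarrow> delta_like N d"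
  by (simp add: delta_like_def delta_like_at_zero)

lemma delta_like_uminus: "delta_like N d \<Longrightarrow> delta_like N (\<lambda>m n. - d m n)"
  using delta_like_at_cmult[of N _ d "-1"] by (simp add: delta_like_def)

text \<open>
  The coefficients \<open>k + i choose i\<close> of the first expansion and \<open>(-1)\<^sup>k (k + i choose i)\<close> of the second one
  are values of the same polynomial \<open>m gchoose k\<close>, at \<open>m = k + i\<close> and, by negation of the upper index, at
  \<open>m = -i - 1\<close>.
\<close>

lemma delta_like_omega_diff:
  assumes "k < N"
  shows "delta_like N (expansion_difference (omega_diff k) ((-1) ^ k * omega_diff k))"
  unfolding delta_like_def
proof
  fix L
  let ?d = "expansion_difference (omega_diff k) ((-1) ^ k * omega_diff k)"
  have neg: "(-1) ^ k * (of_int n gchoose k) = (of_int m gchoose k :: complex)" if "m + n = int k - 1" for m n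
  proof -
    have "of_nat k - of_int m - 1 = (of_int n :: complex)"
      using arg_cong[where f = "of_int :: int \<Rightarrow> complex", of "int k - m - 1" n] that by simp
    then show ?thesis using gbinomial_negated_upper[of "of_int m :: complex" k] by simp
  qed
  have d: "?d m n = (if m + n = int k - 1 then (if n < 0 then of_int m gchoose k else 0)
      - koszul (basis_degree m * basis_degree n) (if m < 0 then of_int m gchoose k else 0) else 0)" for m n
    unfolding expansion_difference_def rcoeff_sign_mult
    using neg[of m n] by (auto simp: rcoeff_omega_diff koszul_def add.commute)
  show "delta_like_at N L ?d"
  proof (cases "L = int k - 1")
    case True
    show ?thesis
    proof (rule delta_like_atI[where f = "\<lambda>m. of_int m gchoose k" and g = "\<lambda>m. 0"])
      show "polyseq N (\<lambda>m. of_int m gchoose k)"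
        using polyseq_gbinomial polyseq_mono assms by (metis Suc_leI)
      fix m n :: int assume L: "m + n = L"
      show "of_int m gchoose k = mixed_sign m n * ?d m n" if "m \<ge> 0 \<or> n \<ge> 0"
        using L True that by (auto simp: d mixed_sign_def koszul_def basis_degree_def gbinomial_int_eq_0)
      show "m < 0 \<Longrightarrow> n < 0 \<Longrightarrow> ?d m n = 0"
        using L True by (simp add: d koszul_def basis_degree_def)
      show "m \<ge> 0 \<Longrightarrow> n \<ge> 0 \<Longrightarrow> 0 = ?d m n"
        using L True by (simp add: d koszul_def)
    qed simp
  next
    case False
    then show ?thesis by (intro delta_like_at_zero) (simp add: d)
  qed
qed

lemma delta_like_on_quadrant:
  assumes "\<And>m n. d m n = (if 0 \<le> m \<and> 0 \<le> n \<and> m + n = l then h m else 0)" "polyseq N h"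
  shows "delta_like N d"
  unfolding delta_like_def
proof
  fix L
  show "delta_like_at N L d"
  proof (cases "L = l")
    case True
    show ?thesis
      by (rule delta_like_atI[where f = "\<lambda>m. 0" and g = h])
        (use assms True in \<open>auto simp: mixed_sign_def\<close>)
  next
    case False
    then show ?thesis by (intro delta_like_at_zero) (simp add: assms)
  qed
qed

text \<open>
  Each of the products \<open>\<Omega>\<^sub>w \<Omega>\<^bsub>z-w\<^esub>\<close> and \<open>\<Omega>\<^sub>z \<Omega>\<^bsub>z-w\<^esub>\<close> survives in only one of the two expansions, because
  in the other one both factors are \<open>\<Omega>\<close>'s in the same variable.
\<close>

lemma delta_like_outer_omega_diff:
  assumes "k < N"
  shows "delta_like N (expansion_difference (basis_elt (int b) 1 * omega_diff k) 0)"
    "delta_like N (expansion_difference 0 (basis_elt (int b) 1 * ((-1) ^ k * omega_diff k)))"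
proof -
  have h: "polyseq N (\<lambda>m. of_int m gchoose k)"
    using polyseq_gbinomial polyseq_mono assms by (metis Suc_leI)
  show "delta_like N (expansion_difference (basis_elt (int b) 1 * omega_diff k) 0)"
  proof (rule delta_like_on_quadrant[where l = "int k + int b", OF _ h])
    fix m n :: int
    show "expansion_difference (basis_elt (int b) 1 * omega_diff k) 0 m n
       = (if 0 \<le> m \<and> 0 \<le> n \<and> m + n = int k + int b then of_int m gchoose k else 0)"
      by (auto simp: expansion_difference_def rcoeff_outer_omega_diff koszul_def gbinomial_int_eq_0)
  qed
  have h': "polyseq N (\<lambda>m. (-1) ^ k * (of_int (int k + int b - m) gchoose k))"
    using polyseq_cmult[OF polyseq_reflect[OF h]] .
  have e: "basis_elt (int b) 1 * ((-1) ^ k * omega_diff k) = (-1) ^ k * (basis_elt (int b) 1 * omega_diff k)"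
    by (simp add: uminus_power_if)
  show "delta_like N (expansion_difference 0 (basis_elt (int b) 1 * ((-1) ^ k * omega_diff k)))"
  proof (rule delta_like_on_quadrant[where l = "int k + int b", OF _ h'])
    fix m n :: int
    let ?Q = "0 \<le> m \<and> 0 \<le> n \<and> m + n = int k + int b"
    have "expansion_difference 0 (basis_elt (int b) 1 * ((-1) ^ k * omega_diff k)) m n
        = (if ?Q then (-1) ^ k * (of_int n gchoose k) else 0)"
      unfolding e
      by (auto simp: expansion_difference_def rcoeff_sign_mult rcoeff_outer_omega_diff koszul_def
          gbinomial_int_eq_0 basis_degree_def)
    moreover have "int k + int b - m = n" if ?Q using that by simp
    ultimately show "expansion_difference 0 (basis_elt (int b) 1 * ((-1) ^ k * omega_diff k)) m n
       = (if ?Q then (-1) ^ k * (of_int (int k + int b - m) gchoose k) else 0)"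
      by presburger
  qed
qed

text \<open>
  In either expansion the letters fall into two classes \<open>P\<close>, those expanding to \<open>\<Omega>\<close>'s of the inner and of the
  outer variable; two of three letters belong to the same class.
\<close>

lemma triple_product_zero:
  fixes g :: "'l \<Rightarrow> 'r::ring_1" and P :: "'l \<Rightarrow> bool"
  assumes anti: "\<And>k l. g k * g l + g l * g k = 0" and same: "\<And>k l. P k = P l \<Longrightarrow> g k * g l = 0"
  shows "g a * (g b * g c) = 0"
proof -
  consider "P a = P b" | "P b = P c" | "P a = P c" by blast
  then show ?thesis
  proof cases
    case 1
    then show ?thesis using same by (simp add: mult.assoc[symmetric])
  next
    case 3
    have "g b * g c = - (g c * g b)" using anti[of b c] by (simp add: eq_neg_iff_add_eq_0)
    then have "g a * (g b * g c) = - (g a * g c * g b)" by (simp add: mult.assoc)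
    then show ?thesis using same[OF 3] by simp
  qed (simp add: same)
qed

lemma omega_expand_same_zero:
  "(\<exists>m. k = Omega_w m) = (\<exists>m. l = Omega_w m) \<Longrightarrow> omega_expand_zw k * omega_expand_zw l = 0"
  "(\<exists>m. k = Omega_z m) = (\<exists>m. l = Omega_z m) \<Longrightarrow> omega_expand_wz k * omega_expand_wz l = 0"
  by (cases k; cases l; auto simp: omega_products uminus_power_if)+

lemma omega_triple_zero:
  "omega_expand_zw a * (omega_expand_zw b * omega_expand_zw c) = 0"
  "omega_expand_wz a * (omega_expand_wz b * omega_expand_wz c) = 0"
  by (rule triple_product_zero[where P = "\<lambda>k. \<exists>m. k = Omega_w m", OF expand_zw.g_anticommute omega_expand_same_zero(1)], assumption)
    (rule triple_product_zero[where P = "\<lambda>k. \<exists>m. k = Omega_z m", OF expand_wz.g_anticommute omega_expand_same_zero(2)], assumption)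

definition word_difference :: "omega list \<Rightarrow> int \<Rightarrow> int \<Rightarrow> complex" where
  "word_difference u = expansion_difference (prod_list (map omega_expand_zw u)) (prod_list (map omega_expand_wz u))"

lemma word_difference_swap: "word_difference [k, l] = (\<lambda>m n. - word_difference [l, k] m n)"
proof -
  have "omega_expand_zw k * omega_expand_zw l = - (omega_expand_zw l * omega_expand_zw k)"
    "omega_expand_wz k * omega_expand_wz l = - (omega_expand_wz l * omega_expand_wz k)"
    using expand_zw.g_anticommute[of k l] expand_wz.g_anticommute[of k l]
    by (simp_all add: eq_neg_iff_add_eq_0)
  then show ?thesis by (simp add: word_difference_def expansion_difference_def koszul_def fun_eq_iff)
qed

lemma inner_outer_mult:
  "basis_elt (-1) (basis_elt (int a) 1) * basis_elt (int b) 1 = - basis_elt (int b) (basis_elt (int a) (1::complex))"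
  by (rule raviolo_eqI)
    (auto simp: basis_elt_mult basis_mult_nonzero_def par_past_def par_basis_elt rcoeff_basis_elt par_complex_def)

lemma outer_inner_mult:
  "basis_elt (int a) 1 * basis_elt (-1) (basis_elt (int b) 1) = basis_elt (int a) (basis_elt (int b) (1::complex))"
  by (rule raviolo_eqI)
    (auto simp: basis_elt_mult basis_mult_nonzero_def par_past_def rcoeff_basis_elt)

lemma expansion_difference_zero: "expansion_difference 0 0 = (\<lambda>m n. 0)"
  by (simp add: expansion_difference_def koszul_def fun_eq_iff)

lemma word_difference_two:
  assumes "\<And>j. Omega_zw j \<in> {k, l} \<Longrightarrow> j < N"
  shows "delta_like N (word_difference [k, l])"
proof -
  have zw: "delta_like N (word_difference [Omega_z a, Omega_w b])" for a b
    by (rule delta_like_zero)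
      (auto simp: word_difference_def inner_outer_mult outer_inner_mult expansion_difference_def rcoeff_basis_elt koszul_def basis_degree_def)
  have wd: "delta_like N (word_difference [Omega_w b, Omega_zw j])" if "j < N" for b j
    using delta_like_outer_omega_diff(1)[OF that, of b]
    by (simp add: word_difference_def omega_diff_inner_mult uminus_power_if)
  have zd: "delta_like N (word_difference [Omega_z b, Omega_zw j])" if "j < N" for b j
    using delta_like_outer_omega_diff(2)[OF that, of b]
    by (simp add: word_difference_def omega_diff_inner_mult)
  have same: "delta_like N (word_difference [k, l])"
    if "(\<exists>m. k = Omega_w m) = (\<exists>m. l = Omega_w m)" "(\<exists>m. k = Omega_z m) = (\<exists>m. l = Omega_z m)"
    using omega_expand_same_zero(1)[OF that(1)] omega_expand_same_zero(2)[OF that(2)]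
    by (intro delta_like_zero) (simp add: word_difference_def expansion_difference_zero)
  have swap: "delta_like N (word_difference [k, l])" if "delta_like N (word_difference [l, k])"
    unfolding word_difference_swap[of k l] using that by (rule delta_like_uminus)
  show ?thesis
  proof (cases k)
    case k: (Omega_z a)
    show ?thesis by (cases l) (use k assms zw zd same in auto)
  next
    case k: (Omega_w a)
    show ?thesis by (cases l) (use k assms zw wd same swap in auto)
  next
    case k: (Omega_zw a)
    show ?thesis by (cases l) (use k assms zd wd same swap in auto)
  qed
qed

lemma word_difference_delta_like:
  assumes "\<And>k. Omega_zw k \<in> set u \<Longrightarrow> k < N"
  shows "delta_like N (word_difference u)"
proof -
  consider "u = []" | k where "u = [k]" | k l where "u = [k, l]" | a b c r where "u = a # b # c # r"
    by (metis list.exhaust)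
  then show ?thesis
  proof cases
    case 1
    then show ?thesis
      by (intro delta_like_zero) (auto simp: word_difference_def expansion_difference_def rcoeff_one koszul_def basis_degree_def)
  next
    case 2
    show ?thesis
    proof (cases k)
      case (Omega_zw j)
      then show ?thesis using 2 assms delta_like_omega_diff by (simp add: word_difference_def)
    qed (use 2 in \<open>auto intro!: delta_like_zero simp: word_difference_def expansion_difference_def rcoeff_basis_elt rcoeff_one koszul_def basis_degree_def\<close>)
  next
    case 3
    then show ?thesis using word_difference_two assms by simp
  next
    case 4
    have "prod_list (map omega_expand_zw u) = 0" "prod_list (map omega_expand_wz u) = 0"
      using omega_triple_zero[of a b c] by (simp_all add: 4 mult.assoc[symmetric])
    then show ?thesis by (intro delta_like_zero) (simp add: word_difference_def expansion_difference_zero)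
  qed
qed

lemma delta_like_add: "delta_like N d \<Longrightarrow> delta_like N e \<Longrightarrow> delta_like N (\<lambda>m n. d m n + e m n)"
  by (simp add: delta_like_def delta_like_at_add)

text \<open>
  Every element is a sum of words in the \<open>\<Omega>\<close>'s with power series coefficients, and words of length at least
  three expand to zero.
\<close>

theorem pole_order_zw_delta_like:
  assumes "pole_order_zw_less N F"
  shows "delta_like N (expansion_difference (expansion_zw F) (expansion_wz F))"
proof -
  obtain f where f: "abs_kzw f = F"
    "\<And>u k. u \<in> Poly_Mapping.keys f \<Longrightarrow> Omega_zw k \<in> set (letters u) \<Longrightarrow> k < N"
    using assms unfolding pole_order_zw_less_def by blast
  have "delta_like N (expansion_difference
      (\<Sum>u\<in>U. series_zw (Poly_Mapping.lookup f u) * prod_list (map omega_expand_zw (letters u)))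
      (\<Sum>u\<in>U. series_wz (Poly_Mapping.lookup f u) * prod_list (map omega_expand_wz (letters u))))"
    if "U \<subseteq> Poly_Mapping.keys f" for U
    using that
  proof (induction U rule: infinite_finite_induct)
    case (insert u U)
    obtain W where "weight_le W (prod_list (map omega_expand_zw (letters u)))"
      "weight_le W (prod_list (map omega_expand_wz (letters u)))"
      using weight_le_word by blast
    moreover have "delta_like N (word_difference (letters u))"
      using insert f(2) by (intro word_difference_delta_like) auto
    ultimately show ?case
      using insert delta_like_series_mult unfolding word_difference_def
      by (auto simp: expansion_difference_add[abs_def] intro!: delta_like_add)
  qed (simp_all add: expansion_difference_zero delta_like_zero)
  then show ?thesis
    unfolding f(1)[symmetric] expansion_zw.abs_eq expansion_wz.abs_eq free_eval_def by simp
qed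

section \<open>Elements with prescribed expansions\<close>

definition expands_to :: "nat \<Rightarrow> (int \<Rightarrow> int \<Rightarrow> complex) \<Rightarrow> (int \<Rightarrow> int \<Rightarrow> complex) \<Rightarrow> bool" where
  "expands_to N x y \<longleftrightarrow> (\<exists>F. pole_order_zw_less N F \<and>
     (\<forall>m n. rcoeff (rcoeff (expansion_zw F) n) m = x m n) \<and>
     (\<forall>m n. rcoeff (rcoeff (expansion_wz F) m) n = y m n))"

lemma expands_to_add:
  assumes "expands_to N x y" "expands_to N x' y'"
  shows "expands_to N (\<lambda>m n. x m n + x' m n) (\<lambda>m n. y m n + y' m n)"
proof -
  obtain f where f: "\<And>u k. u \<in> Poly_Mapping.keys f \<Longrightarrow> Omega_zw k \<in> set (letters u) \<Longrightarrow> k < N"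
    "\<And>m n. rcoeff (rcoeff (expansion_zw (abs_kzw f)) n) m = x m n"
    "\<And>m n. rcoeff (rcoeff (expansion_wz (abs_kzw f)) m) n = y m n"
    using assms(1) unfolding expands_to_def pole_order_zw_less_def by blast
  obtain g where g: "\<And>u k. u \<in> Poly_Mapping.keys g \<Longrightarrow> Omega_zw k \<in> set (letters u) \<Longrightarrow> k < N"
    "\<And>m n. rcoeff (rcoeff (expansion_zw (abs_kzw g)) n) m = x' m n"
    "\<And>m n. rcoeff (rcoeff (expansion_wz (abs_kzw g)) m) n = y' m n"
    using assms(2) unfolding expands_to_def pole_order_zw_less_def by blast
  have "\<forall>u\<in>Poly_Mapping.keys (f + g). \<forall>k. Omega_zw k \<in> set (letters u) \<longrightarrow> k < N"
    using keys_add[of f g] f(1) g(1) by blast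
  then have "pole_order_zw_less N (abs_kzw (f + g))"
    unfolding pole_order_zw_less_def by blast
  moreover have "expansion_zw (abs_kzw (f + g)) = expansion_zw (abs_kzw f) + expansion_zw (abs_kzw g)"
    "expansion_wz (abs_kzw (f + g)) = expansion_wz (abs_kzw f) + expansion_wz (abs_kzw g)"
    by (simp_all add: expansion_zw.abs_eq expansion_wz.abs_eq)
  ultimately show ?thesis
    unfolding expands_to_def using f g by (intro exI[of _ "abs_kzw (f + g)"]) simp
qed

lemma expands_to_single:
  assumes "\<And>k. Omega_zw k \<in> set u \<Longrightarrow> k < N"
    and "\<And>m n. rcoeff (rcoeff (series_zw c * prod_list (map omega_expand_zw u)) n) m = x m n"
    and "\<And>m n. rcoeff (rcoeff (series_wz c * prod_list (map omega_expand_wz u)) m) n = y m n"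
  shows "expands_to N x y"
proof -
  have "\<forall>v\<in>Poly_Mapping.keys (Poly_Mapping.single (Word u) c). \<forall>k. Omega_zw k \<in> set (letters v) \<longrightarrow> k < N"
    using assms(1) by (simp add: keys_single)
  then have "pole_order_zw_less N (abs_kzw (Poly_Mapping.single (Word u) c))"
    unfolding pole_order_zw_less_def by blast
  then show ?thesis
    unfolding expands_to_def using assms(2,3)
    by (intro exI[of _ "abs_kzw (Poly_Mapping.single (Word u) c)"])
      (simp add: expansion_zw.abs_eq expansion_wz.abs_eq expand_zw.ev_single expand_wz.ev_single)
qed

lemma series_zero: "series_zw 0 = 0" "series_wz 0 = 0"
  by (simp_all add: series_zw_def series_wz_def regular_series_zero)

lemma expands_to_zero: "expands_to N (\<lambda>m n. 0) (\<lambda>m n. 0)"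
  by (rule expands_to_single[where u = "[]" and c = 0]) (simp_all add: series_zero)

lemma expands_to_sum:
  "finite S \<Longrightarrow> (\<And>s. s \<in> S \<Longrightarrow> expands_to N (x s) (y s)) \<Longrightarrow>
    expands_to N (\<lambda>m n. \<Sum>s\<in>S. x s m n) (\<lambda>m n. \<Sum>s\<in>S. y s m n)"
  by (induction S rule: finite_induct) (simp_all add: expands_to_zero expands_to_add)

definition series_of_w :: "(nat \<Rightarrow> complex) \<Rightarrow> zw_series" where
  "series_of_w h = Abs_fps (\<lambda>j. fps_const (h j))"

lemma series_of_w:
  "series_zw (series_of_w h) = regular_series (\<lambda>j. basis_elt (-1) (h j))"
  "series_wz (series_of_w h) = basis_elt (-1) (regular_series h)"
  unfolding series_zw_def series_wz_def series_of_w_def basis_elt_eq_regular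
  by (auto simp: fun_eq_iff regular_series_zero[symmetric] intro!: arg_cong[where f = regular_series])

lemma series_of_z:
  "series_zw (fps_const (Abs_fps h)) = basis_elt (-1) (regular_series h)"
  "series_wz (fps_const (Abs_fps h)) = regular_series (\<lambda>i. basis_elt (-1) (h i))"
  unfolding series_zw_def series_wz_def basis_elt_eq_regular
  by (auto simp: fun_eq_iff regular_series_zero[symmetric] intro!: arg_cong[where f = regular_series])

lemma par_past_regular_series [simp]: "par_past n (regular_series (h :: nat \<Rightarrow> complex)) = regular_series h"
  by (simp add: par_past_def par_regular_series par_complex_def)

lemma expands_to_regular:
  "expands_to N (\<lambda>m n. if m < 0 \<and> n < 0 then h m n else 0) (\<lambda>m n. if m < 0 \<and> n < 0 then h m n else 0)"
  by (rule expands_to_single[where u = "[]" and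
        c = "Abs_fps (\<lambda>j. Abs_fps (\<lambda>i. h (- int i - 1) (- int j - 1)))"])
    (auto simp: series_zw_def series_wz_def rcoeff_regular_series)

lemma expands_to_omega_z:
  "expands_to N (\<lambda>m n. if m = int k \<and> n < 0 then h n else 0) (\<lambda>m n. if m = int k \<and> n < 0 then h n else 0)"
  by (rule expands_to_single[where u = "[Omega_z k]" and c = "series_of_w (\<lambda>j. h (- int j - 1))"])
    (auto simp: series_of_w rcoeff_mult_basis_elt basis_elt_mult rcoeff_regular_series rcoeff_basis_elt
      basis_mult_nonzero_def par_past_def par_regular_series par_complex_def)

lemma expands_to_omega_w:
  "expands_to N (\<lambda>m n. if n = int k \<and> m < 0 then h m else 0) (\<lambda>m n. if n = int k \<and> m < 0 then h m else 0)"
  by (rule expands_to_single[where u = "[Omega_w k]" and c = "fps_const (Abs_fps (\<lambda>j. h (- int j - 1)))"])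
    (auto simp: series_of_z rcoeff_mult_basis_elt basis_elt_mult rcoeff_regular_series rcoeff_basis_elt
      basis_mult_nonzero_def par_past_def par_regular_series par_complex_def)

text \<open>
  The element \<open>(\<Sum>\<^sub>j h(-j-1) w\<^sup>j) \<Omega>\<^sup>k\<^bsub>z-w\<^esub>\<close>.  Its coefficients are a function of \<open>m + n\<close> times \<open>m gchoose k\<close>,
  which are the terms of the Newton expansion of a polynomial on each line.
\<close>

lemma expands_to_omega_zw:
  assumes "k < N"
  shows "expands_to N
    (\<lambda>m n. if m \<ge> 0 \<and> n < 0 \<and> m + n < int k then h (m + n - int k) * (of_int m gchoose k) else 0)
    (\<lambda>m n. if m < 0 \<and> n \<ge> 0 \<and> m + n < int k then h (m + n - int k) * (of_int m gchoose k) else 0)"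
proof (rule expands_to_single[where u = "[Omega_zw k]" and c = "series_of_w (\<lambda>j. h (- int j - 1))"])
  fix m n :: int
  show "rcoeff (rcoeff (series_zw (series_of_w (\<lambda>j. h (- int j - 1))) * prod_list (map omega_expand_zw [Omega_zw k])) n) m
    = (if m \<ge> 0 \<and> n < 0 \<and> m + n < int k then h (m + n - int k) * (of_int m gchoose k) else 0)"
  proof (cases "n < 0")
    case False
    then show ?thesis by (simp add: series_of_w omega_diff_def regular_series_mult rcoeff_regular_series)
  next
    case True
    define j where "j = nat (- n - 1)"
    have n: "n = - int j - 1" using True by (simp add: j_def)
    have sum: "rcoeff (sum F S) m = (\<Sum>i\<in>S. rcoeff (F i) m)" for F :: "nat \<Rightarrow> complex raviolo" and S
      by (induction S rule: infinite_finite_induct) simp_all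
    have "rcoeff (rcoeff (series_zw (series_of_w (\<lambda>j. h (- int j - 1))) * prod_list (map omega_expand_zw [Omega_zw k])) n) m
      = (\<Sum>i=0..j. rcoeff (basis_elt (-1) (h (- int i - 1)) * basis_elt (int (k + (j - i))) (of_nat ((k + (j - i)) choose (j - i)))) m)"
      using True by (simp add: series_of_w omega_diff_def regular_series_mult rcoeff_regular_series j_def sum del: of_nat_add)
    also have "\<dots> = (\<Sum>i=0..j. if m = int (k + (j - i)) then h (- int i - 1) * of_nat ((k + (j - i)) choose (j - i)) else 0)"
      by (rule sum.cong) (auto simp: basis_elt_mult rcoeff_basis_elt)
    also have "\<dots> = (\<Sum>i=0..j. if i = nat (int k + int j - m) then
        (if m \<ge> int k \<and> m + n < int k then h (m + n - int k) * (of_int m gchoose k) else 0) else 0)"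
    proof (rule sum.cong[OF refl])
      fix i assume i: "i \<in> {0..j}"
      show "(if m = int (k + (j - i)) then h (- int i - 1) * of_nat ((k + (j - i)) choose (j - i)) else 0) =
        (if i = nat (int k + int j - m) then
        (if m \<ge> int k \<and> m + n < int k then h (m + n - int k) * (of_int m gchoose k) else 0) else 0)"
      proof (cases "m = int (k + (j - i))")
        case True
        then show ?thesis
          using i binomial_eq_gbinomial_int[OF True] by (auto simp: n of_nat_diff algebra_simps)
      next
        case False
        then show ?thesis using i by (auto simp: n of_nat_diff)
      qed
    qed
    also have "\<dots> = (if m \<ge> int k \<and> m + n < int k then h (m + n - int k) * (of_int m gchoose k) else 0)"
      by (auto simp: n)
    also have "\<dots> = (if m \<ge> 0 \<and> n < 0 \<and> m + n < int k then h (m + n - int k) * (of_int m gchoose k) else 0)"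
      using True gbinomial_int_eq_0[of m k] by auto
    finally show ?thesis .
  qed
next
  fix m n :: int
  have neg: "(-1) ^ k * (of_int n' gchoose k) = (of_int m gchoose k :: complex)" if "n' = int k - m - 1" for n'
    using gbinomial_negated_upper[of "of_int m :: complex" k] that by simp
  show "rcoeff (rcoeff (series_wz (series_of_w (\<lambda>j. h (- int j - 1))) * prod_list (map omega_expand_wz [Omega_zw k])) m) n
    = (if m < 0 \<and> n \<ge> 0 \<and> m + n < int k then h (m + n - int k) * (of_int m gchoose k) else 0)"
  proof (cases "m < 0")
    case False
    then show ?thesis
      by (simp add: series_of_w rcoeff_basis_elt_mult rcoeff_sign_mult omega_diff_def rcoeff_regular_series)
  next
    case True
    define i where "i = nat (- m - 1)"
    have m: "m = - int i - 1" using True by (simp add: i_def)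
    have c: "(-1) ^ k * of_nat ((k + i) choose i) = (of_int m gchoose k :: complex)"
      using neg[of "int (k + i)"] binomial_eq_gbinomial_int[OF refl, of k i] by (simp add: m)
    have "rcoeff (rcoeff (series_wz (series_of_w (\<lambda>j. h (- int j - 1))) * prod_list (map omega_expand_wz [Omega_zw k])) m) n
      = (-1) ^ k * rcoeff (regular_series (\<lambda>j. h (- int j - 1)) * basis_elt (int (k + i)) (of_nat ((k + i) choose i))) n"
      using True by (simp add: series_of_w rcoeff_basis_elt_mult rcoeff_sign_mult omega_diff_def rcoeff_regular_series i_def
          mult.left_commute uminus_power_if del: of_nat_add)
    also have "\<dots> = (if n \<ge> 0 \<and> m + n < int k then h (m + n - int k) * ((-1) ^ k * of_nat ((k + i) choose i)) else 0)"
      by (auto simp: rcoeff_mult_basis_elt rcoeff_regular_series basis_mult_nonzero_def m algebra_simps)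
    finally show ?thesis using True c by simp
  qed
qed (use assms in simp)

lemma expands_to_omega_w_omega_zw:
  assumes "k < N"
  shows "expands_to N
    (\<lambda>m n. if m \<ge> 0 \<and> n \<ge> 0 \<and> m + n = int k + int b then h * (of_int m gchoose k) else 0) (\<lambda>m n. 0)"
proof (rule expands_to_single[where u = "[Omega_w b, Omega_zw k]" and c = "fps_const (fps_const h)"])
  fix m n :: int
  show "rcoeff (rcoeff (series_zw (fps_const (fps_const h)) * prod_list (map omega_expand_zw [Omega_w b, Omega_zw k])) n) m
    = (if m \<ge> 0 \<and> n \<ge> 0 \<and> m + n = int k + int b then h * (of_int m gchoose k) else 0)"
    by (auto simp: series_constant rcoeff_basis_elt_mult[of "-1"] par_past_basis_elt_negative
        rcoeff_outer_omega_diff gbinomial_int_eq_0)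
  have "prod_list (map omega_expand_wz [Omega_w b, Omega_zw k]) = 0"
    by (simp add: omega_diff_inner_mult uminus_power_if)
  then show "rcoeff (rcoeff (series_wz (fps_const (fps_const h)) * prod_list (map omega_expand_wz [Omega_w b, Omega_zw k])) m) n = 0"
    by simp
qed (use assms in auto)

lemma expands_to_omega_z_omega_w:
  "expands_to N (\<lambda>m n. if m = int a \<and> n = int b then - h else 0) (\<lambda>m n. if m = int a \<and> n = int b then h else 0)"
  by (rule expands_to_single[where u = "[Omega_z a, Omega_w b]" and c = "fps_const (fps_const h)"])
    (auto simp: series_constant rcoeff_basis_elt_mult[of "-1"] par_past_basis_elt_negative
        inner_outer_mult outer_inner_mult rcoeff_basis_elt)

text \<open>
  The converse of \<open>pole_order_zw_delta_like\<close>.  The Newton coefficients of the polynomials \<open>f\<close> on all lines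
  assemble into the series multiplying \<open>\<Omega>\<^sup>k\<^bsub>z-w\<^esub>\<close>, and those of the polynomials \<open>g\<close> into the coefficients of
  \<open>\<Omega>\<^sub>w\<^sup>c \<Omega>\<^sup>k\<^bsub>z-w\<^esub>\<close>.  Once these terms account for the difference, what remains is the same in both
  expansions and consists of terms in \<open>z, w, \<Omega>\<^sub>z, \<Omega>\<^sub>w\<close>.  The bound \<open>K\<close> makes the sums over the \<open>\<Omega>\<close>'s
  finite.
\<close>

lemma delta_like_expands_to:
  fixes a b :: "int \<Rightarrow> int \<Rightarrow> complex"
  assumes delta: "delta_like N (\<lambda>m n. a m n - koszul (basis_degree m * basis_degree n) (b m n))"
    and a_w: "\<And>m n. m < 0 \<Longrightarrow> n \<ge> int K \<Longrightarrow> a m n = 0"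
    and b_z: "\<And>m n. n < 0 \<Longrightarrow> m \<ge> int K \<Longrightarrow> b m n = 0"
    and ab: "\<And>m n. m \<ge> 0 \<Longrightarrow> n \<ge> 0 \<Longrightarrow> m \<ge> int K \<or> n \<ge> int K \<Longrightarrow> a m n = 0 \<and> b m n = 0"
  shows "expands_to N a b"
proof -
  define d where "d m n = a m n - koszul (basis_degree m * basis_degree n) (b m n)" for m n
  have d: "d m n = (if m \<ge> 0 \<and> n \<ge> 0 then a m n + b m n else a m n - b m n)" for m n
    by (simp add: d_def koszul_def basis_degree_def)
  have dL: "delta_like_at N L d" for L
    using delta unfolding delta_like_def d_def[abs_def] by blast
  have neg: "a m n = b m n" if "m < 0" "n < 0" for m n
    using dL[of "m + n"] that unfolding delta_like_at_def delta_witnesses_def by (auto simp: d)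
  have "\<forall>L. \<exists>f. polyseq N f \<and> (\<forall>m n. m + n = L \<longrightarrow> m \<ge> 0 \<or> n \<ge> 0 \<longrightarrow> f m = mixed_sign m n * d m n)"
    using dL unfolding delta_like_at_def delta_witnesses_def by blast
  then obtain f where f: "\<And>L. polyseq N (f L)"
    "\<And>L m n. m + n = L \<Longrightarrow> m \<ge> 0 \<or> n \<ge> 0 \<Longrightarrow> f L m = mixed_sign m n * d m n"
    by metis
  have "\<forall>L. \<exists>g. polyseq N g \<and> (\<forall>m n. m + n = L \<longrightarrow> m \<ge> 0 \<longrightarrow> n \<ge> 0 \<longrightarrow> g m = d m n)"
    using dL unfolding delta_like_at_def delta_witnesses_def by blast
  then obtain g where g: "\<And>L. polyseq N (g L)"
    "\<And>L m n. m + n = L \<Longrightarrow> m \<ge> 0 \<Longrightarrow> n \<ge> 0 \<Longrightarrow> g L m = d m n"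
    by metis
  (* coefficients of (m gchoose k) on the line l + k, so that fk k l belongs to w^(-l-1) Omega_{z-w}^k *)
  define fk where "fk k l = (forward_diff ^^ k) (f (l + int k)) 0" for k l
  define gk where "gk k l = (forward_diff ^^ k) (g (l + int k)) 0" for k l
  have fk_0: "fk k l = 0" if "l \<ge> 0" for k l
    unfolding fk_def
  proof (rule forward_diff_power_eq_zero)
    fix j :: int assume "0 \<le> j" "j \<le> 0 + int k"
    then show "f (l + int k) j = 0"
      using f(2)[of j "l + int k - j" "l + int k"] that by (simp add: mixed_sign_def)
  qed
  have f_newton: "f (m + n) m = (\<Sum>k<N. if m + n < int k then fk k (m + n - int k) * (of_int m gchoose k) else 0)" for m n
    unfolding newton_expansion[OF f(1)[of "m + n"], of m]
  proof (rule sum.cong[OF refl])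
    fix k
    show "(of_int m gchoose k) * (forward_diff ^^ k) (f (m + n)) 0 =
      (if m + n < int k then fk k (m + n - int k) * (of_int m gchoose k) else 0)"
      using fk_0[of "m + n - int k" k] by (simp add: fk_def)
  qed
  have g_newton: "d m n = (\<Sum>k<N. \<Sum>c<2 * K. if m + n = int k + int c then gk k (int c) * (of_int m gchoose k) else 0)"
    if mn: "m \<ge> 0" "n \<ge> 0" for m n
  proof (cases "m + n < int (2 * K)")
    case True
    have "d m n = (\<Sum>k<N. (of_int m gchoose k) * (forward_diff ^^ k) (g (m + n)) 0)"
      using g(2)[OF refl mn] newton_expansion[OF g(1)[of "m + n"], of m] by simp
    also have "\<dots> = (\<Sum>k<N. \<Sum>c<2 * K. if m + n = int k + int c then gk k (int c) * (of_int m gchoose k) else 0)"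
    proof (rule sum.cong[OF refl])
      fix k
      define c0 where "c0 = nat (m + n - int k)"
      have "(\<Sum>c<2 * K. if m + n = int k + int c then gk k (int c) * (of_int m gchoose k) else 0) =
        (\<Sum>c<2 * K. if c = c0 then (if m + n \<ge> int k then gk k (int c0) * (of_int m gchoose k) else 0) else 0)"
        by (rule sum.cong) (auto simp: c0_def)
      also have "\<dots> = (if m + n \<ge> int k then gk k (int c0) * (of_int m gchoose k) else 0)"
        using True by (auto simp: c0_def)
      also have "\<dots> = (of_int m gchoose k) * (forward_diff ^^ k) (g (m + n)) 0"
      proof (cases "m + n \<ge> int k")
        case True
        then have "int c0 + int k = m + n" by (simp add: c0_def)
        then show ?thesis using True by (simp add: gk_def)
      next
        case False
        then show ?thesis using mn by (simp add: gbinomial_int_eq_0)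
      qed
      finally show "(of_int m gchoose k) * (forward_diff ^^ k) (g (m + n)) 0 =
        (\<Sum>c<2 * K. if m + n = int k + int c then gk k (int c) * (of_int m gchoose k) else 0)" ..
    qed
    finally show ?thesis .
  next
    case False
    have d0: "d m' n' = 0" if "m' \<ge> 0" "n' \<ge> 0" "m' + n' = m + n" for m' n'
    proof -
      have "m' \<ge> int K \<or> n' \<ge> int K" using that(3) False by linarith
      then show ?thesis using ab[OF that(1,2)] that by (simp add: d)
    qed
    have "gk k (int c) = 0" if "m + n = int k + int c" for k c
      unfolding gk_def
    proof (rule forward_diff_power_eq_zero)
      fix j :: int assume "0 \<le> j" "j \<le> 0 + int k"
      then show "g (int c + int k) j = 0"
        using g(2)[of j "m + n - j" "int c + int k"] d0[of j "m + n - j"] that by simp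
    qed
    then have "(\<Sum>k<N. \<Sum>c<2 * K. if m + n = int k + int c then gk k (int c) * (of_int m gchoose k) else 0) = 0"
      by (intro sum.neutral ballI) simp
    then show ?thesis using d0[OF mn refl] by simp
  qed
  (* the six kinds of terms, in the order 1, Omega_z, Omega_w, Omega_{z-w}, Omega_w Omega_{z-w},
     Omega_z Omega_w; X and Y stand for the two expansions where these differ *)
  let ?P1 = "\<lambda>m n. if m < 0 \<and> n < 0 then b m n else 0"
  let ?P2 = "\<lambda>m n. \<Sum>k<K. if m = int k \<and> n < 0 then b (int k) n else 0"
  let ?P3 = "\<lambda>m n. \<Sum>k<K. if n = int k \<and> m < 0 then a m (int k) else 0"
  let ?X4 = "\<lambda>m n. \<Sum>k<N. if m \<ge> 0 \<and> n < 0 \<and> m + n < int k then fk k (m + n - int k) * (of_int m gchoose k) else 0"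
  let ?Y4 = "\<lambda>m n. \<Sum>k<N. if m < 0 \<and> n \<ge> 0 \<and> m + n < int k then fk k (m + n - int k) * (of_int m gchoose k) else 0"
  let ?X5 = "\<lambda>m n. \<Sum>k<N. \<Sum>c<2 * K. if m \<ge> 0 \<and> n \<ge> 0 \<and> m + n = int k + int c then gk k (int c) * (of_int m gchoose k) else 0"
  let ?X6 = "\<lambda>m n. \<Sum>k<K. \<Sum>l<K. if m = int k \<and> n = int l then - b (int k) (int l) else 0"
  let ?Y6 = "\<lambda>m n. \<Sum>k<K. \<Sum>l<K. if m = int k \<and> n = int l then b (int k) (int l) else 0"
  have "expands_to N (\<lambda>m n. ?P1 m n + ?P2 m n + ?P3 m n + ?X4 m n + ?X5 m n + ?X6 m n)
    (\<lambda>m n. ?P1 m n + ?P2 m n + ?P3 m n + ?Y4 m n + (\<Sum>k<N. \<Sum>c<2 * K. 0) + ?Y6 m n)"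
    by (intro expands_to_add expands_to_sum expands_to_regular expands_to_omega_z expands_to_omega_w
        expands_to_omega_zw expands_to_omega_w_omega_zw expands_to_omega_z_omega_w) auto
  moreover have "?P1 m n + ?P2 m n + ?P3 m n + ?X4 m n + ?X5 m n + ?X6 m n = a m n \<and>
    ?P1 m n + ?P2 m n + ?P3 m n + ?Y4 m n + (\<Sum>k<N. \<Sum>c<2 * K. 0) + ?Y6 m n = b m n" for m n
  proof -
    have pick: "(\<Sum>k<K. if m = int k then h k else 0) = (if 0 \<le> m \<and> m < int K then h (nat m) else 0)"
      for m and h :: "nat \<Rightarrow> complex"
    proof -
      have "(\<Sum>k<K. if m = int k then h k else 0) = (\<Sum>k<K. if k = nat m then (if 0 \<le> m then h (nat m) else 0) else 0)"
        by (rule sum.cong) auto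
      then show ?thesis by auto
    qed
    consider "m < 0" "n < 0" | "m \<ge> 0" "n < 0" | "m < 0" "n \<ge> 0" | "m \<ge> 0" "n \<ge> 0" by linarith
    then show ?thesis
    proof cases
      case 1
      then show ?thesis using neg[of m n] by simp
    next
      case 2
      have f4: "?X4 m n = d m n" using f_newton[of m n] f(2)[OF refl, of m n] 2
        by (simp add: mixed_sign_def)
      have "?P2 m n = b m n" using 2 pick[of m "\<lambda>k. b (int k) n"] b_z[of n m] by auto
      then show ?thesis using 2 f4 by (simp add: d)
    next
      case 3
      have f4: "?Y4 m n = - d m n" using f_newton[of m n] f(2)[OF refl, of m n] 3
        by (simp add: mixed_sign_def)
      have "?P3 m n = a m n" using 3 pick[of n "\<lambda>k. a m (int k)"] a_w[of m n] by auto
      then show ?thesis using 3 f4 by (simp add: d)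
    next
      case 4
      have g5: "?X5 m n = d m n" using g_newton[OF 4] 4 by simp
      have "?Y6 m n = (\<Sum>k<K. if m = int k then (\<Sum>l<K. if n = int l then b (int k) (int l) else 0) else 0)"
        by (intro sum.cong refl) (auto intro!: sum.cong)
      also have "\<dots> = b m n"
        unfolding pick using 4 ab[OF 4] by auto
      finally have y6: "?Y6 m n = b m n" .
      have "?X6 m n = - ?Y6 m n"
        unfolding sum_negf[symmetric] by (intro sum.cong refl) auto
      then show ?thesis using 4 g5 y6 by (simp add: d)
    qed
  qed
  ultimately show ?thesis by simp
qed

section \<open>Locality in terms of commutators\<close>

text \<open>
  The coefficient of \<open>e\<^sub>n(w) e\<^sub>m(z)\<close> in \<open>A(z) B(w) - (-1)\<^bsup>p q\<^esup> B(w) A(z)\<close>, applied to \<open>v\<close>.  Up to a sign it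
  is the supercommutator of the modes \<open>A\<^sub>m\<close> and \<open>B\<^sub>n\<close>.
\<close>

definition field_commutator ::
    "int \<Rightarrow> 'v::ab_group_add modes \<Rightarrow> int \<Rightarrow> 'v modes \<Rightarrow> int \<Rightarrow> int \<Rightarrow> 'v \<Rightarrow> 'v" where
  "field_commutator p A q B m n v =
     koszul (p * basis_degree n) (A m (B n v)) -
     koszul (p * q + q * basis_degree m + basis_degree m * basis_degree n) (B n (A m v))"

abbreviation functional :: "(complex \<Rightarrow> 'v::ab_group_add \<Rightarrow> 'v) \<Rightarrow> ('v \<Rightarrow> complex) \<Rightarrow> bool" where
  "functional scale \<equiv> Vector_Spaces.linear scale (*)"

text \<open>
  Locality as a condition on the commutator alone.  It stays at the level of matrix coefficients, where
  the polynomials are complex valued; vectors are recovered with \<open>functional_separates\<close>.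
\<close>

definition local_upto ::
    "(complex \<Rightarrow> 'v::ab_group_add \<Rightarrow> 'v) \<Rightarrow> nat \<Rightarrow> int \<Rightarrow> 'v modes \<Rightarrow> int \<Rightarrow> 'v modes \<Rightarrow> bool" where
  "local_upto scale N p A q B \<longleftrightarrow>
     (\<forall>\<phi> v. functional scale \<phi> \<longrightarrow> delta_like N (\<lambda>m n. \<phi> (field_commutator p A q B m n v)))"

lemma koszul_koszul [simp]: "koszul k (koszul l x) = koszul (k + l) x"
  by (simp add: koszul_def)

lemma koszul_zero [simp]: "koszul k 0 = 0"
  by (simp add: koszul_def)

context
  fixes scale :: "complex \<Rightarrow> 'v::ab_group_add \<Rightarrow> 'v" and \<phi> :: "'v \<Rightarrow> complex"
  assumes \<phi>: "functional scale \<phi>"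
begin

interpretation Vector_Spaces.linear scale "(*)" \<phi> by (rule \<phi>)

lemmas functional_add = add and functional_diff = diff and functional_zero = zero
  and functional_neg = neg and functional_sum = sum and functional_scale = scale

lemma functional_koszul: "\<phi> (koszul k v) = koszul k (\<phi> v)"
  by (simp add: koszul_def neg)

end

theorem mutually_local_imp_local_upto:
  assumes "mutually_local scale p A q B"
  obtains N where "local_upto scale N p A q B"
proof -
  obtain N where N: "\<And>v \<phi>. functional scale \<phi> \<Longrightarrow>
       \<exists>F. pole_order_zw_less N F \<and>
         (\<forall>m n. rcoeff (rcoeff (expansion_zw F) n) m =
            koszul (p * basis_degree n) (\<phi> (A m (B n v)))) \<and>
         (\<forall>m n. rcoeff (rcoeff (expansion_wz F) m) n =
            koszul (p * q) (koszul (q * basis_degree m) (\<phi> (B n (A m v)))))"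
    using assms unfolding mutually_local_def by blast
  have "local_upto scale N p A q B"
    unfolding local_upto_def
  proof (intro allI impI)
    fix \<phi> v
    assume \<phi>: "functional scale \<phi>"
    obtain F where F: "pole_order_zw_less N F"
      "\<And>m n. rcoeff (rcoeff (expansion_zw F) n) m = koszul (p * basis_degree n) (\<phi> (A m (B n v)))"
      "\<And>m n. rcoeff (rcoeff (expansion_wz F) m) n =
        koszul (p * q) (koszul (q * basis_degree m) (\<phi> (B n (A m v))))"
      using N[OF \<phi>, of v] by blast
    have "expansion_difference (expansion_zw F) (expansion_wz F) =
        (\<lambda>m n. \<phi> (field_commutator p A q B m n v))"
      by (simp add: fun_eq_iff expansion_difference_def field_commutator_def F(2,3)
          functional_diff[OF \<phi>] functional_koszul[OF \<phi>] add.commute add.left_commute)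
    then show "delta_like N (\<lambda>m n. \<phi> (field_commutator p A q B m n v))"
      using pole_order_zw_delta_like[OF F(1)] by simp
  qed
  then show ?thesis by (rule that)
qed

lemma eventually_zero_bound:
  assumes "\<exists>M. \<forall>m\<ge>M. f m = (0::'a::zero)"
  obtains K :: nat where "\<And>m. m \<ge> int K \<Longrightarrow> f m = 0"
proof -
  obtain M where "\<forall>m\<ge>M. f m = 0" using assms by blast
  moreover have "M \<le> m" if "m \<ge> int (nat M)" for m using that by arith
  ultimately have "f m = 0" if "m \<ge> int (nat M)" for m using that by blast
  then show ?thesis by (rule that)
qed

text \<open>
  Only finitely many \<open>n \<ge> 0\<close> have \<open>B\<^sub>n v \<noteq> 0\<close>, so the bounds for \<open>A\<^sub>m (B\<^sub>n v)\<close> have a maximum over them.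
\<close>

lemma composition_bound:
  assumes A: "\<And>v. \<exists>M. \<forall>m\<ge>M. A m v = (0::'v::zero)" and B: "\<And>v. \<exists>M. \<forall>m\<ge>M. B m v = (0::'v)"
    and A0: "\<And>m. A m 0 = 0"
  obtains K :: nat where "\<And>m n. n \<ge> int K \<Longrightarrow> A m (B n v) = 0"
    "\<And>m n. n \<ge> 0 \<Longrightarrow> m \<ge> int K \<Longrightarrow> A m (B n v) = 0"
proof -
  obtain K where K: "\<And>n. n \<ge> int K \<Longrightarrow> B n v = 0" using eventually_zero_bound[OF B] by metis
  have "\<exists>L::nat. \<forall>m\<ge>int L. A m (B n v) = 0" for n
    using eventually_zero_bound[OF A] by metis
  then obtain L :: "int \<Rightarrow> nat" where L: "\<And>n m. m \<ge> int (L n) \<Longrightarrow> A m (B n v) = 0" by metis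
  define M where "M = K + (\<Sum>n\<in>{0..<int K}. L n)"
  show ?thesis
  proof (rule that[of M])
    fix m n :: int
    show "A m (B n v) = 0" if "n \<ge> int M"
    proof -
      have "K \<le> M" by (simp add: M_def)
      then have "int K \<le> n" using that by linarith
      then show ?thesis using K A0 by simp
    qed
    show "A m (B n v) = 0" if "n \<ge> 0" "m \<ge> int M"
    proof (cases "n \<ge> int K")
      case True
      then show ?thesis using K A0 by simp
    next
      case False
      then have "L n \<le> (\<Sum>n\<in>{0..<int K}. L n)" using that by (intro member_le_sum) auto
      then have "L n \<le> M" by (simp add: M_def)
      then show ?thesis using that by (intro L) linarith
    qed
  qed
qed

text \<open>
  The boundedness that is part of the target of the expansions is automatic for fields; only the
  commutator carries information.
\<close>

theorem local_upto_imp_mutually_local: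
  assumes local: "local_upto scale N p A q B"
    and A: "raviolo_field scale A" and B: "raviolo_field scale B"
  shows "mutually_local scale p A q B"
  unfolding mutually_local_def
proof (intro exI[of _ N] allI impI)
  fix v \<phi>
  assume \<phi>: "functional scale \<phi>"
  have zero: "A m 0 = 0" "B m 0 = 0" for m
    using A B module_hom.zero Vector_Spaces.linear.axioms(3) unfolding raviolo_field_def by metis+
  have bounded: "\<exists>M. \<forall>m\<ge>M. A m v = 0" "\<exists>M. \<forall>m\<ge>M. B m v = 0" for v
    using A B unfolding raviolo_field_def by blast+
  obtain K1 where K1: "\<And>m n. n \<ge> int K1 \<Longrightarrow> A m (B n v) = 0"
    "\<And>m n. n \<ge> 0 \<Longrightarrow> m \<ge> int K1 \<Longrightarrow> A m (B n v) = 0"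
    by (rule composition_bound[of A B v, OF bounded zero(1)]) (rule that)
  obtain K2 where K2: "\<And>n m. m \<ge> int K2 \<Longrightarrow> B n (A m v) = 0"
    "\<And>n m. m \<ge> 0 \<Longrightarrow> n \<ge> int K2 \<Longrightarrow> B n (A m v) = 0"
    by (rule composition_bound[of B A v, OF bounded(2,1) zero(2)]) (rule that)
  define a where "a m n = koszul (p * basis_degree n) (\<phi> (A m (B n v)))" for m n
  define b where "b m n = koszul (p * q) (koszul (q * basis_degree m) (\<phi> (B n (A m v))))" for m n
  have "expands_to N a b"
  proof (rule delta_like_expands_to[where K = "K1 + K2"])
    have "(\<lambda>m n. a m n - koszul (basis_degree m * basis_degree n) (b m n)) =
        (\<lambda>m n. \<phi> (field_commutator p A q B m n v))"
      by (simp add: fun_eq_iff field_commutator_def a_def b_def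
          functional_diff[OF \<phi>] functional_koszul[OF \<phi>] add.commute add.left_commute)
    then show "delta_like N (\<lambda>m n. a m n - koszul (basis_degree m * basis_degree n) (b m n))"
      using local \<phi> by (simp add: local_upto_def)
  qed (use K1 K2 in \<open>auto simp: a_def b_def functional_zero[OF \<phi>]\<close>)
  then show "\<exists>F. pole_order_zw_less N F \<and>
         (\<forall>m n. rcoeff (rcoeff (expansion_zw F) n) m = koszul (p * basis_degree n) (\<phi> (A m (B n v)))) \<and>
         (\<forall>m n. rcoeff (rcoeff (expansion_wz F) m) n =
            koszul (p * q) (koszul (q * basis_degree m) (\<phi> (B n (A m v)))))"
    by (simp only: expands_to_def a_def b_def)
qed

lemma functional_separates:
  fixes scale :: "complex \<Rightarrow> 'v::ab_group_add \<Rightarrow> 'v"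
  assumes "vector_space scale" and zero: "\<And>\<phi>. functional scale \<phi> \<Longrightarrow> \<phi> v = 0"
  shows "v = 0"
proof (rule ccontr)
  assume "v \<noteq> 0"
  interpret vector_space scale by fact
  interpret vs: vector_space "(*) :: complex \<Rightarrow> complex \<Rightarrow> complex"
    by standard (simp_all add: algebra_simps)
  interpret vector_space_pair scale "(*) :: complex \<Rightarrow> complex \<Rightarrow> complex" ..
  have "independent {v}" using \<open>v \<noteq> 0\<close> by simp
  from linear_independent_extend[OF this, of "\<lambda>_. 1"]
  obtain \<phi> where "functional scale \<phi>" "\<phi> v = 1" by auto
  then show False using zero by force
qed

section \<open>Symmetry, derivatives and linear combinations\<close>

lemma koszul_add: "koszul k (x + y) = koszul k x + koszul k y"
  by (simp add: koszul_def)

lemma koszul_diff: "koszul k (x - y) = koszul k x - koszul k y"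
  by (simp add: koszul_def)

lemma koszul_neg: "koszul k (- x) = - koszul k x"
  by (simp add: koszul_def)

lemma koszul_sum: "koszul k (sum f S) = (\<Sum>i\<in>S. koszul k (f i))"
  by (simp add: koszul_def sum_negf)

context
  fixes scale :: "complex \<Rightarrow> 'v::ab_group_add \<Rightarrow> 'v" and A :: "'v modes"
  assumes A: "raviolo_field scale A"
begin

lemma field_linear: "Vector_Spaces.linear scale scale (A m)"
  using A by (simp add: raviolo_field_def)

lemma field_bounded: "\<exists>M. \<forall>m\<ge>M. A m v = 0"
  using A by (simp add: raviolo_field_def)

lemma field_add: "A m (u + v) = A m u + A m v"
  and field_diff: "A m (u - v) = A m u - A m v"
  and field_neg: "A m (- u) = - A m u"
  and field_zero: "A m 0 = 0"
  and field_sum: "A m (sum f S) = (\<Sum>i\<in>S. A m (f i))"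
  and field_scale: "A m (scale c u) = scale c (A m u)"
  using field_linear[of m] module_hom.add module_hom.diff module_hom.neg module_hom.zero
    module_hom.sum module_hom.scale Vector_Spaces.linear.axioms(3) by metis+

lemma field_koszul: "A m (koszul k u) = koszul k (A m u)"
  by (simp add: koszul_def field_neg)

lemma functional_field:
  "functional scale \<phi> \<Longrightarrow> functional scale (\<lambda>u. \<phi> (A m u))"
  using Vector_Spaces.linear_compose[OF field_linear, of "(*)" \<phi>] by (simp add: o_def)

end

lemma common_mode_bound:
  assumes A: "raviolo_field scale A" and B: "raviolo_field scale B"
  obtains bd :: "'v::ab_group_add \<Rightarrow> nat" where "\<And>u j. j \<ge> int (bd u) \<Longrightarrow> A j u = 0 \<and> B j u = 0"
proof -
  have "\<exists>K::nat. \<forall>j\<ge>int K. A j u = 0 \<and> B j u = 0" for u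
  proof -
    obtain K1 K2 :: nat where "\<And>j. j \<ge> int K1 \<Longrightarrow> A j u = 0" "\<And>j. j \<ge> int K2 \<Longrightarrow> B j u = 0"
      using eventually_zero_bound[OF field_bounded[OF A]] eventually_zero_bound[OF field_bounded[OF B]] by metis
    then show ?thesis by (intro exI[of _ "K1 + K2"]) simp
  qed
  then show ?thesis using that by metis
qed

lemma local_upto_mono:
  assumes "local_upto scale N p A q B" "N \<le> M"
  shows "local_upto scale M p A q B"
  using assms delta_like_at_mono[OF _ assms(2)] unfolding local_upto_def delta_like_def by blast

lemma local_upto_common:
  assumes "local_upto scale N p A q B" "local_upto scale M p' A' q' B'"
  shows "local_upto scale (max N M) p A q B" "local_upto scale (max N M) p' A' q' B'"
  using assms local_upto_mono by (metis max.cobounded1 max.cobounded2)+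

text \<open>
  Exchanging the variables reflects the lines, \<open>m \<mapsto> L - m\<close>, and polynomials stay polynomials.  The sign in
  the degree two region comes from exchanging \<open>e\<^sub>n(w)\<close> and \<open>e\<^sub>m(z)\<close>.
\<close>

lemma delta_like_swap:
  assumes "delta_like N d"
  shows "delta_like N (\<lambda>m n. - koszul (c + basis_degree m * basis_degree n) (d n m))"
  unfolding delta_like_def
proof
  fix L
  have "delta_like_at N L d" using assms by (simp add: delta_like_def)
  then obtain f g where "delta_witnesses N L d f g"
    unfolding delta_like_at_def by blast
  note d = delta_witnessesD[OF this]
  show "delta_like_at N L (\<lambda>m n. - koszul (c + basis_degree m * basis_degree n) (d n m))"
  proof (rule delta_like_atI)
    show "polyseq N (\<lambda>m. koszul c (f (L - m)))" "polyseq N (\<lambda>m. koszul c (g (L - m)))"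
      by (intro polyseq_koszul polyseq_reflect d)+
  next
    fix m n :: int assume L: "m + n = L" and mn: "m \<ge> 0 \<or> n \<ge> 0"
    have "f n = mixed_sign n m * d n m" using L mn by (intro d(3)) auto
    moreover have "L - m = n" using L by simp
    ultimately show "koszul c (f (L - m)) = mixed_sign m n * - koszul (c + basis_degree m * basis_degree n) (d n m)"
      using mn by (cases "m \<ge> 0"; cases "n \<ge> 0") (simp_all add: mixed_sign_def koszul_def basis_degree_def)
  next
    fix m n :: int assume L: "m + n = L" and mn: "m \<ge> 0" "n \<ge> 0"
    have "g n = d n m" using L mn by (intro d(5)) auto
    moreover have "L - m = n" using L by simp
    ultimately show "koszul c (g (L - m)) = - koszul (c + basis_degree m * basis_degree n) (d n m)"
      using mn by (simp add: koszul_def basis_degree_def)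
  next
    fix m n :: int assume L: "m + n = L" and mn: "m < 0" "n < 0"
    have "d n m = 0" using L mn by (intro d(1)) auto
    then show "- koszul (c + basis_degree m * basis_degree n) (d n m) = 0" by simp
  qed
qed

lemma field_commutator_swap:
  "field_commutator q B p A m n v =
     - koszul (p * q + basis_degree m * basis_degree n) (field_commutator p A q B n m v)"
  by (simp add: field_commutator_def koszul_diff mult.commute add.commute add.left_commute)
    (simp add: koszul_def)

theorem local_upto_swap:
  assumes "local_upto scale N p A q B"
  shows "local_upto scale N q B p A"
  unfolding local_upto_def
proof (intro allI impI)
  fix \<phi> v
  assume \<phi>: "functional scale \<phi>"
  have "delta_like N (\<lambda>m n. \<phi> (field_commutator p A q B m n v))"
    using assms \<phi> by (simp add: local_upto_def)
  then have "delta_like N (\<lambda>m n. - koszul (p * q + basis_degree m * basis_degree n)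
      (\<phi> (field_commutator p A q B n m v)))"
    by (rule delta_like_swap)
  then show "delta_like N (\<lambda>m n. \<phi> (field_commutator q B p A m n v))"
    by (simp add: field_commutator_swap[of q B] functional_neg[OF \<phi>] functional_koszul[OF \<phi>])
qed

text \<open>
  The factor \<open>m\<close> raises the degree by one, and its zero at \<open>m = 0\<close> hides the change of region between
  \<open>m - 1 = -1\<close> and \<open>m = 0\<close>.
\<close>

lemma delta_like_deriv:
  assumes "delta_like N d"
  shows "delta_like (Suc N) (\<lambda>m n. - (of_int m * d (m - 1) n))"
  unfolding delta_like_def
proof
  fix L
  have "delta_like_at N (L - 1) d" using assms by (simp add: delta_like_def)
  then obtain f g where "delta_witnesses N (L - 1) d f g"
    unfolding delta_like_at_def by blast
  note d = delta_witnessesD[OF this]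
  show "delta_like_at (Suc N) L (\<lambda>m n. - (of_int m * d (m - 1) n))"
  proof (rule delta_like_atI)
    show "polyseq (Suc N) (\<lambda>m. - (of_int m * f (m - 1)))" "polyseq (Suc N) (\<lambda>m. - (of_int m * g (m - 1)))"
      using polyseq_uminus[OF polyseq_id_mult[OF polyseq_shift[OF d(2), of "-1"]]]
        polyseq_uminus[OF polyseq_id_mult[OF polyseq_shift[OF d(4), of "-1"]]] by simp_all
  next
    fix m n :: int assume L: "m + n = L" and mn: "m \<ge> 0 \<or> n \<ge> 0"
    show "- (of_int m * f (m - 1)) = mixed_sign m n * - (of_int m * d (m - 1) n)"
    proof (cases "m = 0")
      case False
      then have "f (m - 1) = mixed_sign (m - 1) n * d (m - 1) n" using L mn by (intro d(3)) auto
      then show ?thesis using mn False by (auto simp: mixed_sign_def)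
    qed simp
  next
    fix m n :: int assume L: "m + n = L" and mn: "m \<ge> 0" "n \<ge> 0"
    show "- (of_int m * g (m - 1)) = - (of_int m * d (m - 1) n)"
      using d(5)[of "m - 1" n] L mn by (cases "m = 0") auto
  next
    fix m n :: int assume L: "m + n = L" and mn: "m < 0" "n < 0"
    then show "- (of_int m * d (m - 1) n) = 0" using d(1)[of "m - 1" n] by simp
  qed
qed

lemma koszul_scale:
  assumes "vector_space scale"
  shows "koszul k (scale c v) = scale c (koszul k v)"
proof -
  interpret vector_space scale by fact
  show ?thesis by (simp add: koszul_def)
qed

theorem local_upto_field_deriv:
  assumes vs: "vector_space scale" and B: "raviolo_field scale B" and loc: "local_upto scale N p A q B"
  shows "local_upto scale (Suc N) p (field_deriv scale A) q B"
  unfolding local_upto_def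
proof (intro allI impI)
  interpret vector_space scale by fact
  fix \<phi> v
  assume \<phi>: "functional scale \<phi>"
  have "field_commutator p (field_deriv scale A) q B m n v =
      scale (- of_int m) (field_commutator p A q B (m - 1) n v)" for m n
  proof (cases "m = 0")
    case False
    then have "basis_degree (m - 1) = basis_degree m" by (simp add: basis_degree_def)
    then show ?thesis
      by (simp add: field_commutator_def field_deriv_def field_scale[OF B] field_neg[OF B]
          koszul_scale[OF vs] koszul_neg scale_right_diff_distrib)
  qed (simp add: field_commutator_def field_deriv_def field_zero[OF B])
  then have "\<phi> (field_commutator p (field_deriv scale A) q B m n v) =
      - (of_int m * \<phi> (field_commutator p A q B (m - 1) n v))" for m n
    by (simp only: functional_scale[OF \<phi>] mult_minus_left)
  then show "delta_like (Suc N) (\<lambda>m n. \<phi> (field_commutator p (field_deriv scale A) q B m n v))"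
    using loc \<phi> delta_like_deriv[of N "\<lambda>m n. \<phi> (field_commutator p A q B m n v)"]
    by (simp add: local_upto_def)
qed

lemma local_upto_id:
  assumes B: "raviolo_field scale B"
  shows "local_upto scale N 0 id_field q B"
proof -
  have "field_commutator 0 id_field q B m n v = 0" for m n v
    by (simp add: field_commutator_def id_field_def field_zero[OF B] basis_degree_def)
  then show ?thesis
    by (simp add: local_upto_def functional_zero delta_like_zero)
qed

lemma local_upto_add:
  assumes C: "raviolo_field scale C"
    and "local_upto scale N p A q C" "local_upto scale N p B q C"
  shows "local_upto scale N p (\<lambda>m v. A m v + B m v) q C"
  unfolding local_upto_def
proof (intro allI impI)
  fix \<phi> v
  assume \<phi>: "functional scale \<phi>"
  have "field_commutator p (\<lambda>m v. A m v + B m v) q C m n v =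
      field_commutator p A q C m n v + field_commutator p B q C m n v" for m n
    by (simp add: field_commutator_def field_add[OF C] koszul_add)
  then show "delta_like N (\<lambda>m n. \<phi> (field_commutator p (\<lambda>m v. A m v + B m v) q C m n v))"
    using assms(2,3) \<phi> by (simp add: local_upto_def functional_add[OF \<phi>] delta_like_add)
qed

lemma delta_like_cmult: "delta_like N d \<Longrightarrow> delta_like N (\<lambda>m n. c * d m n)"
  by (simp add: delta_like_def delta_like_at_cmult)

lemma local_upto_scale:
  assumes vs: "vector_space scale" and C: "raviolo_field scale C"
    and "local_upto scale N p A q C"
  shows "local_upto scale N p (\<lambda>m v. scale c (A m v)) q C"
  unfolding local_upto_def
proof (intro allI impI)
  interpret vector_space scale by fact
  fix \<phi> v
  assume \<phi>: "functional scale \<phi>"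
  have "field_commutator p (\<lambda>m v. scale c (A m v)) q C m n v =
      scale c (field_commutator p A q C m n v)" for m n
    by (simp add: field_commutator_def field_scale[OF C] koszul_scale[OF vs] scale_right_diff_distrib)
  then show "delta_like N (\<lambda>m n. \<phi> (field_commutator p (\<lambda>m v. scale c (A m v)) q C m n v))"
    using assms(3) \<phi> by (simp add: local_upto_def functional_scale[OF \<phi>] delta_like_cmult)
qed

lemma local_negative_modes_commute:
  assumes vs: "vector_space scale" and loc: "local_upto scale N p A q B" and mn: "m < 0" "n < 0"
  shows "A m (B n v) = koszul (p * q) (B n (A m v))"
proof -
  have "field_commutator p A q B m n v = 0"
  proof (rule functional_separates[OF vs])
    fix \<phi> :: "'a \<Rightarrow> complex" assume "functional scale \<phi>"
    then have "delta_like_at N (m + n) (\<lambda>m n. \<phi> (field_commutator p A q B m n v))"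
      using loc by (simp add: local_upto_def delta_like_def)
    then show "\<phi> (field_commutator p A q B m n v) = 0"
      using mn unfolding delta_like_at_def delta_witnesses_def by blast
  qed
  then show ?thesis using mn by (simp add: field_commutator_def basis_degree_def koszul_def)
qed

section \<open>Commutators and regular modes\<close>

text \<open>
  \<open>S i j n\<close> is the coefficient of \<open>e\<^sub>i(z) e\<^sub>j(x) \<Omega>\<^sub>w\<^sup>n\<close>.  On arrays that vanish for \<open>i \<ge> 0\<close> and for
  \<open>j \<ge> 0\<close>, the next two operators are multiplication by \<open>z - w\<close> and by \<open>x - w\<close>.
\<close>

definition times_z_minus_w :: "(int \<Rightarrow> int \<Rightarrow> nat \<Rightarrow> complex) \<Rightarrow> int \<Rightarrow> int \<Rightarrow> nat \<Rightarrow> complex" where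
  "times_z_minus_w S i j n = S (i + 1) j n - S i j (Suc n)"

definition times_x_minus_w :: "(int \<Rightarrow> int \<Rightarrow> nat \<Rightarrow> complex) \<Rightarrow> int \<Rightarrow> int \<Rightarrow> nat \<Rightarrow> complex" where
  "times_x_minus_w S i j n = S i (j + 1) n - S i j (Suc n)"

lemma times_x_z_minus_w_commute: "times_x_minus_w (times_z_minus_w S) = times_z_minus_w (times_x_minus_w S)"
  by (simp add: times_z_minus_w_def times_x_minus_w_def fun_eq_iff)

lemma times_minus_w_zero [simp]: "times_z_minus_w (\<lambda>i j n. 0) = (\<lambda>i j n. 0)"
  "times_x_minus_w (\<lambda>i j n. 0) = (\<lambda>i j n. 0)"
  by (simp_all add: times_z_minus_w_def times_x_minus_w_def fun_eq_iff)

lemma times_minus_w_funpow_commute: "(times_x_minus_w ^^ b) (times_z_minus_w S) = times_z_minus_w ((times_x_minus_w ^^ b) S)"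
  "(times_z_minus_w ^^ b) (times_x_minus_w S) = times_x_minus_w ((times_z_minus_w ^^ b) S)"
  by (induction b) (simp_all add: times_x_z_minus_w_commute)

text \<open>
  If \<open>(z - w) S = (x - w) S = 0\<close> then \<open>(z - x) S = 0\<close>, and \<open>S\<close>, being a family of power series in \<open>z\<close> and
  \<open>x\<close> by the third assumption, is zero because power series have no zero divisors.  Higher powers are
  reduced to this case by induction.
\<close>

lemma torsion_imp_zero:
  assumes "(times_z_minus_w ^^ a) S = (\<lambda>i j n. 0)" "(times_x_minus_w ^^ b) S = (\<lambda>i j n. 0)"
    and "\<And>i j n. i \<ge> 0 \<or> j \<ge> 0 \<Longrightarrow> S i j n = 0"
  shows "S = (\<lambda>i j n. 0)"
  using assms
proof (induction "a + b" arbitrary: a b S rule: less_induct)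
  case less
  show ?case
  proof (cases a)
    case 0
    then show ?thesis using less.prems(1) by simp
  next
    case a: (Suc a')
    show ?thesis
    proof (cases b)
      case 0
      then show ?thesis using less.prems(2) by simp
    next
      case b: (Suc b')
      have boundary: "times_z_minus_w S i j n = 0" "times_x_minus_w S i j n = 0" if "i \<ge> 0 \<or> j \<ge> 0" for i j n
        using that less.prems(3) by (auto simp: times_z_minus_w_def times_x_minus_w_def)
      have X: "times_z_minus_w S = (\<lambda>i j n. 0)"
      proof (rule less.hyps[of a' b])
        show "(times_z_minus_w ^^ a') (times_z_minus_w S) = (\<lambda>i j n. 0)"
          using less.prems(1) a by (simp add: funpow_Suc_right del: funpow.simps)
        show "(times_x_minus_w ^^ b) (times_z_minus_w S) = (\<lambda>i j n. 0)"
          using less.prems(2) by (simp add: times_minus_w_funpow_commute)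
      qed (use a boundary in auto)
      have Y: "times_x_minus_w S = (\<lambda>i j n. 0)"
      proof (rule less.hyps[of a b'])
        show "(times_x_minus_w ^^ b') (times_x_minus_w S) = (\<lambda>i j n. 0)"
          using less.prems(2) b by (simp add: funpow_Suc_right del: funpow.simps)
        show "(times_z_minus_w ^^ a) (times_x_minus_w S) = (\<lambda>i j n. 0)"
          using less.prems(1) by (simp add: times_minus_w_funpow_commute)
      qed (use b boundary in auto)
      have step: "S (i + 1) j n = S i (j + 1) n" for i j n
      proof -
        have "times_z_minus_w S i j n = 0" "times_x_minus_w S i j n = 0" using X Y by simp_all
        then show ?thesis by (simp add: times_z_minus_w_def times_x_minus_w_def)
      qed
      have "S i j n = S (i + int k) (j - int k) n" for i j n k
      proof (induction k)
        case (Suc k)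
        then show ?case using step[of "i + int k" "j - int (Suc k)" n] by (simp add: algebra_simps)
      qed simp
      from this[of _ _ _ "nat (- i)" for i] have "S i j n = 0" for i j n
        using less.prems(3)[of "i + int (nat (- i))" "j - int (nat (- i))" n] by (metis add.commute int_nat_eq
            le_add_same_cancel2 linorder_le_cases neg_0_le_iff_le uminus_add_conv_diff diff_self order_refl zero_le_imp_eq_int of_nat_0_le_iff add_increasing2)
      then show ?thesis by (simp add: fun_eq_iff)
    qed
  qed
qed

text \<open>
  Polynomial dependence on \<open>i\<close> along the lines \<open>i + n = L\<close> says that a power of \<open>z - w\<close> kills \<open>S\<close>; the
  same holds for \<open>j\<close> and \<open>x - w\<close>.
\<close>

lemma double_polyseq_imp_zero:
  assumes 1: "\<And>j L. \<exists>h. polyseq N h \<and> (\<forall>i n. i + int n = L \<longrightarrow> S i j n = h i)"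
    and 2: "\<And>i L. \<exists>h. polyseq N h \<and> (\<forall>j n. j + int n = L \<longrightarrow> S i j n = h j)"
    and 3: "\<And>i j n. i \<ge> 0 \<or> j \<ge> 0 \<Longrightarrow> S i j n = 0"
  shows "S i j n = 0"
proof -
  have "\<forall>j L. \<exists>h. polyseq N h \<and> (\<forall>i n. i + int n = L \<longrightarrow> S i j n = h i)"
    using 1 by blast
  then obtain h where h: "\<And>j L. polyseq N (h j L)" "\<And>j L i n. i + int n = L \<Longrightarrow> S i j n = h j L i"
    by metis
  have "\<forall>i L. \<exists>h. polyseq N h \<and> (\<forall>j n. j + int n = L \<longrightarrow> S i j n = h j)"
    using 2 by blast
  then obtain h' where h': "\<And>i L. polyseq N (h' i L)" "\<And>i L j n. j + int n = L \<Longrightarrow> S i j n = h' i L j"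
    by metis
  have "(times_z_minus_w ^^ k) S i j n = (forward_diff ^^ k) (h j (i + int n + int k)) i" for k i j n
  proof (induction k arbitrary: i n)
    case (Suc k)
    show ?case
      using Suc[of "i + 1" n] Suc[of i "Suc n"]
      by (simp add: times_z_minus_w_def[of "(times_z_minus_w ^^ k) S"] forward_diff_def[of "(forward_diff ^^ k) _"] algebra_simps)
  qed (simp add: h)
  then have X: "(times_z_minus_w ^^ N) S = (\<lambda>i j n. 0)"
    using h(1) by (simp add: polyseq_def fun_eq_iff)
  have "(times_x_minus_w ^^ k) S i j n = (forward_diff ^^ k) (h' i (j + int n + int k)) j" for k i j n
  proof (induction k arbitrary: j n)
    case (Suc k)
    show ?case
      using Suc[of "j + 1" n] Suc[of j "Suc n"]
      by (simp add: times_x_minus_w_def[of "(times_x_minus_w ^^ k) S"] forward_diff_def[of "(forward_diff ^^ k) _"] algebra_simps)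
  qed (simp add: h')
  then have Y: "(times_x_minus_w ^^ N) S = (\<lambda>i j n. 0)"
    using h'(1) by (simp add: polyseq_def fun_eq_iff)
  from torsion_imp_zero[OF X Y 3] show ?thesis by simp
qed

lemma local_uptoE:
  assumes "local_upto scale N p A q B"
  obtains f g where
    "\<And>\<phi> v L. functional scale \<phi> \<Longrightarrow> polyseq N (f \<phi> v L)"
    "\<And>\<phi> v L m n. functional scale \<phi> \<Longrightarrow> m + n = L \<Longrightarrow> m \<ge> 0 \<or> n \<ge> 0 \<Longrightarrow>
       f \<phi> v L m = mixed_sign m n * \<phi> (field_commutator p A q B m n v)"
    "\<And>\<phi> v L. functional scale \<phi> \<Longrightarrow> polyseq N (g \<phi> v L)"
    "\<And>\<phi> v L m n. functional scale \<phi> \<Longrightarrow> m + n = L \<Longrightarrow> m \<ge> 0 \<Longrightarrow> n \<ge> 0 \<Longrightarrow>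
       g \<phi> v L m = \<phi> (field_commutator p A q B m n v)"
proof -
  define P where "P \<phi> v L f \<longleftrightarrow> functional scale \<phi> \<longrightarrow> polyseq N f \<and>
      (\<forall>m n. m + n = L \<longrightarrow> m \<ge> 0 \<or> n \<ge> 0 \<longrightarrow> f m = mixed_sign m n * \<phi> (field_commutator p A q B m n v))"
    for \<phi> v L f
  define Q where "Q \<phi> v L g \<longleftrightarrow> functional scale \<phi> \<longrightarrow> polyseq N g \<and>
      (\<forall>m n. m + n = L \<longrightarrow> m \<ge> 0 \<longrightarrow> n \<ge> 0 \<longrightarrow> g m = \<phi> (field_commutator p A q B m n v))"
    for \<phi> v L g
  have ex: "(\<exists>f. P \<phi> v L f) \<and> (\<exists>g. Q \<phi> v L g)" for \<phi> v L
  proof (cases "functional scale \<phi>")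
    case True
    then have "delta_like_at N L (\<lambda>m n. \<phi> (field_commutator p A q B m n v))"
      using assms by (simp add: local_upto_def delta_like_def)
    then show ?thesis unfolding delta_like_at_def delta_witnesses_def P_def Q_def by blast
  qed (simp add: P_def Q_def)
  define f where "f \<phi> v L = (SOME f. P \<phi> v L f)" for \<phi> v L
  define g where "g \<phi> v L = (SOME g. Q \<phi> v L g)" for \<phi> v L
  have f: "P \<phi> v L (f \<phi> v L)" for \<phi> v L
    using ex[of \<phi> v L] someI_ex[of "P \<phi> v L"] unfolding f_def by blast
  have g: "Q \<phi> v L (g \<phi> v L)" for \<phi> v L
    using ex[of \<phi> v L] someI_ex[of "Q \<phi> v L"] unfolding g_def by blast
  show ?thesis
    by (rule that[of f g]) (use f[unfolded P_def] g[unfolded Q_def] in blast)+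
qed

lemma field_commutator_linear:
  assumes "raviolo_field scale A" "raviolo_field scale B"
  shows "field_commutator p A q B m n 0 = 0"
  by (simp add: field_commutator_def field_zero[OF assms(1)] field_zero[OF assms(2)])

lemma commutator_with_mode_polyseq:
  assumes loc: "local_upto scale N p A s C" and B: "raviolo_field scale B"
    and \<phi>: "functional scale \<phi>"
  obtains h where "polyseq N h"
    "\<And>i n. i + int n = L \<Longrightarrow> (if i \<ge> 0 then 0 else
       \<phi> (field_commutator p A s C i (int n) (B j v) - koszul k (B j (field_commutator p A s C i (int n) v)))) = h i"
proof -
  note \<phi>B = functional_field[OF B \<phi>, of j]
  obtain f g where fg: "\<And>\<phi> v L. functional scale \<phi> \<Longrightarrow> polyseq N (f \<phi> v L)"
    "\<And>\<phi> v L m n. functional scale \<phi> \<Longrightarrow> m + n = L \<Longrightarrow> m \<ge> 0 \<or> n \<ge> 0 \<Longrightarrow>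
       f \<phi> v L m = mixed_sign m n * \<phi> (field_commutator p A s C m n v)"
    "\<And>\<phi> v L. functional scale \<phi> \<Longrightarrow> polyseq N (g \<phi> v L)"
    by (rule local_uptoE[OF loc]) (rule that)
  let ?f1 = "f \<phi> (B j v) L" and ?f2 = "f (\<lambda>u. \<phi> (B j u)) v L"
  show ?thesis
  proof (rule that[of "\<lambda>i. koszul k (?f2 i) - ?f1 i"])
    show "polyseq N (\<lambda>i. koszul k (?f2 i) - ?f1 i)"
      by (intro polyseq_diff polyseq_koszul fg(1) \<phi> \<phi>B)
    fix i n assume "i + int n = L"
    then have "?f1 i = mixed_sign i (int n) * \<phi> (field_commutator p A s C i (int n) (B j v))"
      "?f2 i = mixed_sign i (int n) * \<phi> (B j (field_commutator p A s C i (int n) v))"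
      by (auto intro!: fg(2) \<phi> \<phi>B)
    then show "(if i \<ge> 0 then 0 else \<phi> (field_commutator p A s C i (int n) (B j v) -
        koszul k (B j (field_commutator p A s C i (int n) v)))) = koszul k (?f2 i) - ?f1 i"
      by (simp add: mixed_sign_def functional_diff[OF \<phi>] functional_koszul[OF \<phi>] koszul_neg)
  qed
qed

text \<open>
  By the Jacobi identity and since \<open>A\<^sub>i\<close> and \<open>B\<^sub>j\<close> supercommute, the double commutators
  \<open>[[A\<^sub>i, C\<^sub>n], B\<^sub>j]\<close> and \<open>[[B\<^sub>j, C\<^sub>n], A\<^sub>i]\<close> agree up to sign.  The first form shows that a power of
  \<open>z - w\<close> kills the array of double commutators, the second one that a power of \<open>x - w\<close> does.
\<close>

lemma commutator_negative_mode_commute: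
  assumes vs: "vector_space scale"
    and A: "raviolo_field scale A" and B: "raviolo_field scale B" and C: "raviolo_field scale C"
    and comm: "\<And>i j u. i < 0 \<Longrightarrow> j < 0 \<Longrightarrow> A i (B j u) = koszul (p * q) (B j (A i u))"
    and locA: "local_upto scale N p A s C" and locB: "local_upto scale N q B s C"
    and i: "i < 0" and j: "j < 0" and n: "n \<ge> 0"
  shows "field_commutator p A s C i n (B j v) = koszul (q * (p + s - 1)) (B j (field_commutator p A s C i n v))"
proof -
  let ?D = "\<lambda>i j n. field_commutator p A s C i n (B j v) - koszul (q * (p + s - 1)) (B j (field_commutator p A s C i n v))"
  let ?E = "\<lambda>i j n. field_commutator q B s C j n (A i v) - koszul (p * (q + s - 1)) (A i (field_commutator q B s C j n v))"
  have jacobi: "?D i j n = koszul (p * q + p * s + q * s) (?E i j n)" if "i < 0" "j < 0" "n \<ge> 0" for i j n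
    using that by (cases "even p"; cases "even q"; cases "even s")
      (simp_all add: field_commutator_def koszul_def basis_degree_def comm
        field_diff[OF A] field_diff[OF B] field_add[OF A] field_add[OF B] field_neg[OF A] field_neg[OF B] field_neg[OF C])
  have "?D i j n = 0"
  proof (rule functional_separates[OF vs])
    fix \<phi> :: "'a \<Rightarrow> complex" assume \<phi>: "functional scale \<phi>"
    (* extension by zero to i >= 0 or j >= 0 is compatible with the polynomials, which vanish there *)
    define S where "S i j n = (if i \<ge> 0 \<or> j \<ge> 0 then 0 else \<phi> (?D i j (int n)))" for i j :: int and n :: nat
    have "S i j (nat n) = 0"
    proof (rule double_polyseq_imp_zero[of N S])
      fix j L
      obtain h where h: "polyseq N h" "\<And>i n. i + int n = L \<Longrightarrow> (if i \<ge> 0 then 0 else \<phi> (?D i j (int n))) = h i"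
        by (rule commutator_with_mode_polyseq[OF locA B \<phi>]) (rule that)
      show "\<exists>h. polyseq N h \<and> (\<forall>i n. i + int n = L \<longrightarrow> S i j n = h i)"
      proof (cases "j \<ge> 0")
        case True
        then show ?thesis by (intro exI[of _ "\<lambda>m. 0"]) (simp add: S_def)
      next
        case False
        then show ?thesis using h by (intro exI[of _ h]) (auto simp: S_def split: if_splits)
      qed
    next
      fix i L
      obtain h where h: "polyseq N h" "\<And>j n. j + int n = L \<Longrightarrow> (if j \<ge> 0 then 0 else \<phi> (?E i j (int n))) = h j"
        by (rule commutator_with_mode_polyseq[OF locB A \<phi>]) (rule that)
      show "\<exists>h. polyseq N h \<and> (\<forall>j n. j + int n = L \<longrightarrow> S i j n = h j)"
      proof (cases "i \<ge> 0")
        case True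
        then show ?thesis by (intro exI[of _ "\<lambda>m. 0"]) (simp add: S_def)
      next
        case False
        have "S i j n = koszul (p * q + p * s + q * s) (h j)" if "j + int n = L" for j n
          using h(2)[OF that] False jacobi[of i j "int n"]
          by (auto simp: S_def functional_koszul[OF \<phi>] split: if_splits)
        then show ?thesis using h(1) polyseq_koszul by blast
      qed
    qed (simp add: S_def)
    then show "\<phi> (?D i j n) = 0" using i j n by (simp add: S_def)
  qed
  then show ?thesis by simp
qed

section \<open>Modes of normal-ordered products and Dong's lemma\<close>

lemma normal_ordered_negative:
  assumes A: "raviolo_field scale A" and B: "raviolo_field scale B" and "m < 0"
  shows "normal_ordered p A q B m v = (\<Sum>i\<in>{m..-1}. A i (B (m - 1 - i) v))"
proof -
  let ?t = "\<lambda>i. if basis_mult_nonzero i (m - 1 - i) then koszul ((p - basis_degree i) * basis_degree (m - 1 - i))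
     (field_plus A i (B (m - 1 - i) v)) else 0"
  have "field_mult p (field_plus A) B m v = sum ?t {m..-1}"
    unfolding field_mult_def
    by (rule Sum_any.expand_superset) (use assms(3) in \<open>auto simp: basis_mult_nonzero_def field_plus_def\<close>)
  also have "\<dots> = (\<Sum>i\<in>{m..-1}. A i (B (m - 1 - i) v))"
    by (rule sum.cong) (auto simp: basis_mult_nonzero_def field_plus_def basis_degree_def koszul_def)
  finally have 1: "field_mult p (field_plus A) B m v = \<dots>" .
  have 2: "field_mult q B (field_minus A) m v = 0"
    unfolding field_mult_def
    by (rule Sum_any_eq_0) (use assms(3) in \<open>auto simp: basis_mult_nonzero_def field_minus_def field_zero[OF B]\<close>)
  show ?thesis by (simp add: normal_ordered_def 1 2)
qed

text \<open>
  Any sufficiently large \<open>K\<close> is allowed, so that the products on several vectors can be written as sums over a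
  common range.
\<close>

lemma normal_ordered_nonnegative:
  assumes A: "raviolo_field scale A" and B: "raviolo_field scale B" and "m \<ge> 0"
    and K: "\<And>j. j \<ge> K \<Longrightarrow> A j v = 0" "\<And>j. j \<ge> K \<Longrightarrow> B j v = 0"
  shows "normal_ordered p A q B m v = (\<Sum>i\<in>{-K..-1}. koszul p (A i (B (m - 1 - i) v)) +
    koszul (p * q + q) (B i (A (m - 1 - i) v)))"
proof -
  let ?t = "\<lambda>i. if basis_mult_nonzero i (m - 1 - i) then koszul ((p - basis_degree i) * basis_degree (m - 1 - i))
     (field_plus A i (B (m - 1 - i) v)) else 0"
  have "field_mult p (field_plus A) B m v = sum ?t {-K..-1}"
    unfolding field_mult_def
  proof (rule Sum_any.expand_superset)
    show "{i. ?t i \<noteq> 0} \<subseteq> {-K..-1}"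
    proof safe
      fix i assume "?t i \<noteq> 0"
      then have "i < 0" "B (m - 1 - i) v \<noteq> 0" by (auto simp: field_plus_def field_zero[OF A] split: if_splits)
      then show "i \<in> {-K..-1}" using K(2)[of "m - 1 - i"] assms(3) by force
    qed
  qed simp
  also have "\<dots> = (\<Sum>i\<in>{-K..-1}. koszul p (A i (B (m - 1 - i) v)))"
    by (rule sum.cong) (use assms(3) in \<open>auto simp: basis_mult_nonzero_def field_plus_def basis_degree_def\<close>)
  finally have 1: "field_mult p (field_plus A) B m v = \<dots>" .
  let ?u = "\<lambda>i. if basis_mult_nonzero i (m - 1 - i) then koszul ((q - basis_degree i) * basis_degree (m - 1 - i))
     (B i (field_minus A (m - 1 - i) v)) else 0"
  have "field_mult q B (field_minus A) m v = sum ?u {-K..-1}"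
    unfolding field_mult_def
  proof (rule Sum_any.expand_superset)
    show "{i. ?u i \<noteq> 0} \<subseteq> {-K..-1}"
    proof safe
      fix i assume u: "?u i \<noteq> 0"
      then have "i < 0 \<or> m - 1 - i < 0" by (auto simp: basis_mult_nonzero_def split: if_splits)
      moreover have "m - 1 - i \<ge> 0" "A (m - 1 - i) v \<noteq> 0"
        using u by (auto simp: field_minus_def field_zero[OF B] split: if_splits)
      ultimately show "i \<in> {-K..-1}" using K(1)[of "m - 1 - i"] assms(3) by force
    qed
  qed simp
  also have "\<dots> = (\<Sum>i\<in>{-K..-1}. koszul q (B i (A (m - 1 - i) v)))"
    by (rule sum.cong) (use assms(3) in \<open>auto simp: basis_mult_nonzero_def field_minus_def basis_degree_def\<close>)
  finally have 2: "field_mult q B (field_minus A) m v = \<dots>" .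
  show ?thesis by (simp add: normal_ordered_def 1 2 koszul_sum sum.distrib)
qed

lemma sum_reflect_int:
  fixes h :: "int \<Rightarrow> 'a::comm_monoid_add"
  shows "(\<Sum>i\<in>{-K..-1}. h (m - 1 - i)) = (\<Sum>j\<in>{m..<m + K}. h j)"
  by (rule sum.reindex_bij_witness[of _ "\<lambda>j. m - 1 - j" "\<lambda>i. m - 1 - i"]) auto

lemma sum_reflect_int_negative:
  fixes h :: "int \<Rightarrow> 'a::comm_monoid_add"
  shows "(\<Sum>i\<in>{m..-1}. h (m - 1 - i)) = (\<Sum>j\<in>{m..-1}. h j)"
  by (rule sum.reindex_bij_witness[of _ "\<lambda>j. m - 1 - j" "\<lambda>i. m - 1 - i"]) auto

context
  fixes scale :: "complex \<Rightarrow> 'v::ab_group_add \<Rightarrow> 'v"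
    and p q s :: int and A B C :: "'v modes" and N :: nat
  assumes vs: "vector_space scale"
    and A: "raviolo_field scale A" and B: "raviolo_field scale B" and C: "raviolo_field scale C"
    and comm: "\<And>i j u. i < 0 \<Longrightarrow> j < 0 \<Longrightarrow> A i (B j u) = koszul (p * q) (B j (A i u))"
    and locA: "local_upto scale N p A s C" and locB: "local_upto scale N q B s C"
begin

abbreviation (input) comm_AC :: "int \<Rightarrow> int \<Rightarrow> 'v \<Rightarrow> 'v" where "comm_AC \<equiv> field_commutator p A s C"
abbreviation (input) comm_BC :: "int \<Rightarrow> int \<Rightarrow> 'v \<Rightarrow> 'v" where "comm_BC \<equiv> field_commutator q B s C"

lemma A_C: "i < 0 \<Longrightarrow> n < 0 \<Longrightarrow> A i (C n u) = koszul (p * s) (C n (A i u))"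
  by (rule local_negative_modes_commute[OF vs locA])

lemma B_C: "i < 0 \<Longrightarrow> n < 0 \<Longrightarrow> B i (C n u) = koszul (q * s) (C n (B i u))"
  by (rule local_negative_modes_commute[OF vs locB])

lemmas linear_rules = field_diff[OF A] field_diff[OF B] field_diff[OF C]
  field_add[OF A] field_add[OF B] field_add[OF C] field_neg[OF A] field_neg[OF B] field_neg[OF C]

text \<open>
  The next three lemmas are the Leibniz rule for the commutator of \<open>A\<^sub>i B\<^sub>j\<close> and \<open>B\<^sub>i A\<^sub>j\<close> with \<open>C\<^sub>n\<close>, one for each
  region of the indices.  A term in which two regular modes commute drops out.
\<close>

lemma term_pos_neg:
  assumes "i < 0" "j \<ge> 0" "n < 0" "m \<ge> 0"
  shows "koszul ((p + q) * basis_degree n) (koszul p (A i (B j (C n v)))) -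
      koszul ((p + q) * s + s * basis_degree m + basis_degree m * basis_degree n) (C n (koszul p (A i (B j v))))
    = koszul p (A i (comm_BC j n v))"
  and "koszul ((p + q) * basis_degree n) (koszul (p * q + q) (B i (A j (C n v)))) -
      koszul ((p + q) * s + s * basis_degree m + basis_degree m * basis_degree n) (C n (koszul (p * q + q) (B i (A j v))))
    = koszul (p * q + q) (B i (comm_AC j n v))"
  using assms by (cases "even p"; cases "even q"; cases "even s";
      simp add: field_commutator_def koszul_def basis_degree_def linear_rules A_C B_C)+

text \<open>
  Only in this region does the commutator \<open>[A\<^sub>i, C\<^sub>n]\<close> stand to the left of a regular mode that has to be moved
  past it.
\<close>

lemma term_neg_pos:
  assumes "i < 0" "j < 0" "n \<ge> 0" "m < 0"
  shows "koszul ((p + q) * basis_degree n) (A i (B j (C n v))) -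
      koszul ((p + q) * s + s * basis_degree m + basis_degree m * basis_degree n) (C n (A i (B j v)))
    = koszul p (A i (comm_BC j n v)) + koszul (p * q + q) (B j (comm_AC i n v))"
proof -
  have "koszul ((p + q) * basis_degree n) (A i (B j (C n v))) -
      koszul ((p + q) * s + s * basis_degree m + basis_degree m * basis_degree n) (C n (A i (B j v)))
    = koszul p (A i (comm_BC j n v)) + koszul (q * s) (comm_AC i n (B j v))"
    using assms by (cases "even p"; cases "even q"; cases "even s")
      (simp_all add: field_commutator_def koszul_def basis_degree_def linear_rules)
  also have "koszul (q * s) (comm_AC i n (B j v)) =
      koszul (p * q + q) (B j (comm_AC i n v))"
  proof -
    have "comm_AC i n (B j v) =
        koszul (q * (p + s - 1)) (B j (comm_AC i n v))"
      by (rule commutator_negative_mode_commute[OF vs A B C comm locA locB assms(1-3)])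
    then show ?thesis
      by (cases "even p"; cases "even q"; cases "even s") (simp_all add: koszul_def)
  qed
  finally show ?thesis .
qed

lemma term_pos_pos:
  assumes "i < 0" "j \<ge> 0" "n \<ge> 0" "m \<ge> 0"
  shows "koszul ((p + q) * basis_degree n) (koszul p (A i (B j (C n v)))) -
      koszul ((p + q) * s + s * basis_degree m + basis_degree m * basis_degree n) (C n (koszul p (A i (B j v))))
    = A i (comm_BC j n v) + koszul (q * s + s + p + 1) (comm_AC i n (B j v))"
  and "koszul ((p + q) * basis_degree n) (koszul (p * q + q) (B i (A j (C n v)))) -
      koszul ((p + q) * s + s * basis_degree m + basis_degree m * basis_degree n) (C n (koszul (p * q + q) (B i (A j v))))
    = koszul (p * q) (B i (comm_AC j n v)) +
      koszul (p * q + p * s + s + q + 1) (comm_BC i n (A j v))"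
  using assms by (cases "even p"; cases "even q"; cases "even s";
      simp add: field_commutator_def koszul_def basis_degree_def linear_rules)+

text \<open>
  By the Leibniz rule the commutator of \<open>:AB:\<close> with \<open>C\<close> is a sum of commutators of \<open>B\<close> and \<open>A\<close> with \<open>C\<close>,
  multiplied from the left by regular modes \<open>A\<^sub>i\<close>, \<open>B\<^sub>i\<close> or, in the degree two region, from the right by polar modes
  \<open>B\<^sub>j\<close>, \<open>A\<^sub>j\<close>.  A mode applied to the left changes the functional, a mode applied to the right changes the vector,
  and both only shift the argument of the polynomials.  So the witnesses for \<open>:AB:\<close> are sums of shifts of the
  witnesses for \<open>A\<close> and \<open>B\<close>, with the same bound \<open>N\<close> on the degree.  What has to be arranged is that the
  range of summation does not depend on the position \<open>m\<close> on the line.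
\<close>

lemma delta_like_at_normal_ordered:
  assumes \<phi>: "functional scale \<phi>"
  shows "delta_like_at N L (\<lambda>m n. \<phi> (field_commutator (p + q) (normal_ordered p A q B) s C m n v))"
proof -
  let ?W = "normal_ordered p A q B"
  note \<phi>A = functional_field[OF A \<phi>] and \<phi>B = functional_field[OF B \<phi>]
  obtain fA gA where fA: "\<And>\<phi> v L. functional scale \<phi> \<Longrightarrow> polyseq N (fA \<phi> v L)"
    "\<And>\<phi> v L m n. functional scale \<phi> \<Longrightarrow> m + n = L \<Longrightarrow> m \<ge> 0 \<or> n \<ge> 0 \<Longrightarrow>
       fA \<phi> v L m = mixed_sign m n * \<phi> (comm_AC m n v)"
    and gA: "\<And>\<phi> v L. functional scale \<phi> \<Longrightarrow> polyseq N (gA \<phi> v L)"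
    "\<And>\<phi> v L m n. functional scale \<phi> \<Longrightarrow> m + n = L \<Longrightarrow> m \<ge> 0 \<Longrightarrow> n \<ge> 0 \<Longrightarrow>
       gA \<phi> v L m = \<phi> (comm_AC m n v)"
    by (rule local_uptoE[OF locA]) (rule that)
  obtain fB gB where fB: "\<And>\<phi> v L. functional scale \<phi> \<Longrightarrow> polyseq N (fB \<phi> v L)"
    "\<And>\<phi> v L m n. functional scale \<phi> \<Longrightarrow> m + n = L \<Longrightarrow> m \<ge> 0 \<or> n \<ge> 0 \<Longrightarrow>
       fB \<phi> v L m = mixed_sign m n * \<phi> (comm_BC m n v)"
    and gB: "\<And>\<phi> v L. functional scale \<phi> \<Longrightarrow> polyseq N (gB \<phi> v L)"
    "\<And>\<phi> v L m n. functional scale \<phi> \<Longrightarrow> m + n = L \<Longrightarrow> m \<ge> 0 \<Longrightarrow> n \<ge> 0 \<Longrightarrow>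
       gB \<phi> v L m = \<phi> (comm_BC m n v)"
    by (rule local_uptoE[OF locB]) (rule that)
  (* on the line l >= N the polynomial has l + 1 > N zeros, at 0, ..., l *)
  have f_large: "fA \<psi> u l m = 0" "fB \<psi> u l m = 0"
    if "functional scale \<psi>" "l \<ge> int N" for \<psi> u l m
  proof -
    have "fA \<psi> u l k = 0" "fB \<psi> u l k = 0" if "0 \<le> k" "k < 0 + int N" for k
      using fA(2)[OF \<open>functional scale \<psi>\<close>, of k "l - k" l u]
        fB(2)[OF \<open>functional scale \<psi>\<close>, of k "l - k" l u] that \<open>l \<ge> int N\<close>
      by (simp_all add: mixed_sign_def)
    then show "fA \<psi> u l m = 0" "fB \<psi> u l m = 0"
      using polyseq_eq_zero fA(1) fB(1) that(1) by metis+
  qed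
  obtain bd :: "'v \<Rightarrow> nat" where bd: "\<And>u j. j \<ge> int (bd u) \<Longrightarrow> A j u = 0 \<and> B j u = 0"
    by (rule common_mode_bound[OF A B]) (rule that)
  define f where "f K m = (\<Sum>i\<in>{-K..-1}. koszul p (fB (\<lambda>u. \<phi> (A i u)) v (L - 1 - i) (m - 1 - i)) +
    koszul (p * q + q) (fA (\<lambda>u. \<phi> (B i u)) v (L - 1 - i) (m - 1 - i)))" for K :: int and m
  (* below -K0 the terms lie on lines beyond N and vanish; this range works for all m at once *)
  define K0 where "K0 = max 0 (int N - L)"
  have f_K: "f K m = f K0 m" if "K \<ge> K0" for K m
    unfolding f_def
  proof (rule sum.mono_neutral_right)
    show "\<forall>i\<in>{- K..- 1} - {- K0..- 1}. koszul p (fB (\<lambda>u. \<phi> (A i u)) v (L - 1 - i) (m - 1 - i)) +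
        koszul (p * q + q) (fA (\<lambda>u. \<phi> (B i u)) v (L - 1 - i) (m - 1 - i)) = 0"
      by (auto simp: K0_def f_large \<phi>A \<phi>B)
  qed (use that in auto)
  have f_poly: "polyseq N (f K0)"
    unfolding f_def diff_diff_eq diff_conv_add_uminus
    by (intro polyseq_sum polyseq_add polyseq_koszul polyseq_shift fA(1) fB(1) \<phi>A \<phi>B)
  show ?thesis
  proof (rule delta_like_atI[OF _ f_poly])
    fix m n :: int assume L: "m + n = L" and mn: "m < 0" "n < 0"
    have "?W m (C n v) = koszul ((p + q) * s) (C n (?W m v))"
      unfolding normal_ordered_negative[OF A B mn(1)] field_sum[OF C] koszul_sum
    proof (rule sum.cong[OF refl], goal_cases)
      case (1 i)
      then show ?case
        using mn by (simp add: A_C B_C field_koszul[OF A] distrib_right add.commute)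
    qed
    then show "\<phi> (field_commutator (p + q) ?W s C m n v) = 0"
      using mn by (simp add: field_commutator_def basis_degree_def functional_zero[OF \<phi>] koszul_def field_neg[OF C])
  next
    fix m n :: int assume L: "m + n = L" and mn: "m \<ge> 0 \<or> n \<ge> 0"
    have Li: "m - 1 - i + n = L - 1 - i" for i using L by simp
    have nonneg_zero: "fA \<psi> u (L - 1 - i) (m - 1 - i) = 0" "fB \<psi> u (L - 1 - i) (m - 1 - i) = 0"
      if "functional scale \<psi>" "m - 1 - i \<ge> 0" "n \<ge> 0" for \<psi> u i
      using fA(2)[OF that(1) Li, of i u] fB(2)[OF that(1) Li, of i u] that by (simp_all add: mixed_sign_def)
    consider "m \<ge> 0" "n \<ge> 0" | "m \<ge> 0" "n < 0" | "m < 0" "n \<ge> 0" using mn by linarith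
    then show "f K0 m = mixed_sign m n * \<phi> (field_commutator (p + q) ?W s C m n v)"
    proof cases
      case 1
      have "f K0 m = 0"
        unfolding f_def by (rule sum.neutral) (use 1 in \<open>auto simp: nonneg_zero \<phi>A \<phi>B\<close>)
      then show ?thesis using 1 by (simp add: mixed_sign_def)
    next
      case 2
      define K where "K = K0 + int (bd v) + int (bd (C n v))"
      have K0: "K0 \<ge> 0" by (simp add: K0_def)
      have W: "?W m u = (\<Sum>i\<in>{-K..-1}. koszul p (A i (B (m - 1 - i) u)) +
          koszul (p * q + q) (B i (A (m - 1 - i) u)))" if "u = v \<or> u = C n v" for u
        by (rule normal_ordered_nonnegative[OF A B 2(1)]) (use that bd K0 in \<open>auto simp: K_def\<close>)
      have "field_commutator (p + q) ?W s C m n v = (\<Sum>i\<in>{-K..-1}.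
          koszul p (A i (comm_BC (m - 1 - i) n v)) +
          koszul (p * q + q) (B i (comm_AC (m - 1 - i) n v)))"
        unfolding field_commutator_def[of "p + q" ?W] W[OF disjI1[OF refl]] W[OF disjI2[OF refl]]
          field_sum[OF C] koszul_sum sum_subtractf[symmetric]
      proof (rule sum.cong[OF refl], goal_cases)
        case (1 i)
        then have i: "i < 0" "m - 1 - i \<ge> 0" using 2 by auto
        show ?case
          unfolding term_pos_neg[OF i 2(2,1), symmetric] field_add[OF C] koszul_add by simp
      qed
      then have "\<phi> (field_commutator (p + q) ?W s C m n v) = (\<Sum>i\<in>{-K..-1}.
          koszul p (\<phi> (A i (comm_BC (m - 1 - i) n v))) +
          koszul (p * q + q) (\<phi> (B i (comm_AC (m - 1 - i) n v))))"
        by (simp only: functional_sum[OF \<phi>] functional_add[OF \<phi>] functional_koszul[OF \<phi>])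
      also have "\<dots> = f K m"
        unfolding f_def
      proof (rule sum.cong[OF refl], goal_cases)
        case (1 i)
        then have "m - 1 - i \<ge> 0" using 2 by auto
        then show ?case
          using fB(2)[OF \<phi>A Li, of i i v] fA(2)[OF \<phi>B Li, of i i v] 2 by (simp add: mixed_sign_def)
      qed
      also have "\<dots> = f K0 m" by (rule f_K) (simp add: K_def)
      finally show ?thesis using 2 by (simp add: mixed_sign_def)
    next
      case 3
      define K where "K = K0 + (- m)"
      have "field_commutator (p + q) ?W s C m n v = (\<Sum>i\<in>{m..-1}.
          koszul p (A i (comm_BC (m - 1 - i) n v)) +
          koszul (p * q + q) (B (m - 1 - i) (comm_AC i n v)))"
        unfolding field_commutator_def[of "p + q" ?W] normal_ordered_negative[OF A B 3(1)]
          field_sum[OF C] koszul_sum sum_subtractf[symmetric]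
      proof (rule sum.cong[OF refl], goal_cases)
        case (1 i)
        then have i: "i < 0" "m - 1 - i < 0" by auto
        show ?case
          by (rule term_neg_pos[OF i 3(2,1)])
      qed
      then have "\<phi> (field_commutator (p + q) ?W s C m n v) = (\<Sum>i\<in>{m..-1}.
          koszul p (\<phi> (A i (comm_BC (m - 1 - i) n v)))) + (\<Sum>i\<in>{m..-1}.
          koszul (p * q + q) (\<phi> (B (m - 1 - i) (comm_AC (m - 1 - (m - 1 - i)) n v))))"
        by (simp add: functional_sum[OF \<phi>] functional_add[OF \<phi>] functional_koszul[OF \<phi>] sum.distrib)
      also have "\<dots> = (\<Sum>i\<in>{m..-1}.
          koszul p (\<phi> (A i (comm_BC (m - 1 - i) n v))) +
          koszul (p * q + q) (\<phi> (B i (comm_AC (m - 1 - i) n v))))"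
        unfolding sum_reflect_int_negative[of "\<lambda>j. koszul (p * q + q) (\<phi> (B j (comm_AC (m - 1 - j) n v)))" m]
        by (simp add: sum.distrib)
      also have "\<dots> = (\<Sum>i\<in>{m..-1}. - (koszul p (fB (\<lambda>u. \<phi> (A i u)) v (L - 1 - i) (m - 1 - i)) +
          koszul (p * q + q) (fA (\<lambda>u. \<phi> (B i u)) v (L - 1 - i) (m - 1 - i))))"
      proof (rule sum.cong[OF refl], goal_cases)
        case (1 i)
        then have "m - 1 - i < 0" by auto
        then show ?case
          using fB(2)[OF \<phi>A Li, of i i v] fA(2)[OF \<phi>B Li, of i i v] 3
          by (simp add: mixed_sign_def koszul_neg)
      qed
      also have "\<dots> = - f K m"
        unfolding f_def sum_negf[symmetric]
        by (rule sum.mono_neutral_left) (use 3 in \<open>auto simp: K_def K0_def nonneg_zero \<phi>A \<phi>B\<close>)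
      also have "f K m = f K0 m" by (rule f_K) (use 3 in \<open>simp add: K_def\<close>)
      finally show ?thesis using 3 by (simp add: mixed_sign_def)
    qed
  next
    (* here 0 <= n <= L leaves finitely many vectors C_n v, so that one range serves for all m *)
    define K where "K = int (bd v) + (\<Sum>n\<in>{0..L}. int (bd (C n v)))"
    have K_v: "int (bd v) \<le> K" and K_C: "n \<in> {0..L} \<Longrightarrow> int (bd (C n v)) \<le> K" for n
      unfolding K_def by (auto intro!: sum_nonneg add_nonneg_nonneg intro: order_trans[OF member_le_sum[of n "{0..L}" "\<lambda>n. int (bd (C n v))"]])
    (* g1 collects the regular modes on the left, g2 the polar modes on the right; the sign of g2 is the
       mixed sign of the region m < 0 <= n of the commutators that it uses *)
    define g1 where "g1 m = (\<Sum>i\<in>{-K..-1}. gB (\<lambda>u. \<phi> (A i u)) v (L - 1 - i) (m - 1 - i) +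
      koszul (p * q) (gA (\<lambda>u. \<phi> (B i u)) v (L - 1 - i) (m - 1 - i)))" for m
    define g2 where "g2 m = (\<Sum>j\<in>{0..<K}. koszul (q * s + s + p + 1) (fA \<phi> (B j v) (L - 1 - j) (m - 1 - j)) +
      koszul (p * q + p * s + s + q + 1) (fB \<phi> (A j v) (L - 1 - j) (m - 1 - j)))" for m
    show "polyseq N (\<lambda>m. g1 m - g2 m)"
      unfolding g1_def g2_def diff_diff_eq diff_conv_add_uminus
      by (intro polyseq_add polyseq_uminus polyseq_sum polyseq_koszul polyseq_shift fA(1) fB(1) gA(1) gB(1) \<phi>A \<phi>B \<phi>)
    fix m n :: int assume L: "m + n = L" and mn: "m \<ge> 0" "n \<ge> 0"
    have Li: "m - 1 - i + n = L - 1 - i" for i using L by simp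
    have W: "?W m u = (\<Sum>i\<in>{-K..-1}. koszul p (A i (B (m - 1 - i) u)) +
        koszul (p * q + q) (B i (A (m - 1 - i) u)))" if "u = v \<or> u = C n v" for u
    proof (rule normal_ordered_nonnegative[OF A B mn(1)])
      fix j assume "j \<ge> K"
      moreover have "int (bd u) \<le> K" using that K_v K_C[of n] L mn by auto
      ultimately have "j \<ge> int (bd u)" by simp
      then show "A j u = 0" "B j u = 0" using bd by blast+
    qed
    have "field_commutator (p + q) ?W s C m n v = (\<Sum>i\<in>{-K..-1}.
        (A i (comm_BC (m - 1 - i) n v) +
          koszul (q * s + s + p + 1) (comm_AC i n (B (m - 1 - i) v))) +
        (koszul (p * q) (B i (comm_AC (m - 1 - i) n v)) +
          koszul (p * q + p * s + s + q + 1) (comm_BC i n (A (m - 1 - i) v))))"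
      unfolding field_commutator_def[of "p + q" ?W] W[OF disjI1[OF refl]] W[OF disjI2[OF refl]]
        field_sum[OF C] koszul_sum sum_subtractf[symmetric]
    proof (rule sum.cong[OF refl], goal_cases)
      case (1 i)
      then have i: "i < 0" "m - 1 - i \<ge> 0" using mn by auto
      show ?case
        unfolding term_pos_pos[OF i mn(2,1), symmetric] field_add[OF C] koszul_add by simp
    qed
    then have "\<phi> (field_commutator (p + q) ?W s C m n v) =
      (\<Sum>i\<in>{-K..-1}. \<phi> (A i (comm_BC (m - 1 - i) n v)) +
          koszul (p * q) (\<phi> (B i (comm_AC (m - 1 - i) n v)))) +
      (\<Sum>i\<in>{-K..-1}. koszul (q * s + s + p + 1) (\<phi> (comm_AC (m - 1 - (m - 1 - i)) n (B (m - 1 - i) v))) +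
          koszul (p * q + p * s + s + q + 1) (\<phi> (comm_BC (m - 1 - (m - 1 - i)) n (A (m - 1 - i) v))))"
      by (simp add: functional_sum[OF \<phi>] functional_add[OF \<phi>] functional_koszul[OF \<phi>] sum.distrib algebra_simps)
    also have "(\<Sum>i\<in>{-K..-1}. \<phi> (A i (comm_BC (m - 1 - i) n v)) +
          koszul (p * q) (\<phi> (B i (comm_AC (m - 1 - i) n v)))) = g1 m"
      unfolding g1_def
    proof (rule sum.cong[OF refl], goal_cases)
      case (1 i)
      then have "m - 1 - i \<ge> 0" using mn by auto
      then show ?case
        using gB(2)[OF \<phi>A Li, of i i v] gA(2)[OF \<phi>B Li, of i i v] mn by simp
    qed
    also have "(\<Sum>i\<in>{-K..-1}. koszul (q * s + s + p + 1) (\<phi> (comm_AC (m - 1 - (m - 1 - i)) n (B (m - 1 - i) v))) +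
          koszul (p * q + p * s + s + q + 1) (\<phi> (comm_BC (m - 1 - (m - 1 - i)) n (A (m - 1 - i) v)))) =
      (\<Sum>j\<in>{m..<m + K}. koszul (q * s + s + p + 1) (\<phi> (comm_AC (m - 1 - j) n (B j v))) +
          koszul (p * q + p * s + s + q + 1) (\<phi> (comm_BC (m - 1 - j) n (A j v))))"
      by (rule sum_reflect_int)
    also have "\<dots> = - g2 m"
    proof -
      let ?h = "\<lambda>j. koszul (q * s + s + p + 1) (fA \<phi> (B j v) (L - 1 - j) (m - 1 - j)) +
        koszul (p * q + p * s + s + q + 1) (fB \<phi> (A j v) (L - 1 - j) (m - 1 - j))"
      have fval: "fA \<phi> u (L - 1 - j) (m - 1 - j) = (if m - 1 - j \<ge> 0 then 0 else - \<phi> (comm_AC (m - 1 - j) n u))"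
        "fB \<phi> u (L - 1 - j) (m - 1 - j) = (if m - 1 - j \<ge> 0 then 0 else - \<phi> (comm_BC (m - 1 - j) n u))"
        for j u
        using fA(2)[OF \<phi> Li, of j u] fB(2)[OF \<phi> Li, of j u] mn by (simp_all add: mixed_sign_def)
      have K: "K \<ge> 0" unfolding K_def by (intro add_nonneg_nonneg sum_nonneg) auto
      have h_ge: "?h j = 0" if "j \<ge> K" for j
      proof -
        have "j \<ge> int (bd v)" using that K_v by simp
        then have "A j v = 0" "B j v = 0" using bd by blast+
        then show ?thesis
          by (simp add: fval field_commutator_linear[OF A C] field_commutator_linear[OF B C] functional_zero[OF \<phi>])
      qed
      have h_less: "?h j = 0" if "j < m" for j
        using that by (simp add: fval)
      have "(\<Sum>j\<in>{m..<m + K}. koszul (q * s + s + p + 1) (\<phi> (comm_AC (m - 1 - j) n (B j v))) +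
          koszul (p * q + p * s + s + q + 1) (\<phi> (comm_BC (m - 1 - j) n (A j v)))) =
        - (\<Sum>j\<in>{m..<m + K}. ?h j)"
        unfolding sum_negf[symmetric] by (rule sum.cong) (auto simp: fval koszul_neg)
      also have "(\<Sum>j\<in>{m..<m + K}. ?h j) = (\<Sum>j\<in>{0..<m + K}. ?h j)"
        by (rule sum.mono_neutral_left) (use h_less mn K in auto)
      also have "\<dots> = g2 m"
        unfolding g2_def by (rule sum.mono_neutral_right) (use h_ge mn in auto)
      finally show ?thesis .
    qed
    finally show "g1 m - g2 m = \<phi> (field_commutator (p + q) ?W s C m n v)" by simp
  qed
qed

theorem local_upto_normal_ordered: "local_upto scale N (p + q) (normal_ordered p A q B) s C"
  by (simp add: local_upto_def delta_like_def delta_like_at_normal_ordered)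

end

section \<open>Fields that create a state\<close>

lemma homogeneous_field_field: "homogeneous_raviolo_field scale V p A \<Longrightarrow> raviolo_field scale A"
  by (simp add: homogeneous_raviolo_field_def)

lemma homogeneous_field_degree:
  "homogeneous_raviolo_field scale V p A \<Longrightarrow> v \<in> V r \<Longrightarrow> A m v \<in> V (r + (p - basis_degree m))"
  by (simp add: homogeneous_raviolo_field_def homogeneous_endo_def)

definition translation_covariant ::
    "(complex \<Rightarrow> 'v::ab_group_add \<Rightarrow> 'v) \<Rightarrow> ('v \<Rightarrow> 'v) \<Rightarrow> 'v modes \<Rightarrow> bool" where
  "translation_covariant scale T A \<longleftrightarrow> (\<forall>m v. T (A m v) - A m (T v) = field_deriv scale A m v)"

text \<open>
  What the axioms require of \<open>Y(a,z)\<close> for \<open>a\<close> of degree \<open>p\<close>, apart from locality.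
\<close>

definition state_field ::
    "(complex \<Rightarrow> 'v::ab_group_add \<Rightarrow> 'v) \<Rightarrow> (int \<Rightarrow> 'v set) \<Rightarrow> 'v \<Rightarrow> ('v \<Rightarrow> 'v) \<Rightarrow> int \<Rightarrow> 'v \<Rightarrow> 'v modes \<Rightarrow> bool" where
  "state_field scale V vac T p a A \<longleftrightarrow> homogeneous_raviolo_field scale V p A \<and>
     translation_covariant scale T A \<and> (\<forall>m\<ge>0. A m vac = 0) \<and> A (-1) vac = a"

context graded_vector_space
begin

lemma zero_component: "0 \<in> V r"
  using subspace_component[of r] by (simp add: subspace_def)

lemma koszul_component: "v \<in> V r \<Longrightarrow> koszul k v \<in> V r"
  using subspace_component[of r] by (simp add: koszul_def subspace_neg)

lemma linearI:
  "(\<And>u v. f (u + v) = f u + f v) \<Longrightarrow> (\<And>c v. f (scale c v) = scale c (f v)) \<Longrightarrow>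
    Vector_Spaces.linear scale scale f"
  by (simp add: Vector_Spaces.linear_iff vector_space_axioms)

lemma raviolo_field_deriv:
  assumes A: "raviolo_field scale A"
  shows "raviolo_field scale (field_deriv scale A)"
  unfolding raviolo_field_def
proof (intro conjI allI)
  show "Vector_Spaces.linear scale scale (field_deriv scale A m)" for m
    by (rule linearI) (simp_all add: field_deriv_def field_add[OF A] field_scale[OF A]
        scale_right_distrib scale_left_commute)
  show "\<exists>N. \<forall>m\<ge>N. field_deriv scale A m v = 0" for v
  proof -
    obtain M where M: "\<And>m. m \<ge> M \<Longrightarrow> A m v = 0" using field_bounded[OF A] by blast
    then have "field_deriv scale A m v = 0" if "m \<ge> M + 1" for m
      using that by (simp add: field_deriv_def)
    then show ?thesis by blast
  qed
qed

lemma homogeneous_field_deriv: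
  assumes A: "homogeneous_raviolo_field scale V p A"
  shows "homogeneous_raviolo_field scale V p (field_deriv scale A)"
  unfolding homogeneous_raviolo_field_def homogeneous_endo_def
proof (intro conjI allI ballI)
  note f = raviolo_field_deriv[OF homogeneous_field_field[OF A]]
  show "raviolo_field scale (field_deriv scale A)" by (rule f)
  show "Vector_Spaces.linear scale scale (field_deriv scale A m)" for m by (rule field_linear[OF f])
  fix m r v assume v: "v \<in> V r"
  show "field_deriv scale A m v \<in> V (r + (p - basis_degree m))"
  proof (cases "m = 0")
    case True
    then show ?thesis by (simp add: field_deriv_def zero_component)
  next
    case False
    then have "basis_degree (m - 1) = basis_degree m" by (simp add: basis_degree_def)
    then have "A (m - 1) v \<in> V (r + (p - basis_degree m))"
      using homogeneous_field_degree[OF A v, of "m - 1"] by simp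
    then show ?thesis unfolding field_deriv_def by (rule subspace_scale[OF subspace_component])
  qed
qed

lemma normal_ordered_field:
  assumes A: "raviolo_field scale A" and B: "raviolo_field scale B"
  shows "raviolo_field scale (normal_ordered p A q B)"
  unfolding raviolo_field_def
proof (intro conjI allI)
  let ?W = "normal_ordered p A q B"
  obtain bd :: "'v \<Rightarrow> nat" where bd: "\<And>u j. j \<ge> int (bd u) \<Longrightarrow> A j u = 0 \<and> B j u = 0"
    by (rule common_mode_bound[OF A B]) (rule that)
  have W: "?W m u = (\<Sum>i\<in>{-K..-1}. koszul p (A i (B (m - 1 - i) u)) + koszul (p * q + q) (B i (A (m - 1 - i) u)))"
    if "m \<ge> 0" "K \<ge> int (bd u)" for m K u
    by (rule normal_ordered_nonnegative[OF A B that(1)]) (use bd that in auto)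
  have W': "?W m u = (\<Sum>i\<in>{m..-1}. A i (B (m - 1 - i) u))" if "m < 0" for m u
    by (rule normal_ordered_negative[OF A B that])
  note lin = field_add[OF A] field_add[OF B] field_scale[OF A] field_scale[OF B]
  show "Vector_Spaces.linear scale scale (?W m)" for m
  proof (rule linearI)
    fix u v
    show "?W m (u + v) = ?W m u + ?W m v"
    proof (cases "m < 0")
      case False
      define K where "K = int (bd u) + int (bd v) + int (bd (u + v))"
      show ?thesis
        using False W[of m u K] W[of m v K] W[of m "u + v" K]
        by (simp add: K_def lin koszul_add sum.distrib[symmetric] algebra_simps)
    qed (simp add: W' lin sum.distrib)
  next
    fix c v
    show "?W m (scale c v) = scale c (?W m v)"
    proof (cases "m < 0")
      case False
      define K where "K = int (bd v) + int (bd (scale c v))"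
      show ?thesis
        using False W[of m v K] W[of m "scale c v" K]
        by (simp add: K_def lin koszul_scale[OF vector_space_axioms] scale_sum_right scale_right_distrib)
    qed (simp add: W' lin scale_sum_right)
  qed
  show "\<exists>N. \<forall>m\<ge>N. ?W m v = 0" for v
  proof (intro exI allI impI)
    fix m assume m: "m \<ge> int (bd v)"
    then have "?W m v = (\<Sum>i\<in>{-int (bd v)..-1}. koszul p (A i (B (m - 1 - i) v)) + koszul (p * q + q) (B i (A (m - 1 - i) v)))"
      by (intro W) auto
    also have "\<dots> = 0"
    proof (intro sum.neutral ballI)
      fix i assume "i \<in> {-int (bd v)..-1}"
      then have "m - 1 - i \<ge> int (bd v)" using m by auto
      then show "koszul p (A i (B (m - 1 - i) v)) + koszul (p * q + q) (B i (A (m - 1 - i) v)) = 0"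
        using bd by (simp add: field_zero[OF A] field_zero[OF B])
    qed
    finally show "?W m v = 0" .
  qed
qed

lemma normal_ordered_homogeneous:
  assumes A: "homogeneous_raviolo_field scale V p A" and B: "homogeneous_raviolo_field scale V q B"
  shows "homogeneous_raviolo_field scale V (p + q) (normal_ordered p A q B)"
proof -
  note fA = homogeneous_field_field[OF A] and fB = homogeneous_field_field[OF B]
  note f = normal_ordered_field[OF fA fB, of p q]
  have "normal_ordered p A q B m v \<in> V (r + (p + q - basis_degree m))" if v: "v \<in> V r" for m r v
  proof (cases "m < 0")
    case True
    have "A i (B j v) \<in> V (r + (p + q))" if "i < 0" "j < 0" for i j
      using homogeneous_field_degree[OF A homogeneous_field_degree[OF B v], of i j] that
      by (simp add: basis_degree_def algebra_simps)
    then show ?thesis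
      unfolding normal_ordered_negative[OF fA fB True] using True
      by (intro subspace_sum subspace_component) (auto simp: basis_degree_def)
  next
    case False
    then have m: "m \<ge> 0" by simp
    obtain bd :: "'v \<Rightarrow> nat" where bd: "\<And>u j. j \<ge> int (bd u) \<Longrightarrow> A j u = 0 \<and> B j u = 0"
      by (rule common_mode_bound[OF fA fB]) (rule that)
    have W: "normal_ordered p A q B m v = (\<Sum>i\<in>{-int (bd v)..-1}. koszul p (A i (B (m - 1 - i) v)) +
        koszul (p * q + q) (B i (A (m - 1 - i) v)))"
      by (rule normal_ordered_nonnegative[OF fA fB m]) (use bd in auto)
    have "A i (B j v) \<in> V (r + (p + q - 1))" "B i (A j v) \<in> V (r + (p + q - 1))" if "i < 0" "j \<ge> 0" for i j
      using homogeneous_field_degree[OF A homogeneous_field_degree[OF B v], of i j]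
        homogeneous_field_degree[OF B homogeneous_field_degree[OF A v], of i j] that
      by (simp_all add: basis_degree_def algebra_simps)
    then show ?thesis
      unfolding W using m
      by (intro subspace_sum subspace_add subspace_component koszul_component) (auto simp: basis_degree_def)
  qed
  then show ?thesis
    using f field_linear[OF f] by (simp add: homogeneous_raviolo_field_def homogeneous_endo_def)
qed

text \<open>
  With \<open>u i = A\<^sub>i B\<^bsub>m-2-i\<^esub> v\<close> the left hand side is the derivation rule for \<open>\<Sum>\<^sub>i A\<^sub>i B\<^bsub>m-1-i\<^esub> v\<close>.  The
  coefficients of \<open>u i\<close> add up to \<open>-m\<close>, up to a boundary term at the lower end of the range.
\<close>

lemma derivation_sum_telescope:
  "(\<Sum>i\<in>{-int K..-1}. scale (- of_int i) (u (i - 1)) + scale (- of_int (m - 1 - i)) (u i)) =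
    scale (- of_int m) (\<Sum>i\<in>{-int K..-1}. u i) + scale (of_nat K) (u (- int K - 1))"
proof (induction K)
  case (Suc K)
  have "{-int (Suc K)..-1} = insert (- int K - 1) {-int K..-1}" by auto
  then have s: "(\<Sum>i\<in>{-int (Suc K)..-1}. f i) = f (- int K - 1) + (\<Sum>i\<in>{-int K..-1}. f i)" for f :: "int \<Rightarrow> 'v"
    by simp
  have e: "- int (Suc K) - 1 = - int K - 2" by simp
  show ?case unfolding s Suc e by (simp add: algebra_simps)
qed simp

lemma normal_ordered_translation_covariant:
  assumes A: "raviolo_field scale A" and B: "raviolo_field scale B"
    and T: "Vector_Spaces.linear scale scale T"
    and TA: "translation_covariant scale T A" and TB: "translation_covariant scale T B"
  shows "translation_covariant scale T (normal_ordered p A q B)"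
  unfolding translation_covariant_def
proof (intro allI)
  interpret T: Vector_Spaces.linear scale scale T by (rule T)
  let ?W = "normal_ordered p A q B"
  fix m v
  have deriv: "T (A i (B j v)) - A i (B j (T v)) =
      scale (- of_int i) (A (i - 1) (B j v)) + scale (- of_int j) (A i (B (j - 1) v))"
    if "translation_covariant scale T A" "translation_covariant scale T B" "raviolo_field scale A" for A B :: "'v modes" and i j
  proof -
    have "T (A i (B j v)) = scale (- of_int i) (A (i - 1) (B j v)) + A i (T (B j v))"
      using that(1) unfolding translation_covariant_def field_deriv_def by (metis diff_add_cancel)
    moreover have "T (B j v) = scale (- of_int j) (B (j - 1) v) + B j (T v)"
      using that(2) unfolding translation_covariant_def field_deriv_def by (metis diff_add_cancel)
    ultimately show ?thesis
      by (simp only: field_add[OF that(3)] field_scale[OF that(3)]) simp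
  qed
  show "T (?W m v) - ?W m (T v) = field_deriv scale ?W m v"
  proof (cases "m < 0")
    case True
    define K where "K = nat (- m)"
    have K: "m = - int K" using True by (simp add: K_def)
    let ?u = "\<lambda>i. A i (B (m - 1 - 1 - i) v)"
    have "T (?W m v) - ?W m (T v) = (\<Sum>i\<in>{-int K..-1}. T (A i (B (m - 1 - i) v)) - A i (B (m - 1 - i) (T v)))"
      unfolding K[symmetric] normal_ordered_negative[OF A B True] T.sum sum_subtractf ..
    also have "\<dots> = (\<Sum>i\<in>{-int K..-1}. scale (- of_int i) (?u (i - 1)) + scale (- of_int (m - 1 - i)) (?u i))"
      by (rule sum.cong[OF refl]) (simp only: deriv[OF TA TB A], simp add: algebra_simps)
    also have "\<dots> = scale (- of_int m) (\<Sum>i\<in>{-int K..-1}. ?u i) + scale (of_nat K) (?u (- int K - 1))"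
      by (rule derivation_sum_telescope)
    also have "\<dots> = scale (- of_int m) (?u (m - 1) + (\<Sum>i\<in>{m..-1}. ?u i))"
      by (simp add: K scale_right_distrib)
    also have "?u (m - 1) + (\<Sum>i\<in>{m..-1}. ?u i) = (\<Sum>i\<in>{m-1..-1}. ?u i)"
    proof -
      have "{m-1..-1} = insert (m - 1) {m..-1}" using True by auto
      then show ?thesis by simp
    qed
    also have "scale (- of_int m) (\<Sum>i\<in>{m-1..-1}. ?u i) = field_deriv scale ?W m v"
      unfolding field_deriv_def using normal_ordered_negative[OF A B, of "m - 1" p q v] True by simp
    finally show ?thesis .
  next
    case False
    then have m: "m \<ge> 0" by simp
    obtain bd :: "'v \<Rightarrow> nat" where bd: "\<And>u j. j \<ge> int (bd u) \<Longrightarrow> A j u = 0 \<and> B j u = 0"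
      by (rule common_mode_bound[OF A B]) (rule that)
    (* the summand 1 covers the index m - 1 in the boundary term of the telescoping sum *)
    define K where "K = bd v + bd (T v) + 1"
    let ?u = "\<lambda>i. A i (B (m - 1 - 1 - i) v)" and ?w = "\<lambda>i. B i (A (m - 1 - 1 - i) v)"
    have W: "?W k u = (\<Sum>i\<in>{-int K..-1}. koszul p (A i (B (k - 1 - i) u)) + koszul (p * q + q) (B i (A (k - 1 - i) u)))"
      if "k \<ge> 0" "u = v \<or> u = T v" for k u
      by (rule normal_ordered_nonnegative[OF A B that(1)]) (use that(2) bd in \<open>auto simp: K_def\<close>)
    have Tk: "T (koszul k x) = koszul k (T x)" for k x by (simp add: koszul_def T.neg)
    have "T (?W m v) - ?W m (T v) = (\<Sum>i\<in>{-int K..-1}.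
        koszul p (T (A i (B (m - 1 - i) v)) - A i (B (m - 1 - i) (T v))) +
        koszul (p * q + q) (T (B i (A (m - 1 - i) v)) - B i (A (m - 1 - i) (T v))))"
      unfolding W[OF m disjI1[OF refl]] W[OF m disjI2[OF refl]] T.sum sum_subtractf[symmetric]
      by (rule sum.cong[OF refl]) (simp add: T.add Tk koszul_diff)
    also have "\<dots> = koszul p (\<Sum>i\<in>{-int K..-1}. scale (- of_int i) (?u (i - 1)) + scale (- of_int (m - 1 - i)) (?u i)) +
      koszul (p * q + q) (\<Sum>i\<in>{-int K..-1}. scale (- of_int i) (?w (i - 1)) + scale (- of_int (m - 1 - i)) (?w i))"
      unfolding koszul_sum sum.distrib[symmetric]
      by (rule sum.cong[OF refl]) (simp only: deriv[OF TA TB A] deriv[OF TB TA B], simp add: algebra_simps)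
    also have "\<dots> = koszul p (scale (- of_int m) (\<Sum>i\<in>{-int K..-1}. ?u i)) +
        koszul (p * q + q) (scale (- of_int m) (\<Sum>i\<in>{-int K..-1}. ?w i))"
    proof -
      have "m - 1 - 1 - (- int K - 1) \<ge> int (bd v)" using m by (simp add: K_def)
      then have "?u (- int K - 1) = 0" "?w (- int K - 1) = 0"
        using bd by (simp_all add: field_zero[OF A] field_zero[OF B])
      then show ?thesis
        unfolding derivation_sum_telescope[where u = ?u] derivation_sum_telescope[where u = ?w] by simp
    qed
    also have "\<dots> = scale (- of_int m) (\<Sum>i\<in>{-int K..-1}. koszul p (?u i) + koszul (p * q + q) (?w i))"
      by (simp only: koszul_scale[OF vector_space_axioms] scale_right_distrib[symmetric] koszul_sum sum.distrib)
    also have "\<dots> = field_deriv scale ?W m v"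
    proof (cases "m = 0")
      case False
      then show ?thesis unfolding field_deriv_def using W[of "m - 1" v] m by simp
    qed (simp add: field_deriv_def)
    finally show ?thesis .
  qed
qed

lemma state_field_normal_ordered:
  assumes T: "Vector_Spaces.linear scale scale T"
    and A: "state_field scale V vac T p a A" and B: "state_field scale V vac T q b B"
  shows "state_field scale V vac T (p + q) (A (-1) b) (normal_ordered p A q B)"
proof -
  have fA: "raviolo_field scale A" and fB: "raviolo_field scale B"
    using A B homogeneous_field_field unfolding state_field_def by blast+
  have "normal_ordered p A q B m vac = 0" if "m \<ge> 0" for m
    using normal_ordered_nonnegative[OF fA fB that, of 0 vac p q] A B by (simp add: state_field_def)
  moreover have "normal_ordered p A q B (-1) vac = A (-1) b"
    using normal_ordered_negative[OF fA fB, of "-1" p q vac] B by (simp add: state_field_def)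
  ultimately show ?thesis
    using A B normal_ordered_homogeneous[of p A q B] normal_ordered_translation_covariant[OF fA fB T]
    by (simp add: state_field_def)
qed

lemma field_deriv_translation_covariant:
  assumes T: "Vector_Spaces.linear scale scale T" and "translation_covariant scale T A"
  shows "translation_covariant scale T (field_deriv scale A)"
  unfolding translation_covariant_def
proof (intro allI)
  interpret T: Vector_Spaces.linear scale scale T by (rule T)
  have mode: "field_deriv scale X m v = scale (- of_int m) (X (m - 1) v)" for X m v
    by (simp add: field_deriv_def)
  fix m v
  have "T (A (m - 1) v) - A (m - 1) (T v) = field_deriv scale A (m - 1) v"
    using assms(2) by (simp add: translation_covariant_def)
  then show "T (field_deriv scale A m v) - field_deriv scale A m (T v) = field_deriv scale (field_deriv scale A) m v"
    unfolding mode[of A m] mode[of "field_deriv scale A"] T.scale scale_right_diff_distrib[symmetric]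
    by simp
qed

lemma state_field_deriv:
  assumes T: "Vector_Spaces.linear scale scale T" and A: "state_field scale V vac T p a A"
  shows "state_field scale V vac T p (A (-2) vac) (field_deriv scale A)"
proof -
  have "field_deriv scale A m vac = 0" if "m \<ge> 0" for m
    using A that by (cases "m = 0") (simp_all add: field_deriv_def state_field_def)
  moreover have "field_deriv scale A (-1) vac = A (-2) vac" by (simp add: field_deriv_def)
  ultimately show ?thesis
    using A homogeneous_field_deriv field_deriv_translation_covariant[OF T] by (simp add: state_field_def)
qed

text \<open>
  For \<open>l = 0\<close> this gives the factorials that the definition of \<open>word_field\<close> divides by.
\<close>

lemma funpow_field_deriv_mode:
  "(field_deriv scale ^^ k) A (- 1 - int l) v = scale (fact (l + k) / fact l) (A (- 1 - int l - int k) v)"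
proof (induction k arbitrary: l)
  case (Suc k)
  have "(field_deriv scale ^^ Suc k) A (- 1 - int l) v =
      scale (of_nat (Suc l)) ((field_deriv scale ^^ k) A (- 1 - int (Suc l)) v)"
    by (simp add: field_deriv_def algebra_simps)
  also have "\<dots> = scale (of_nat (Suc l) * (fact (Suc l + k) / fact (Suc l))) (A (- 1 - int (Suc l) - int k) v)"
    by (simp only: Suc scale_scale)
  also have "of_nat (Suc l) * (fact (Suc l + k) / fact (Suc l)) = (fact (l + Suc k) / fact l :: complex)"
  proof -
    have "fact (Suc l) = (of_nat (Suc l) * fact l :: complex)" by (rule fact_Suc)
    moreover have "of_nat (Suc l) \<noteq> (0::complex)" by (rule of_nat_neq_0)
    moreover have "fact (Suc l + k) = (fact (l + Suc k) :: complex)" by simp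
    ultimately show ?thesis
      by (simp only: times_divide_eq_right nonzero_mult_divide_mult_cancel_left[OF \<open>of_nat (Suc l) \<noteq> 0\<close>])
  qed
  also have "- 1 - int (Suc l) - int k = - 1 - int l - int (Suc k)" by simp
  finally show ?case .
qed simp

lemma state_field_funpow_deriv:
  assumes T: "Vector_Spaces.linear scale scale T" and A: "state_field scale V vac T p a A"
  shows "state_field scale V vac T p ((field_deriv scale ^^ k) A (-1) vac) ((field_deriv scale ^^ k) A)"
proof (induction k)
  case 0
  show ?case using A by (simp add: state_field_def)
next
  case (Suc k)
  then show ?case using state_field_deriv[OF T Suc] by (simp add: state_field_def)
qed

lemma id_field_field: "raviolo_field scale id_field"
  unfolding raviolo_field_def
proof (intro conjI allI)
  show "Vector_Spaces.linear scale scale (id_field m)" for m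
    by (rule linearI) (simp_all add: id_field_def)
  show "\<exists>N. \<forall>m\<ge>N. id_field m v = 0" for v
    by (intro exI[of _ 0]) (simp add: id_field_def)
qed

lemma normal_ordered_id:
  assumes A: "raviolo_field scale A"
  shows "normal_ordered p A 0 id_field = A"
proof (intro ext)
  fix m v
  show "normal_ordered p A 0 id_field m v = A m v"
  proof (cases "m < 0")
    case True
    have "normal_ordered p A 0 id_field m v = (\<Sum>i\<in>{m..-1}. if i = m then A m v else 0)"
      unfolding normal_ordered_negative[OF A id_field_field True]
      by (rule sum.cong) (auto simp: id_field_def field_zero[OF A])
    then show ?thesis using True by simp
  next
    case False
    then have m: "m \<ge> 0" by simp
    obtain K :: nat where K: "\<And>j. j \<ge> int K \<Longrightarrow> A j v = 0"
      using eventually_zero_bound[OF field_bounded[OF A]] by metis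
    have "normal_ordered p A 0 id_field m v = (\<Sum>i\<in>{-(int K + 1)..-1}. if i = - 1 then A m v else 0)"
      by (subst normal_ordered_nonnegative[OF A id_field_field m, of "int K + 1"])
        (use K m in \<open>auto simp: id_field_def field_zero[OF A] koszul_def intro!: sum.cong\<close>)
    then show ?thesis by simp
  qed
qed

lemma normal_ordered_list_Cons:
  assumes "raviolo_field scale X"
  shows "normal_ordered_list ((p, X) # Ls) =
    normal_ordered p X (sum_list (map fst Ls)) (normal_ordered_list Ls)"
  by (cases Ls) (simp_all add: normal_ordered_id[OF assms])

lemma normal_ordered_list_field:
  "(\<And>p X. (p, X) \<in> set Ls \<Longrightarrow> raviolo_field scale X) \<Longrightarrow> raviolo_field scale (normal_ordered_list Ls)"
proof (induction Ls)
  case Nil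
  show ?case by (simp add: id_field_field)
next
  case (Cons x Ls)
  obtain p X where x: "x = (p, X)" by (cases x)
  then have "raviolo_field scale X" "raviolo_field scale (normal_ordered_list Ls)"
    using Cons by auto
  then show ?case unfolding x by (subst normal_ordered_list_Cons) (auto intro: normal_ordered_field)
qed

text \<open>
  The induction hypothesis is needed for two fields, for \<open>C\<close> and for the first factor \<open>X\<close>: locality of \<open>X\<close> with the
  remaining product provides the commuting regular modes on which Dong's lemma depends.
\<close>

lemma normal_ordered_list_local:
  assumes fields: "\<And>p X. (p, X) \<in> set Ls \<Longrightarrow> raviolo_field scale X"
    and pairs: "\<And>p X q Y. (p, X) \<in> set Ls \<Longrightarrow> (q, Y) \<in> set Ls \<Longrightarrow> \<exists>N. local_upto scale N p X q Y"
    and C: "raviolo_field scale C" "\<And>p X. (p, X) \<in> set Ls \<Longrightarrow> \<exists>N. local_upto scale N p X s C"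
  shows "\<exists>N. local_upto scale N (sum_list (map fst Ls)) (normal_ordered_list Ls) s C"
  using assms
proof (induction Ls arbitrary: s C)
  case Nil
  then show ?case using local_upto_id[OF Nil.prems(3)] by auto
next
  case (Cons x Ls)
  obtain p X where x: "x = (p, X)" by (cases x)
  let ?q = "sum_list (map fst Ls)" and ?B = "normal_ordered_list Ls"
  have X: "raviolo_field scale X" and B: "raviolo_field scale ?B"
    using Cons.prems(1) x by (auto intro!: normal_ordered_list_field)
  obtain N1 where N1: "local_upto scale N1 p X s C" using Cons.prems(4) x by auto
  obtain N2 where N2: "local_upto scale N2 ?q ?B s C"
    using Cons.IH[of C s] Cons.prems by auto
  obtain N3 where "local_upto scale N3 ?q ?B p X"
    using Cons.IH[of X p] Cons.prems x X by auto
  then have N3: "local_upto scale N3 p X ?q ?B" by (rule local_upto_swap)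
  have "local_upto scale (max N1 N2) (p + ?q) (normal_ordered p X ?q ?B) s C"
    by (rule local_upto_normal_ordered[OF vector_space_axioms X B Cons.prems(3)
          local_negative_modes_commute[OF vector_space_axioms N3] local_upto_common[OF N1 N2]])
  then show ?case unfolding x normal_ordered_list_Cons[OF X] by auto
qed

lemma state_field_scale:
  assumes "state_field scale V vac T p a A" and T: "Vector_Spaces.linear scale scale T"
  shows "state_field scale V vac T p (scale c a) (\<lambda>m v. scale c (A m v))"
proof -
  interpret T: Vector_Spaces.linear scale scale T by (rule T)
  have h: "homogeneous_raviolo_field scale V p A" and t: "translation_covariant scale T A"
    using assms by (auto simp: state_field_def)
  note f = homogeneous_field_field[OF h]
  have lin: "Vector_Spaces.linear scale scale (\<lambda>v. scale c (A m v))" for m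
    by (rule linearI) (simp_all add: field_add[OF f] field_scale[OF f] scale_right_distrib scale_left_commute)
  have "\<exists>N. \<forall>m\<ge>N. scale c (A m v) = 0" for v
    using field_bounded[OF f, of v] by (metis scale_zero_right)
  then have "homogeneous_raviolo_field scale V p (\<lambda>m v. scale c (A m v))"
    using lin homogeneous_field_degree[OF h] subspace_scale[OF subspace_component]
    by (simp add: homogeneous_raviolo_field_def raviolo_field_def homogeneous_endo_def)
  moreover have "translation_covariant scale T (\<lambda>m v. scale c (A m v))"
    using t unfolding translation_covariant_def
    by (simp add: T.scale scale_right_diff_distrib[symmetric] field_deriv_def scale_left_commute)
  ultimately show ?thesis using assms by (simp add: state_field_def)
qed

lemma state_field_add:
  assumes "state_field scale V vac T p a A" "state_field scale V vac T p b B"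
    and T: "Vector_Spaces.linear scale scale T"
  shows "state_field scale V vac T p (a + b) (\<lambda>m v. A m v + B m v)"
proof -
  interpret T: Vector_Spaces.linear scale scale T by (rule T)
  have hA: "homogeneous_raviolo_field scale V p A" and tA: "translation_covariant scale T A"
    and hB: "homogeneous_raviolo_field scale V p B" and tB: "translation_covariant scale T B"
    using assms by (auto simp: state_field_def)
  note fA = homogeneous_field_field[OF hA] and fB = homogeneous_field_field[OF hB]
  have lin: "Vector_Spaces.linear scale scale (\<lambda>v. A m v + B m v)" for m
    by (rule linearI) (simp_all add: field_add[OF fA] field_scale[OF fA] field_add[OF fB] field_scale[OF fB]
        scale_right_distrib algebra_simps)
  have "\<exists>N. \<forall>m\<ge>N. A m v + B m v = 0" for v
    by (rule bounded_pointwise[OF field_bounded[OF fA, of v] field_bounded[OF fB, of v]]) simp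
  then have "homogeneous_raviolo_field scale V p (\<lambda>m v. A m v + B m v)"
    using lin homogeneous_field_degree[OF hA] homogeneous_field_degree[OF hB] subspace_add[OF subspace_component]
    by (simp add: homogeneous_raviolo_field_def raviolo_field_def homogeneous_endo_def)
  moreover have "translation_covariant scale T (\<lambda>m v. A m v + B m v)"
    unfolding translation_covariant_def
  proof (intro allI)
    fix m v
    have "T (A m v) - A m (T v) = field_deriv scale A m v" "T (B m v) - B m (T v) = field_deriv scale B m v"
      using tA tB by (simp_all add: translation_covariant_def)
    then show "T (A m v + B m v) - (A m (T v) + B m (T v)) = field_deriv scale (\<lambda>m v. A m v + B m v) m v"
      by (simp add: T.add field_deriv_def algebra_simps)
  qed
  ultimately show ?thesis using assms by (simp add: state_field_def)
qed

text \<open>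
  Translation covariance gives \<open>A\<^bsub>m-1\<^esub> |0\<rangle> = -T A\<^sub>m |0\<rangle> / m\<close> for \<open>m < 0\<close>, so all of \<open>A(z) |0\<rangle>\<close> is determined by
  its value at \<open>z = 0\<close>.
\<close>

lemma state_field_vacuum_modes:
  assumes "state_field scale V vac T p a A" "state_field scale V vac T q a B"
    and T: "Vector_Spaces.linear scale scale T" "T vac = 0"
  shows "A m vac = B m vac"
proof (cases "m \<ge> 0")
  case False
  have step: "X (m - 1) vac = scale (- 1 / of_int m) (T (X m vac))"
    if "translation_covariant scale T X" "X m 0 = 0" "m < 0" for X m
  proof -
    have "T (X m vac) - X m (T vac) = field_deriv scale X m vac"
      using that(1) unfolding translation_covariant_def by blast
    then have "T (X m vac) = scale (- of_int m) (X (m - 1) vac)"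
      using that(2) T(2) by (simp add: field_deriv_def)
    then show ?thesis using that(3) by simp
  qed
  have "A (-1 - int k) vac = B (-1 - int k) vac" for k
  proof (induction k)
    case 0
    then show ?case using assms by (simp add: state_field_def)
  next
    case (Suc k)
    have "raviolo_field scale A" "raviolo_field scale B"
      using assms homogeneous_field_field unfolding state_field_def by blast+
    then show ?case
      using step[of A "-1 - int k"] step[of B "-1 - int k"] assms(1,2) Suc
      by (simp add: state_field_def field_zero algebra_simps)
  qed
  from this[of "nat (- m - 1)"] show ?thesis using False by simp
qed (use assms in \<open>simp add: state_field_def\<close>)

section \<open>Homogeneous components\<close>

definition component :: "'v \<Rightarrow> int \<Rightarrow> 'v" where
  "component v = (THE f. (\<forall>r. f r \<in> V r) \<and> finite {r. f r \<noteq> 0} \<and> v = (\<Sum>r | f r \<noteq> 0. f r))"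

lemma component: "component v r \<in> V r" "finite {r. component v r \<noteq> 0}"
  "v = (\<Sum>r | component v r \<noteq> 0. component v r)"
  using theI'[OF direct_sum[of v]] unfolding component_def by blast+

lemma component_unique:
  assumes "\<And>r. f r \<in> V r" "finite S" "\<And>r. r \<notin> S \<Longrightarrow> f r = 0" "v = (\<Sum>r\<in>S. f r)"
  shows "component v = f"
proof -
  have "finite {r. f r \<noteq> 0}" using assms(2,3) by (metis (mono_tags, lifting) finite_subset mem_Collect_eq subsetI)
  moreover have "v = (\<Sum>r | f r \<noteq> 0. f r)"
    unfolding assms(4) by (rule sum.mono_neutral_right) (use assms in auto)
  ultimately show ?thesis using direct_sum[of v] component[of v] assms(1) by blast
qed

lemma component_sum:
  assumes "finite S" "{r. component v r \<noteq> 0} \<subseteq> S"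
  shows "(\<Sum>r\<in>S. component v r) = v"
  by (subst (2) component(3)) (rule sum.mono_neutral_right, use assms in auto)

lemma component_add: "component (u + v) = (\<lambda>r. component u r + component v r)"
proof (rule component_unique)
  let ?S = "{r. component u r \<noteq> 0} \<union> {r. component v r \<noteq> 0}"
  show "finite ?S" using component(2) by simp
  then show "u + v = (\<Sum>r\<in>?S. component u r + component v r)"
    by (simp add: sum.distrib component_sum)
  show "component u r + component v r \<in> V r" for r
    by (rule subspace_add[OF subspace_component component(1) component(1)])
qed auto

lemma component_scale: "component (scale c v) = (\<lambda>r. scale c (component v r))"
proof (rule component_unique)
  let ?S = "{r. component v r \<noteq> 0}"
  show "finite ?S" by (rule component(2))
  then show "scale c v = (\<Sum>r\<in>?S. scale c (component v r))"
    unfolding scale_sum_right[symmetric] by (simp add: component_sum)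
  show "scale c (component v r) \<in> V r" for r
    by (rule subspace_scale[OF subspace_component component(1)])
qed auto

lemma component_zero: "component 0 r = 0"
  using component_scale[of 0 0] by simp

lemma component_homogeneous: "v \<in> V p \<Longrightarrow> component v = (\<lambda>r. if r = p then v else 0)"
  by (rule component_unique[where S = "{p}"]) (auto simp: zero_component)

lemma linear_zero_on_span:
  assumes f: "Vector_Spaces.linear scale scale f" and S: "\<And>s. s \<in> S \<Longrightarrow> f s = 0" and v: "v \<in> span S"
  shows "f v = 0"
proof -
  interpret f: Vector_Spaces.linear scale scale f by (rule f)
  from v show ?thesis
    by (induction rule: span_induct_alt) (simp_all add: f.add f.scale S f.zero)
qed

end

section \<open>Uniqueness of local fields\<close>

text \<open>
  The hypotheses on the generating fields, with locality expressed through commutators.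
\<close>

locale generating_fields = graded_vector_space scale V
  for scale :: "complex \<Rightarrow> 'v::ab_group_add \<Rightarrow> 'v" and V :: "int \<Rightarrow> 'v set" +
  fixes vac :: 'v and T :: "'v \<Rightarrow> 'v" and I :: "'i set" and r :: "'i \<Rightarrow> int" and A :: "'i \<Rightarrow> 'v modes"
  assumes vac_degree: "vac \<in> V 0"
    and T_endo: "homogeneous_endo scale V 0 T" and T_vac: "T vac = 0"
    and generator_homogeneous: "i \<in> I \<Longrightarrow> homogeneous_raviolo_field scale V (r i) (A i)"
    and generator_vac: "i \<in> I \<Longrightarrow> m \<ge> 0 \<Longrightarrow> A i m vac = 0"
    and generator_covariant: "i \<in> I \<Longrightarrow> translation_covariant scale T (A i)"
    and generators_local: "i \<in> I \<Longrightarrow> j \<in> I \<Longrightarrow> \<exists>N. local_upto scale N (r i) (A i) (r j) (A j)"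
    and spanning: "span {word_vector A vac ws |ws. \<forall>(i, j)\<in>set ws. i \<in> I \<and> j < 0} = UNIV"
begin

abbreviation creates :: "int \<Rightarrow> 'v \<Rightarrow> 'v modes \<Rightarrow> bool" where
  "creates \<equiv> state_field scale V vac T"

definition admissible :: "('i \<times> int) list \<Rightarrow> bool" where
  "admissible ws \<longleftrightarrow> (\<forall>(i, j)\<in>set ws. i \<in> I \<and> j < 0)"

definition word_degree :: "('i \<times> int) list \<Rightarrow> int" where
  "word_degree ws = (\<Sum>(i, j)\<leftarrow>ws. r i)"

lemma T_linear: "Vector_Spaces.linear scale scale T"
  using T_endo by (simp add: homogeneous_endo_def)

lemma generator_field: "i \<in> I \<Longrightarrow> raviolo_field scale (A i)"
  using generator_homogeneous homogeneous_field_field by blast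

lemma word_vector_Cons: "word_vector A vac ((i, j) # ws) = A i j (word_vector A vac ws)"
  by (simp add: word_vector_def)

lemma admissible_Cons: "admissible ((i, j) # ws) \<longleftrightarrow> i \<in> I \<and> j < 0 \<and> admissible ws"
  by (auto simp: admissible_def)

lemma span_admissible_words: "span {word_vector A vac ws |ws. admissible ws} = UNIV"
  using spanning by (simp add: admissible_def)

lemma eq_zero_if_zero_on_words:
  assumes "Vector_Spaces.linear scale scale f" "\<And>ws. admissible ws \<Longrightarrow> f (word_vector A vac ws) = 0"
  shows "f v = 0"
  by (rule linear_zero_on_span[OF assms(1), of "{word_vector A vac ws |ws. admissible ws}"])
    (use assms(2) span_admissible_words in auto)

lemma eq_zero_by_word_induction:
  assumes f: "Vector_Spaces.linear scale scale f" and "f vac = 0"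
    and step: "\<And>i j u. i \<in> I \<Longrightarrow> j < 0 \<Longrightarrow> f u = 0 \<Longrightarrow> f (A i j u) = 0"
  shows "f v = 0"
proof (rule eq_zero_if_zero_on_words[OF f])
  fix ws show "admissible ws \<Longrightarrow> f (word_vector A vac ws) = 0"
  proof (induction ws)
    case Nil
    show ?case using assms(2) by (simp add: word_vector_def)
  next
    case (Cons w ws)
    then show ?case by (cases w) (simp add: admissible_Cons word_vector_Cons step)
  qed
qed

text \<open>
  The analogue of Goddard's uniqueness theorem.  The modes \<open>D\<^sub>m\<close> with \<open>m < 0\<close> supercommute with the
  regular modes of the generators and annihilate the vacuum, hence vanish on all words.  For \<open>m \<ge> 0\<close> the commutators
  with regular modes are values of polynomials which also describe the commutators of the modes \<open>D\<^sub>k\<close>, \<open>k < 0\<close>, with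
  polar modes of the generators.  The latter are zero, so these polynomials have too many zeros, and \<open>D\<^sub>m\<close> vanishes
  on words as well.
\<close>

theorem local_field_eq_zero:
  assumes D: "raviolo_field scale D"
    and loc: "\<And>i. i \<in> I \<Longrightarrow> \<exists>N. local_upto scale N p D (r i) (A i)"
    and vac: "\<And>m. D m vac = 0"
  shows "D m v = 0"
proof -
  have neg: "D m v = 0" if m: "m < 0" for m v
  proof (rule eq_zero_by_word_induction[OF field_linear[OF D] vac])
    fix i and j :: int and u assume i: "i \<in> I" "j < 0" "D m u = 0"
    obtain N where "local_upto scale N p D (r i) (A i)" using loc i by blast
    from local_negative_modes_commute[OF vector_space_axioms this m i(2)]
    show "D m (A i j u) = 0" using i by (simp add: field_zero[OF generator_field])
  qed
  show ?thesis
  proof (cases "m < 0")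
    case True
    then show ?thesis by (rule neg)
  next
    case False
    then have m: "m \<ge> 0" by simp
    show ?thesis
    proof (rule eq_zero_by_word_induction[OF field_linear[OF D] vac])
      fix i and j :: int and u assume i: "i \<in> I" and j: "j < 0" and u: "D m u = 0"
      have "field_commutator p D (r i) (A i) m j u = 0"
      proof (rule functional_separates[OF vector_space_axioms])
        fix \<phi> assume \<phi>: "functional scale \<phi>"
        obtain N where "local_upto scale N p D (r i) (A i)" using loc i by blast
        then obtain f where f: "polyseq N f"
          "\<And>m' n. m' + n = m + j \<Longrightarrow> m' \<ge> 0 \<or> n \<ge> 0 \<Longrightarrow>
            f m' = mixed_sign m' n * \<phi> (field_commutator p D (r i) (A i) m' n u)"
          using \<phi> unfolding local_upto_def delta_like_def delta_like_at_def delta_witnesses_def by blast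
        (* N consecutive points k on the line with k < 0 and m + j - k >= 0 *)
        define b where "b = min (- 1) (m + j) - int N"
        have "f k = 0" if "b \<le> k" "k < b + int N" for k
        proof -
          have k: "k < 0" "m + j - k \<ge> 0" using that by (auto simp: b_def)
          have "field_commutator p D (r i) (A i) k (m + j - k) u = 0"
            by (simp add: field_commutator_def neg[OF k(1)] field_zero[OF generator_field[OF i]])
          then show ?thesis using f(2)[of k "m + j - k"] k by (simp add: functional_zero[OF \<phi>])
        qed
        then have "f m = 0" using polyseq_eq_zero[OF f(1)] by metis
        then show "\<phi> (field_commutator p D (r i) (A i) m j u) = 0"
          using f(2)[of m j] m j by (simp add: mixed_sign_def)
      qed
      then show "D m (A i j u) = 0"
        using u by (simp add: field_commutator_def basis_degree_def field_zero[OF generator_field[OF i]]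
            koszul_def split: if_splits)
    qed
  qed
qed

lemma state_field_unique:
  assumes "creates p a X" "creates p a Y"
    and locX: "\<And>i. i \<in> I \<Longrightarrow> \<exists>N. local_upto scale N p X (r i) (A i)"
    and locY: "\<And>i. i \<in> I \<Longrightarrow> \<exists>N. local_upto scale N p Y (r i) (A i)"
  shows "X = Y"
proof -
  (* X - Y, written so that closure of local fields under sums and multiples applies *)
  let ?D = "\<lambda>m v. X m v + scale (- 1) (Y m v)"
  have sY: "creates p (scale (- 1) a) (\<lambda>m v. scale (- 1) (Y m v))"
    by (rule state_field_scale[OF assms(2) T_linear])
  have "creates p (a + scale (- 1) a) ?D"
    by (rule state_field_add[OF assms(1) sY T_linear])
  then have D: "raviolo_field scale ?D"
    using homogeneous_field_field unfolding state_field_def by blast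
  have "?D m v = 0" for m v
  proof (rule local_field_eq_zero[OF D])
    fix i assume i: "i \<in> I"
    obtain N M where NM: "local_upto scale N p X (r i) (A i)" "local_upto scale M p Y (r i) (A i)"
      using locX locY i by blast
    note NM' = local_upto_common[OF NM]
    show "\<exists>N. local_upto scale N p ?D (r i) (A i)"
      using local_upto_add[OF generator_field[OF i] NM'(1)
          local_upto_scale[OF vector_space_axioms generator_field[OF i] NM'(2)]] by blast
  next
    show "?D m vac = 0" for m
      using state_field_vacuum_modes[OF assms(1,2) T_linear T_vac, of m] by simp
  qed
  then show ?thesis by (simp add: fun_eq_iff)
qed

section \<open>The vertex algebra\<close>

definition word_factors :: "('i \<times> int) list \<Rightarrow> (int \<times> 'v modes) list" where
  "word_factors ws = map (\<lambda>(i, j). (r i, (field_deriv scale ^^ nat (- j - 1)) (A i))) ws"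

definition word_factorial :: "('i \<times> int) list \<Rightarrow> complex" where
  "word_factorial ws = (\<Prod>(i, j)\<leftarrow>ws. fact (nat (- j - 1)))"

lemma word_field_eq:
  "word_field scale r A ws = (\<lambda>m v. scale (1 / word_factorial ws) (normal_ordered_list (word_factors ws) m v))"
  by (simp add: word_field_def word_factors_def word_factorial_def)

lemma word_factorial_nonzero: "word_factorial ws \<noteq> 0"
  by (induction ws) (auto simp: word_factorial_def)

lemma sum_word_factors: "sum_list (map fst (word_factors ws)) = word_degree ws"
  by (induction ws) (auto simp: word_factors_def word_degree_def)

lemma generator_state_field: "i \<in> I \<Longrightarrow> creates (r i) (A i (-1) vac) (A i)"
  by (simp add: state_field_def generator_homogeneous generator_covariant generator_vac)

lemma word_factors_cases:
  assumes "(p, X) \<in> set (word_factors ws)" "admissible ws"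
  obtains i k where "i \<in> I" "p = r i" "X = (field_deriv scale ^^ k) (A i)"
proof -
  obtain i j where "(i, j) \<in> set ws" "p = r i" "X = (field_deriv scale ^^ nat (- j - 1)) (A i)"
    using assms(1) by (auto simp: word_factors_def)
  then show ?thesis using that[of i "nat (- j - 1)"] assms(2) by (auto simp: admissible_def)
qed

lemma funpow_deriv_field: "raviolo_field scale X \<Longrightarrow> raviolo_field scale ((field_deriv scale ^^ k) X)"
  by (induction k) (simp_all add: raviolo_field_deriv)

lemma word_factors_field:
  "(p, X) \<in> set (word_factors ws) \<Longrightarrow> admissible ws \<Longrightarrow> raviolo_field scale X"
  by (erule (1) word_factors_cases) (simp add: funpow_deriv_field generator_field)

lemma local_funpow_deriv:
  assumes B: "raviolo_field scale B" and "\<exists>N. local_upto scale N p X q B"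
  shows "\<exists>N. local_upto scale N p ((field_deriv scale ^^ k) X) q B"
proof (induction k)
  case (Suc k)
  then obtain N where "local_upto scale N p ((field_deriv scale ^^ k) X) q B" by blast
  from local_upto_field_deriv[OF vector_space_axioms B this]
  have "local_upto scale (Suc N) p ((field_deriv scale ^^ Suc k) X) q B" by simp
  then show ?case by blast
qed (use assms(2) in simp)

lemma ex_local_upto_swap:
  assumes "\<exists>N. local_upto scale N p X q Z"
  shows "\<exists>N. local_upto scale N q Z p X"
proof -
  obtain N where "local_upto scale N p X q Z" using assms by blast
  from local_upto_swap[OF this] show ?thesis by blast
qed

lemma derivatives_local:
  assumes "i \<in> I" "j \<in> I"
  shows "\<exists>N. local_upto scale N (r i) ((field_deriv scale ^^ k) (A i)) (r j) ((field_deriv scale ^^ l) (A j))"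
proof -
  have "\<exists>N. local_upto scale N (r j) ((field_deriv scale ^^ l) (A j)) (r i) (A i)"
    by (rule local_funpow_deriv[OF generator_field[OF assms(1)] generators_local[OF assms(2,1)]])
  then have "\<exists>N. local_upto scale N (r i) (A i) (r j) ((field_deriv scale ^^ l) (A j))"
    by (rule ex_local_upto_swap)
  then show ?thesis
    by (rule local_funpow_deriv[OF funpow_deriv_field[OF generator_field[OF assms(2)]]])
qed

lemma state_field_id: "creates 0 vac id_field"
proof -
  interpret T: Vector_Spaces.linear scale scale T by (rule T_linear)
  have "homogeneous_raviolo_field scale V 0 id_field"
    using id_field_field field_linear[OF id_field_field]
    by (auto simp: homogeneous_raviolo_field_def homogeneous_endo_def id_field_def basis_degree_def zero_component)
  moreover have "translation_covariant scale T id_field"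
    by (auto simp: translation_covariant_def id_field_def field_deriv_def T.zero)
  ultimately show ?thesis by (simp add: state_field_def id_field_def)
qed

lemma state_field_word_factors:
  "admissible ws \<Longrightarrow> creates (word_degree ws)
     (scale (word_factorial ws) (word_vector A vac ws)) (normal_ordered_list (word_factors ws))"
proof (induction ws)
  case Nil
  show ?case
    using state_field_id by (simp add: word_factors_def word_degree_def word_factorial_def word_vector_def)
next
  case (Cons w ws)
  obtain i j where w: "w = (i, j)" by (cases w)
  then have i: "i \<in> I" "j < 0" "admissible ws" using Cons.prems by (auto simp: admissible_Cons)
  define k where "k = nat (- j - 1)"
  let ?X = "(field_deriv scale ^^ k) (A i)" and ?v = "scale (word_factorial ws) (word_vector A vac ws)"
  have factors: "word_factors (w # ws) = (r i, ?X) # word_factors ws"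
    by (simp add: word_factors_def w k_def)
  have X: "creates (r i) (?X (-1) vac) ?X"
    by (rule state_field_funpow_deriv[OF T_linear generator_state_field[OF i(1)]])
  have "?X (-1) ?v = scale (fact k) (A i j ?v)"
    using funpow_field_deriv_mode[of k "A i" 0 ?v] i(2) by (simp add: k_def)
  also have "\<dots> = scale (word_factorial (w # ws)) (word_vector A vac (w # ws))"
    by (simp add: w word_vector_Cons field_scale[OF generator_field[OF i(1)]] word_factorial_def k_def)
  finally have v: "?X (-1) ?v = \<dots>" .
  have "creates (r i + word_degree ws) (?X (-1) ?v)
      (normal_ordered (r i) ?X (word_degree ws) (normal_ordered_list (word_factors ws)))"
    by (rule state_field_normal_ordered[OF T_linear X Cons.IH[OF i(3)]])
  then show ?case
    unfolding v factors normal_ordered_list_Cons[OF funpow_deriv_field[OF generator_field[OF i(1)]]]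
    by (simp add: sum_word_factors word_degree_def w)
qed

lemma state_field_word:
  assumes "admissible ws"
  shows "creates (word_degree ws) (word_vector A vac ws) (word_field scale r A ws)"
  using state_field_scale[OF state_field_word_factors[OF assms] T_linear, of "1 / word_factorial ws"]
  by (simp add: word_field_eq word_factorial_nonzero)

lemma state_field_field: "creates p a X \<Longrightarrow> raviolo_field scale X"
  by (simp add: state_field_def homogeneous_raviolo_field_def)

lemma word_factors_product_field:
  "admissible ws \<Longrightarrow> raviolo_field scale (normal_ordered_list (word_factors ws))"
  by (rule state_field_field[OF state_field_word_factors])

lemma word_fields_local:
  assumes "admissible ws" "admissible us"
  shows "\<exists>N. local_upto scale N (word_degree ws) (word_field scale r A ws) (word_degree us) (word_field scale r A us)"
proof -
  let ?W = "normal_ordered_list (word_factors ws)" and ?U = "normal_ordered_list (word_factors us)"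
  have pair: "\<exists>N. local_upto scale N p X q Z"
    if h: "(p, X) \<in> set (word_factors ws')" "(q, Z) \<in> set (word_factors us')" "admissible ws'" "admissible us'" for p X q Z ws' us'
  proof -
    obtain i k where "i \<in> I" "p = r i" "X = (field_deriv scale ^^ k) (A i)"
      using word_factors_cases[OF h(1,3)] by blast
    moreover obtain j l where "j \<in> I" "q = r j" "Z = (field_deriv scale ^^ l) (A j)"
      using word_factors_cases[OF h(2,4)] by blast
    ultimately show ?thesis using derivatives_local by simp
  qed
  have WX: "\<exists>N. local_upto scale N (word_degree ws) ?W q Z" if "(q, Z) \<in> set (word_factors us)" for q Z
    unfolding sum_word_factors[symmetric]
  proof (rule normal_ordered_list_local)
    show "raviolo_field scale Z" using that assms(2) by (rule word_factors_field)
      show "raviolo_field scale X" if "(p, X) \<in> set (word_factors ws)" for p X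
      using that assms(1) by (rule word_factors_field)
    show "\<exists>N. local_upto scale N p X q' Z'"
      if "(p, X) \<in> set (word_factors ws)" "(q', Z') \<in> set (word_factors ws)" for p X q' Z'
      using that assms(1,1) by (rule pair)
    show "\<exists>N. local_upto scale N p X q Z" if h: "(p, X) \<in> set (word_factors ws)" for p X
      using h \<open>(q, Z) \<in> set (word_factors us)\<close> assms by (rule pair)
  qed
  have "\<exists>N. local_upto scale N (word_degree us) ?U (word_degree ws) ?W"
    unfolding sum_word_factors[of us, symmetric]
  proof (rule normal_ordered_list_local)
    show "raviolo_field scale ?W" by (rule word_factors_product_field[OF assms(1)])
    show "\<exists>N. local_upto scale N q Z (word_degree ws) ?W" if "(q, Z) \<in> set (word_factors us)" for q Z
      using WX[OF that] by (rule ex_local_upto_swap)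
      show "raviolo_field scale X" if "(p, X) \<in> set (word_factors us)" for p X
      using that assms(2) by (rule word_factors_field)
    show "\<exists>N. local_upto scale N p X q' Z'"
      if "(p, X) \<in> set (word_factors us)" "(q', Z') \<in> set (word_factors us)" for p X q' Z'
      using that assms(2,2) by (rule pair)
  qed
  then obtain N where "local_upto scale N (word_degree us) ?U (word_degree ws) ?W" by blast
  from local_upto_scale[OF vector_space_axioms word_factors_product_field[OF assms(1)] this]
  have "local_upto scale N (word_degree us) (word_field scale r A us) (word_degree ws) ?W"
    by (simp add: word_field_eq)
  then have "local_upto scale N (word_degree ws) ?W (word_degree us) (word_field scale r A us)"
    by (rule local_upto_swap)
  from local_upto_scale[OF vector_space_axioms state_field_field[OF state_field_word[OF assms(2)]] this]
  show ?thesis unfolding word_field_eq[of ws] by blast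
qed

lemma state_field_degree:
  assumes "creates p a X"
  shows "a \<in> V p"
proof -
  have "X (-1) vac \<in> V (0 + (p - basis_degree (-1)))"
    by (rule homogeneous_field_degree) (use assms vac_degree in \<open>auto simp: state_field_def\<close>)
  then show ?thesis using assms by (simp add: state_field_def basis_degree_def)
qed

lemma word_field_singleton: "word_field scale r A [(i, -1)] = A i"
  by (simp add: word_field_def)

lemma word_degree_singleton: "word_degree [(i, j)] = r i"
  by (simp add: word_degree_def)

definition words_of_degree :: "int \<Rightarrow> 'v set" where
  "words_of_degree p = {word_vector A vac ws |ws. admissible ws \<and> word_degree ws = p}"

text \<open>
  Words are homogeneous, so the projection to the component of degree \<open>p\<close> maps a word to itself or to zero.
\<close>

lemma homogeneous_span_words:
  assumes "v \<in> V p"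
  shows "v \<in> span (words_of_degree p)"
proof -
  have "component v p \<in> span (words_of_degree p)" if "v \<in> span {word_vector A vac ws |ws. admissible ws}" for v
    using that
  proof (induction rule: span_induct_alt)
    case base
    show ?case by (simp add: component_zero span_zero)
  next
    case (step c x y)
    from step(1) obtain ws where ws: "x = word_vector A vac ws" "admissible ws" by blast
    have "x \<in> V (word_degree ws)" using state_field_degree[OF state_field_word[OF ws(2)]] ws(1) by simp
    from component_homogeneous[OF this]
    have "component x p \<in> span (words_of_degree p)"
      using ws by (auto simp: words_of_degree_def span_zero intro: span_base)
    then show ?case using step(2) by (simp add: component_add component_scale span_add span_scale)
  qed
  then show ?thesis using component_homogeneous[OF assms] span_admissible_words by (metis UNIV_I)
qed

text \<open>
  The generators are among the word fields, as words with a single letter.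
\<close>

definition local_state_field :: "int \<Rightarrow> 'v \<Rightarrow> 'v modes \<Rightarrow> bool" where
  "local_state_field p a X \<longleftrightarrow> creates p a X \<and>
     (\<forall>ws. admissible ws \<longrightarrow> (\<exists>N. local_upto scale N p X (word_degree ws) (word_field scale r A ws)))"

lemma local_state_field_add:
  assumes "local_state_field p a X" "local_state_field p b Z"
  shows "local_state_field p (a + b) (\<lambda>m v. X m v + Z m v)"
  unfolding local_state_field_def
proof (intro conjI allI impI)
  show "creates p (a + b) (\<lambda>m v. X m v + Z m v)"
    using assms by (intro state_field_add T_linear) (auto simp: local_state_field_def)
  fix ws assume ws: "admissible ws"
  then obtain N M where "local_upto scale N p X (word_degree ws) (word_field scale r A ws)"
    "local_upto scale M p Z (word_degree ws) (word_field scale r A ws)"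
    using assms unfolding local_state_field_def by blast
  from local_upto_add[OF state_field_field[OF state_field_word[OF ws]] local_upto_common[OF this]]
  show "\<exists>N. local_upto scale N p (\<lambda>m v. X m v + Z m v) (word_degree ws) (word_field scale r A ws)" by blast
qed

lemma local_state_field_scale:
  assumes "local_state_field p a X"
  shows "local_state_field p (scale c a) (\<lambda>m v. scale c (X m v))"
  unfolding local_state_field_def
proof (intro conjI allI impI)
  show "creates p (scale c a) (\<lambda>m v. scale c (X m v))"
    using assms by (intro state_field_scale T_linear) (auto simp: local_state_field_def)
  fix ws assume ws: "admissible ws"
  then obtain N where "local_upto scale N p X (word_degree ws) (word_field scale r A ws)"
    using assms unfolding local_state_field_def by blast
  from local_upto_scale[OF vector_space_axioms state_field_field[OF state_field_word[OF ws]] this]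
  show "\<exists>N. local_upto scale N p (\<lambda>m v. scale c (X m v)) (word_degree ws) (word_field scale r A ws)" by blast
qed

lemma local_upto_zero:
  assumes "raviolo_field scale C"
  shows "local_upto scale N p (\<lambda>m v. 0) q C"
  by (simp add: local_upto_def field_commutator_def field_zero[OF assms] functional_zero delta_like_zero)

lemma local_state_field_zero: "local_state_field p 0 (\<lambda>m v. 0)"
proof -
  interpret T: Vector_Spaces.linear scale scale T by (rule T_linear)
  have "creates p 0 (\<lambda>m v. 0)"
    by (auto simp: state_field_def homogeneous_raviolo_field_def raviolo_field_def homogeneous_endo_def
        translation_covariant_def field_deriv_def zero_component T.zero intro!: linearI)
  then show ?thesis
    using local_upto_zero state_field_field[OF state_field_word] by (auto simp: local_state_field_def)
qed

lemma local_state_field_word: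
  "admissible ws \<Longrightarrow> local_state_field (word_degree ws) (word_vector A vac ws) (word_field scale r A ws)"
  by (simp add: local_state_field_def state_field_word word_fields_local)

lemma local_state_field_generator:
  assumes "local_state_field p a X" "i \<in> I"
  shows "\<exists>N. local_upto scale N p X (r i) (A i)"
proof -
  have "admissible [(i, -1)]" using assms(2) by (simp add: admissible_def)
  then show ?thesis
    using assms(1) word_field_singleton[of i] word_degree_singleton[of i "-1"]
    unfolding local_state_field_def by metis
qed

lemma local_state_field_unique:
  assumes "local_state_field p a X" "local_state_field p a Z"
  shows "X = Z"
proof (rule state_field_unique)
  show "creates p a X" "creates p a Z"
    using assms by (simp_all add: local_state_field_def)
  show "\<exists>N. local_upto scale N p X (r i) (A i)" "\<exists>N. local_upto scale N p Z (r i) (A i)" if "i \<in> I" for i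
    using assms that by (auto intro: local_state_field_generator)
qed

text \<open>
  Words have word fields, and the existing pairs of vectors and fields form a linear subspace.
\<close>

lemma local_state_field_exists:
  assumes "a \<in> V p"
  shows "\<exists>X. local_state_field p a X"
  using homogeneous_span_words[OF assms]
proof (induction rule: span_induct_alt)
  case base
  show ?case using local_state_field_zero by blast
next
  case (step c x y)
  from step(1) obtain ws where "x = word_vector A vac ws" "admissible ws" "word_degree ws = p"
    by (auto simp: words_of_degree_def)
  then have "local_state_field p x (word_field scale r A ws)" using local_state_field_word by blast
  then show ?case using step(2) local_state_field_add local_state_field_scale by blast
qed

definition homogeneous_field_of :: "int \<Rightarrow> 'v \<Rightarrow> 'v modes" where
  "homogeneous_field_of p a = (SOME X. local_state_field p a X)"

lemma homogeneous_field_of: "a \<in> V p \<Longrightarrow> local_state_field p a (homogeneous_field_of p a)"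
  unfolding homogeneous_field_of_def
  using someI_ex[of "local_state_field p a"] local_state_field_exists by blast

lemma homogeneous_field_of_eqI: "local_state_field p a X \<Longrightarrow> homogeneous_field_of p a = X"
  using homogeneous_field_of local_state_field_unique state_field_degree unfolding local_state_field_def
  by blast

lemma homogeneous_field_of_zero: "homogeneous_field_of p 0 = (\<lambda>m v. 0)"
  by (rule homogeneous_field_of_eqI) (rule local_state_field_zero)

text \<open>
  For a fixed first vector, locality holds with all word fields and passes to their linear combinations.
\<close>

lemma homogeneous_field_of_local:
  assumes a: "a \<in> V p" and b: "b \<in> V q"
  shows "\<exists>N. local_upto scale N p (homogeneous_field_of p a) q (homogeneous_field_of q b)"
proof -
  let ?X = "homogeneous_field_of p a"
  have X: "raviolo_field scale ?X"
    using homogeneous_field_of[OF a] state_field_field by (auto simp: local_state_field_def)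
  have "\<exists>Z N. local_state_field q b Z \<and> local_upto scale N q Z p ?X"
    using homogeneous_span_words[OF b]
  proof (induction rule: span_induct_alt)
    case base
    show ?case using local_state_field_zero local_upto_zero[OF X] by blast
  next
    case (step c x y)
    from step(1) obtain ws where ws: "x = word_vector A vac ws" "admissible ws" "word_degree ws = q"
      by (auto simp: words_of_degree_def)
    let ?W = "word_field scale r A ws"
    have W: "local_state_field q x ?W" using ws local_state_field_word by blast
    obtain N where "local_upto scale N p ?X q ?W"
      using homogeneous_field_of[OF a] ws unfolding local_state_field_def by blast
    then have NW: "local_upto scale N q (\<lambda>m v. scale c (?W m v)) p ?X"
      by (rule local_upto_scale[OF vector_space_axioms X local_upto_swap])
    obtain Z M where Z: "local_state_field q y Z" "local_upto scale M q Z p ?X" using step(2) by blast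
    have "local_upto scale (max N M) q (\<lambda>m v. scale c (?W m v) + Z m v) p ?X"
      by (rule local_upto_add[OF X local_upto_common[OF NW Z(2)]])
    then show ?case using local_state_field_add[OF local_state_field_scale[OF W] Z(1)] by blast
  qed
  then obtain Z N where "local_state_field q b Z" "local_upto scale N q Z p ?X" by blast
  then have "\<exists>N. local_upto scale N q (homogeneous_field_of q b) p ?X"
    using homogeneous_field_of_eqI by metis
  then show ?thesis by (rule ex_local_upto_swap)
qed

definition state_field_map :: "'v \<Rightarrow> 'v modes" where
  "state_field_map b = (\<lambda>m v. \<Sum>p | component b p \<noteq> 0. homogeneous_field_of p (component b p) m v)"

lemma state_field_map_sum:
  assumes "finite S" "{p. component b p \<noteq> 0} \<subseteq> S"
  shows "state_field_map b m v = (\<Sum>p\<in>S. homogeneous_field_of p (component b p) m v)"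
  unfolding state_field_map_def
  by (rule sum.mono_neutral_left) (use assms in \<open>auto simp: homogeneous_field_of_zero\<close>)

lemma state_field_map_homogeneous:
  assumes "b \<in> V p"
  shows "state_field_map b = homogeneous_field_of p b"
proof (intro ext)
  fix m v
  show "state_field_map b m v = homogeneous_field_of p b m v"
    using component_homogeneous[OF assms]
    by (subst state_field_map_sum[of "{p}"]) auto
qed

lemma state_field_map_word:
  "admissible ws \<Longrightarrow> state_field_map (word_vector A vac ws) = word_field scale r A ws"
  using state_field_map_homogeneous[OF state_field_degree[OF state_field_word]]
    homogeneous_field_of_eqI[OF local_state_field_word] by simp

lemma homogeneous_field_of_add:
  "a \<in> V p \<Longrightarrow> b \<in> V p \<Longrightarrow> homogeneous_field_of p (a + b) =
     (\<lambda>m v. homogeneous_field_of p a m v + homogeneous_field_of p b m v)"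
  by (intro homogeneous_field_of_eqI local_state_field_add homogeneous_field_of)

lemma homogeneous_field_of_scale:
  "a \<in> V p \<Longrightarrow> homogeneous_field_of p (scale c a) = (\<lambda>m v. scale c (homogeneous_field_of p a m v))"
  by (intro homogeneous_field_of_eqI local_state_field_scale homogeneous_field_of)

lemma state_field_map_linear: "Vector_Spaces.linear scale scale (\<lambda>b. state_field_map b m v)"
proof (rule linearI)
  fix a b
  let ?S = "{p. component a p \<noteq> 0} \<union> {p. component b p \<noteq> 0}"
  have S: "finite ?S" using component(2) by simp
  show "state_field_map (a + b) m v = state_field_map a m v + state_field_map b m v"
    using S by (subst (1 2 3) state_field_map_sum[OF S])
      (auto simp: component_add homogeneous_field_of_add component(1) sum.distrib)
next
  fix c b
  let ?S = "{p. component b p \<noteq> 0}"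
  have S: "finite ?S" using component(2) by simp
  show "state_field_map (scale c b) m v = scale c (state_field_map b m v)"
    using S by (subst (1 2) state_field_map_sum[OF S])
      (auto simp: component_scale homogeneous_field_of_scale component(1) scale_sum_right)
qed

lemma homogeneous_field_of_state_field:
  "a \<in> V p \<Longrightarrow> creates p a (homogeneous_field_of p a)"
  using homogeneous_field_of by (simp add: local_state_field_def)

lemma state_field_map_field: "raviolo_field scale (state_field_map b)"
proof -
  have F: "raviolo_field scale (homogeneous_field_of p (component b p))" for p
    by (rule state_field_field[OF homogeneous_field_of_state_field[OF component(1)]])
  have "Vector_Spaces.linear scale scale (state_field_map b m)" for m
    unfolding state_field_map_def
    by (rule linearI) (simp_all add: field_add[OF F] field_scale[OF F] sum.distrib scale_sum_right)
  moreover have "\<exists>N. \<forall>m\<ge>N. state_field_map b m v = 0" for v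
  proof -
    have "\<exists>N. \<forall>m\<ge>N. (\<Sum>p\<in>S. homogeneous_field_of p (component b p) m v) = 0" if "finite S" for S
      using that
    proof (induction S rule: finite_induct)
      case (insert p S)
      have "\<exists>N. \<forall>m\<ge>N. homogeneous_field_of p (component b p) m v +
          (\<Sum>p\<in>S. homogeneous_field_of p (component b p) m v) = 0"
        by (rule bounded_pointwise[OF field_bounded[OF F[of p], of v] insert.IH]) simp
      then show ?case using insert by simp
    qed simp
    from this[OF component(2)[of b]] show ?thesis by (simp add: state_field_map_def)
  qed
  ultimately show ?thesis by (simp add: raviolo_field_def)
qed

theorem state_field_map_vertex_algebra: "raviolo_vertex_algebra scale V vac T state_field_map"
proof (intro raviolo_vertex_algebra.intro raviolo_vertex_algebra_axioms.intro graded_vector_space_axioms)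
  interpret T: Vector_Spaces.linear scale scale T by (rule T_linear)
  note sf = homogeneous_field_of_state_field[OF component(1)]
  show "vac \<in> V 0" "homogeneous_endo scale V 0 T" "T vac = 0" by (fact vac_degree T_endo T_vac)+
  show "Vector_Spaces.linear scale scale (\<lambda>a. state_field_map a m v)" for m v
    by (rule state_field_map_linear)
  show "raviolo_field scale (state_field_map a)" for a by (rule state_field_map_field)
  show "homogeneous_raviolo_field scale V p (state_field_map a)" if "a \<in> V p" for a p
    using homogeneous_field_of_state_field[OF that] state_field_map_homogeneous[OF that]
    by (simp add: state_field_def)
  show "T (state_field_map a m v) - state_field_map a m (T v) = field_deriv scale (state_field_map a) m v" for a m v
  proof -
    have "T (homogeneous_field_of p (component a p) m v) - homogeneous_field_of p (component a p) m (T v) =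
        scale (- of_int m) (homogeneous_field_of p (component a p) (m - 1) v)" for p
      using sf[of p a] unfolding state_field_def translation_covariant_def field_deriv_def by blast
    then show ?thesis
      unfolding state_field_map_def field_deriv_def T.sum sum_subtractf[symmetric] scale_sum_right by simp
  qed
  show "state_field_map vac = id_field"
    using state_field_map_word[of "[]"] by (simp add: admissible_def word_vector_def word_field_def)
  show "state_field_map a m vac = 0" if "m \<ge> 0" for a m
    unfolding state_field_map_def by (rule sum.neutral) (use sf that in \<open>auto simp: state_field_def\<close>)
  show "state_field_map a (- 1) vac = a" for a
  proof -
    have "homogeneous_field_of p (component a p) (- 1) vac = component a p" for p
      using sf[of p a] by (simp add: state_field_def)
    then show ?thesis using component(3)[of a] by (simp add: state_field_map_def)
  qed
  show "mutually_local scale p (state_field_map a) q (state_field_map b)" if ab: "a \<in> V p" "b \<in> V q" for a b p q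
  proof -
    obtain N where "local_upto scale N p (homogeneous_field_of p a) q (homogeneous_field_of q b)"
      using homogeneous_field_of_local[OF ab] by blast
    then show ?thesis
      unfolding state_field_map_homogeneous[OF ab(1)] state_field_map_homogeneous[OF ab(2)]
      by (rule local_upto_imp_mutually_local)
        (use ab homogeneous_field_of_state_field state_field_field in blast)+
  qed
qed

lemma state_field_map_unique:
  assumes lin: "\<And>m v. Vector_Spaces.linear scale scale (\<lambda>b. Y b m v)"
    and words: "\<And>ws. admissible ws \<Longrightarrow> Y (word_vector A vac ws) = word_field scale r A ws"
  shows "Y = state_field_map"
proof (intro ext)
  fix b m v
  interpret Y: Vector_Spaces.linear scale scale "\<lambda>b. Y b m v" by (rule lin)
  interpret Y': Vector_Spaces.linear scale scale "\<lambda>b. state_field_map b m v" by (rule state_field_map_linear)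
  have "Y b m v - state_field_map b m v = 0"
  proof (rule eq_zero_if_zero_on_words[of "\<lambda>b. Y b m v - state_field_map b m v"])
    show "Vector_Spaces.linear scale scale (\<lambda>b. Y b m v - state_field_map b m v)"
      by (rule linearI) (simp_all add: Y.add Y'.add Y.scale Y'.scale scale_right_diff_distrib)
  qed (simp add: words state_field_map_word)
  then show "Y b m v = state_field_map b m v" by simp
qed

text \<open>
  A field \<open>Y(b,z)\<close> of any such vertex algebra is local to the generators, so by uniqueness it is the word field
  when \<open>b\<close> is a word.
\<close>

theorem vertex_algebra_unique:
  assumes Y: "raviolo_vertex_algebra scale V vac T Y" and gen: "\<And>i. i \<in> I \<Longrightarrow> Y (A i (-1) vac) = A i"
  shows "Y = state_field_map"
proof (rule state_field_map_unique)
  interpret Y: raviolo_vertex_algebra scale V vac T Y by (rule Y)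
  show "Vector_Spaces.linear scale scale (\<lambda>b. Y b m v)" for m v by (rule Y.Y_linear)
  fix ws assume ws: "admissible ws"
  let ?a = "word_vector A vac ws"
  have a: "?a \<in> V (word_degree ws)" by (rule state_field_degree[OF state_field_word[OF ws]])
  show "Y ?a = word_field scale r A ws"
  proof (rule state_field_unique)
    show "creates (word_degree ws) ?a (Y ?a)"
      using Y.Y_homogeneous[OF a] Y.translation Y.creation
      by (simp add: state_field_def translation_covariant_def)
    show "creates (word_degree ws) ?a (word_field scale r A ws)"
      by (rule state_field_word[OF ws])
    fix i assume i: "i \<in> I"
    have "A i (-1) vac \<in> V (r i)" by (rule state_field_degree[OF generator_state_field[OF i]])
    from Y.locality[OF a this] show "\<exists>N. local_upto scale N (word_degree ws) (Y ?a) (r i) (A i)"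
      unfolding gen[OF i] by (rule mutually_local_imp_local_upto) blast
    show "\<exists>N. local_upto scale N (word_degree ws) (word_field scale r A ws) (r i) (A i)"
      by (rule local_state_field_generator[OF local_state_field_word[OF ws] i])
  qed
qed

end

theorem proposition4p0p1:
  fixes scale :: "complex \<Rightarrow> 'v::ab_group_add \<Rightarrow> 'v"
    and V :: "int \<Rightarrow> 'v set"
    and vac :: 'v
    and T :: "'v \<Rightarrow> 'v"
    and I :: "'i::linorder set"
    and a :: "'i \<Rightarrow> 'v"
    and r :: "'i \<Rightarrow> int"
    and A :: "'i \<Rightarrow> int \<Rightarrow> 'v \<Rightarrow> 'v"
  assumes "graded_vector_space scale V"
    and "vac \<in> V 0" and "vac \<noteq> 0"
    and "homogeneous_endo scale V 0 T"
    and "countable I"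
    and "\<And>i. i \<in> I \<Longrightarrow> a i \<in> V (r i)"
    and "\<And>i. i \<in> I \<Longrightarrow> homogeneous_raviolo_field scale V (r i) (A i)"
    and "\<And>i. i \<in> I \<Longrightarrow> A i (-1) vac = a i"
    and "\<And>i m. i \<in> I \<Longrightarrow> m \<ge> 0 \<Longrightarrow> A i m vac = 0"
    and "T vac = 0"
    and "\<And>i m v. i \<in> I \<Longrightarrow> T (A i m v) - A i m (T v) = field_deriv scale (A i) m v"
    and "\<And>i j. i \<in> I \<Longrightarrow> j \<in> I \<Longrightarrow> mutually_local scale (r i) (A i) (r j) (A j)"
    and "module.span scale {word_vector A vac ws |ws. \<forall>(i, j)\<in>set ws. i \<in> I \<and> j < 0} = UNIV"
  shows "\<exists>Y.
      (\<forall>ws. (\<forall>(i, j)\<in>set ws. i \<in> I \<and> j < 0) \<longrightarrow> Y (word_vector A vac ws) = word_field scale r A ws) \<and>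
      raviolo_vertex_algebra scale V vac T Y \<and>
      (\<forall>Y'. (\<forall>m v. Vector_Spaces.linear scale scale (\<lambda>b. Y' b m v)) \<and>
          (\<forall>ws. (\<forall>(i, j)\<in>set ws. i \<in> I \<and> j < 0) \<longrightarrow> Y' (word_vector A vac ws) = word_field scale r A ws)
        \<longrightarrow> Y' = Y) \<and>
      (\<forall>i\<in>I. Y (a i) = A i) \<and>
      (\<forall>Y'. raviolo_vertex_algebra scale V vac T Y' \<and> (\<forall>i\<in>I. Y' (a i) = A i) \<longrightarrow> Y' = Y)"
proof -
  interpret graded_vector_space scale V by fact
  interpret generating_fields scale V vac T I r A
  proof
    show "\<exists>N. local_upto scale N (r i) (A i) (r j) (A j)" if "i \<in> I" "j \<in> I" for i j
      using assms(12)[OF that] by (rule mutually_local_imp_local_upto) blast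
    show "translation_covariant scale T (A i)" if "i \<in> I" for i
      using assms(11)[OF that] by (simp add: translation_covariant_def)
  qed (use assms in auto)
  show ?thesis
  proof (intro exI[of _ state_field_map] conjI allI impI ballI)
    fix ws :: "('i \<times> int) list" assume "\<forall>(i, j)\<in>set ws. i \<in> I \<and> j < 0"
    then show "state_field_map (word_vector A vac ws) = word_field scale r A ws"
      by (intro state_field_map_word) (simp add: admissible_def)
  next
    show "raviolo_vertex_algebra scale V vac T state_field_map" by (rule state_field_map_vertex_algebra)
  next
    fix Y' assume "(\<forall>m v. Vector_Spaces.linear scale scale (\<lambda>b. Y' b m v)) \<and>
          (\<forall>ws. (\<forall>(i, j)\<in>set ws. i \<in> I \<and> j < 0) \<longrightarrow> Y' (word_vector A vac ws) = word_field scale r A ws)"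
    then show "Y' = state_field_map" by (intro state_field_map_unique) (auto simp: admissible_def)
  next
    fix i assume i: "i \<in> I"
    then have "state_field_map (word_vector A vac [(i, -1)]) = A i"
      by (subst state_field_map_word) (simp_all add: admissible_def word_field_singleton)
    then show "state_field_map (a i) = A i" using assms(8)[OF i] by (simp add: word_vector_def)
  next
    fix Y' assume "raviolo_vertex_algebra scale V vac T Y' \<and> (\<forall>i\<in>I. Y' (a i) = A i)"
    then show "Y' = state_field_map" by (intro vertex_algebra_unique) (auto simp: assms(8))
  qed
qed

end
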